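(* There exists a Jacobi form of singular weight for $A_2$, namely $$\sigma_{A_2}(\tau,z_1,z_2)=\frac{\vartheta(\tau,z_1)\vartheta(\tau,z_2)\vartheta(\tau,z_1+z_2)}{\eta(\tau)}\in J_{1,A_2}(v_\eta^8).$$ In particular, the Jacobi form of singular weight $$\sigma_{3A_2}=\sigma_{A_2}^{[3]}=\sigma_{A_2}(\tau,\mathfrak Z_1)\sigma_{A_2}(\tau,\mathfrak Z_2)\sigma_{A_2}(\tau,\mathfrak Z_3)\in J_{3,3A_2}$$ has trivial character.
   Context: **Jacobi forms of index one.** Let $L$ be a positive definite even lattice with form $(\cdot,\cdot)$ (extended bilinearly to $L\otimes\mathbb C$) and dual $L^\vee$. $v_\eta$ is the multiplier system of the Dedekind eta function: $\eta(\frac{a\tau+b}{c\tau+d})=v_\eta(A)(c\tau+d)^{1/2}\eta(\tau)$. For $k\in\frac12\mathbb Z$, $D\in\mathbb Z$, $J_{k,L}(v_\eta^D)$ is the space of holomorphic $\varphi:\mathbb H\times(L\otimes\mathbb C)\to\mathbb C$ such that $\varphi(\frac{a\tau+b}{c\tau+d},\frac{\mathfrak Z}{c\tau+d})=v_\eta^D(A)(c\tau+d)^ke^{\pi i\frac{c(\mathfrak Z,\mathfrak Z)}{c\tau+d}}\varphi(\tau,\mathfrak Z)$ for all $A=\begin{pmatrix}a&b\\c&d\end{pmatrix}\in\mathrm{SL}_2(\mathbb Z)$, $\varphi(\tau,\mathfrak Z+x\tau+y)=e^{-\pi i((x,x)\tau+2(x,\mathfrak Z))}\varphi(\tau,\mathfrak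 Z)$ for $x,y\in L$, and $\varphi=\sum f(n,l)e^{2\pi i(n\tau+(l,\mathfrak Z))}$ with the sum over rational $n\ge0$, $n\equiv\frac D{24}\bmod\mathbb Z$, $l\in L^\vee$, $2n-(l,l)\ge0$. $J_{k,L}$ means trivial character ($D=0$). The singular weight for $L$ is $\frac{\mathrm{rank}L}2$. $\vartheta(\tau,z)=\sum_{n\in\mathbb Z}\left(\frac{-4}n\right)e^{2\pi i(\frac{n^2}8\tau+\frac n2z)}$, where $\left(\frac{-4}n\right)$ is $1,-1,0$ for $n\equiv1\bmod4$, $n\equiv3\bmod4$, $n$ even. $A_2=\{x\in\mathbb Z^3:x_1+x_2+x_3=0\}$ with the Euclidean form; points of $A_2\otimes\mathbb C$ are written $(z_1,z_2,-z_1-z_2)$ with coordinates $(z_1,z_2)$. $3A_2=A_2\oplus A_2\oplus A_2$ (orthogonal sum), with points $(\mathfrak Z_1,\mathfrak Z_2,\mathfrak Z_3)$, $\mathfrak Z_i\in A_2\otimes\mathbb C$. *)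

theory Defs
  imports "HOL-Analysis.Analysis"
begin

section \<open>Even lattices\<close>

text \<open>
  A positive definite lattice is represented inside some Euclidean space \<open>real ^ 'n\<close>, with the
  standard inner product as its form; it need not have full rank there. Every positive definite
  lattice has such an embedding.
\<close>

definition even_lattice :: "(real ^ 'n) set \<Rightarrow> bool" where
  "even_lattice L \<longleftrightarrow>
     (\<exists>B. finite B \<and> independent B \<and> L = range (\<lambda>c. \<Sum>b\<in>B. real_of_int (c b) *\<^sub>R b)) \<and>
     (\<forall>x\<in>L. \<exists>m::int. x \<bullet> x = 2 * of_int m)"

definition dual_lattice :: "(real ^ 'n) set \<Rightarrow> (real ^ 'n) set" where
  "dual_lattice L = {l \<in> span L. \<forall>x\<in>L. l \<bullet> x \<in> \<int>}"

text \<open>\<open>dim L\<close> is the dimension of the real span of \<open>L\<close>, that is, the rank of the lattice.\<close>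

definition singular_weight :: "(real ^ 'n) set \<Rightarrow> real" where
  "singular_weight L = real (dim L) / 2"

definition cvec :: "real ^ 'n \<Rightarrow> complex ^ 'n" where
  "cvec x = (\<chi> i. complex_of_real (x $ i))"

text \<open>
  The complex-bilinear (not Hermitian) extension of the form; the library's inner product on
  \<open>complex ^ 'n\<close> is real-valued.
\<close>

definition cform :: "complex ^ 'n \<Rightarrow> complex ^ 'n \<Rightarrow> complex" where
  "cform z w = (\<Sum>i\<in>UNIV. z $ i * w $ i)"

text \<open>\<open>L \<otimes> \<complex>\<close>, realised as the complex span of \<open>L\<close>.\<close>

definition complexification :: "(real ^ 'n) set \<Rightarrow> (complex ^ 'n) set" where
  "complexification L = vec.span (cvec ` L)"

section \<open>The eta function, its multiplier system, and the theta function\<close>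

definition upper_half_plane :: "complex set" where
  "upper_half_plane = {\<tau>. Im \<tau> > 0}"

definition dedekind_eta :: "complex \<Rightarrow> complex" where
  "dedekind_eta \<tau> =
     exp (of_real pi * \<i> * \<tau> / 12) *
     (\<Prod>n. 1 - exp (2 * of_real pi * \<i> * of_nat (Suc n) * \<tau>))"

text \<open>
  The matrix with rows \<open>(a, b)\<close> and \<open>(c, d)\<close> is passed as its four entries; only the
  case \<open>a * d - b * c = 1\<close> is meaningful. All powers of \<open>c\<tau> + d\<close> use the principal branch.
\<close>

definition eta_multiplier :: "int \<Rightarrow> int \<Rightarrow> int \<Rightarrow> int \<Rightarrow> complex" where
  "eta_multiplier a b c d =
     (THE v. \<forall>\<tau>\<in>upper_half_plane.
        dedekind_eta ((of_int a * \<tau> + of_int b) / (of_int c * \<tau> + of_int d)) =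
          v * (of_int c * \<tau> + of_int d) powr (1 / 2) * dedekind_eta \<tau>)"

definition kronecker_minus4 :: "int \<Rightarrow> int" where
  "kronecker_minus4 n = (if n mod 4 = 1 then 1 else if n mod 4 = 3 then -1 else 0)"

definition jacobi_theta :: "complex \<Rightarrow> complex \<Rightarrow> complex" where
  "jacobi_theta \<tau> z =
     (\<Sum>\<^sub>\<infinity>n\<in>(UNIV :: int set). of_int (kronecker_minus4 n) *
        exp (2 * of_real pi * \<i> * ((of_int n)\<^sup>2 / 8 * \<tau> + of_int n / 2 * z)))"

section \<open>Jacobi forms of lattice index\<close>

text \<open>
  Holomorphy in several variables on \<open>S \<times> V\<close>, for \<open>S\<close> open and \<open>V\<close> a complex subspace: total
  differentiability relative to the domain, with complex-linear derivative. The derivative is only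
  determined on \<open>\<complex> \<times> V\<close>; asking for complex linearity everywhere is no restriction, since a
  complex-linear map on \<open>\<complex> \<times> V\<close> extends.
\<close>

definition holomorphic_on_times ::
    "(complex \<Rightarrow> complex ^ 'n \<Rightarrow> complex) \<Rightarrow> complex set \<Rightarrow> (complex ^ 'n) set \<Rightarrow> bool" where
  "holomorphic_on_times \<phi> S V \<longleftrightarrow>
     (\<forall>p \<in> S \<times> V. \<exists>D. ((\<lambda>(\<tau>, z). \<phi> \<tau> z) has_derivative D) (at p within S \<times> V) \<and>
        (\<forall>c t w. D (c * t, c *s w) = c * D (t, w)))"

text \<open>
  \<open>jacobi_forms k L D\<close> is \<open>J\<^bsub>k,L\<^esub>(v\<^sub>\<eta>\<^sup>D)\<close>, for an even lattice \<open>L\<close> and half-integral \<open>k\<close>;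
  the trivial character is \<open>D = 0\<close>. Membership does not constrain the values of a function
  outside \<open>upper_half_plane \<times> complexification L\<close>.
\<close>

definition jacobi_forms ::
    "real \<Rightarrow> (real ^ 'n) set \<Rightarrow> int \<Rightarrow> (complex \<Rightarrow> complex ^ 'n \<Rightarrow> complex) set" where
  "jacobi_forms k L D = {\<phi>.
     holomorphic_on_times \<phi> upper_half_plane (complexification L) \<and>
     (\<forall>a b c d :: int. a * d - b * c = 1 \<longrightarrow>
        (\<forall>\<tau>\<in>upper_half_plane. \<forall>z\<in>complexification L.
           \<phi> ((of_int a * \<tau> + of_int b) / (of_int c * \<tau> + of_int d))
             ((1 / (of_int c * \<tau> + of_int d)) *s z) =
           eta_multiplier a b c d powi D *
           (of_int c * \<tau> + of_int d) powr (of_real k) *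
           exp (of_real pi * \<i> * (of_int c * cform z z / (of_int c * \<tau> + of_int d))) *
           \<phi> \<tau> z)) \<and>
     (\<forall>x\<in>L. \<forall>y\<in>L. \<forall>\<tau>\<in>upper_half_plane. \<forall>z\<in>complexification L.
        \<phi> \<tau> (z + \<tau> *s cvec x + cvec y) =
          exp (- of_real pi * \<i> * (cform (cvec x) (cvec x) * \<tau> + 2 * cform (cvec x) z)) * \<phi> \<tau> z) \<and>
     (\<exists>f :: real \<Rightarrow> real ^ 'n \<Rightarrow> complex.
        \<forall>\<tau>\<in>upper_half_plane. \<forall>z\<in>complexification L.
          ((\<lambda>(n, l). f n l * exp (2 * of_real pi * \<i> * (of_real n * \<tau> + cform (cvec l) z)))
            has_sum \<phi> \<tau> z)
          {(n, l). n \<in> \<rat> \<and> n \<ge> 0 \<and> n - of_int D / 24 \<in> \<int> \<and>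
                   l \<in> dual_lattice L \<and> 2 * n - l \<bullet> l \<ge> 0})}"

section \<open>The lattices \<open>A\<^sub>2\<close> and \<open>3A\<^sub>2\<close>\<close>

definition A2 :: "(real ^ 3) set" where
  "A2 = {x. (\<forall>i. x $ i \<in> \<int>) \<and> x $ 1 + x $ 2 + x $ 3 = 0}"

text \<open>
  Vectors of \<open>'m\<close> blocks, each in \<open>'a ^ 'n\<close>, are indexed by pairs, so that the standard form is
  the orthogonal sum of the forms on the blocks.
\<close>

definition block :: "'m::finite \<Rightarrow> 'a ^ ('m \<times> 'n::finite) \<Rightarrow> 'a ^ 'n" where
  "block j x = (\<chi> i. x $ (j, i))"

definition three_A2 :: "(real ^ (3 \<times> 3)) set" where
  "three_A2 = {x. block 1 x \<in> A2 \<and> block 2 x \<in> A2 \<and> block 3 x \<in> A2}"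

definition sigma_A2 :: "complex \<Rightarrow> complex \<Rightarrow> complex \<Rightarrow> complex" where
  "sigma_A2 \<tau> z1 z2 =
     jacobi_theta \<tau> z1 * jacobi_theta \<tau> z2 * jacobi_theta \<tau> (z1 + z2) / dedekind_eta \<tau>"

text \<open>A point \<open>(z\<^sub>1, z\<^sub>2, -z\<^sub>1-z\<^sub>2)\<close> of \<open>A\<^sub>2 \<otimes> \<complex>\<close> has coordinates \<open>(z\<^sub>1, z\<^sub>2)\<close>.\<close>

definition sigma_A2_form :: "complex \<Rightarrow> complex ^ 3 \<Rightarrow> complex" where
  "sigma_A2_form \<tau> Z = sigma_A2 \<tau> (Z $ 1) (Z $ 2)"

definition sigma_3A2 :: "complex \<Rightarrow> complex ^ (3 \<times> 3) \<Rightarrow> complex" where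
  "sigma_3A2 \<tau> Z =
     sigma_A2_form \<tau> (block 1 Z) * sigma_A2_form \<tau> (block 2 Z) * sigma_A2_form \<tau> (block 3 Z)"

end

theory Submission imports Defs "HOL-Complex_Analysis.Complex_Analysis" begin

text \<open>
  Write \<open>q = exp (2 * pi * \<i> * \<tau>)\<close>. The Fourier expansion, the modular transformation and the
  elliptic transformation of \<open>sigma_A2\<close> have three different sources.

  The Fourier expansion is the denominator identity of the affine root system \<open>A\<^sub>2\<close>: multiplying out
  the three theta series and collecting the terms with a fixed monomial in \<open>z\<^sub>1, z\<^sub>2\<close>, the remaining sum
  over one odd integer is, up to sign, either zero or \<open>\<Sum>k. (-1) ^ k * q ^ ((6 * k + 1)\<^sup>2 / 24)\<close>, times a
  power of \<open>q\<close> whose exponent is half the norm of a vector of the dual lattice. By Euler's pentagonal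
  number theorem, which follows from a finite identity of Shanks, this sum is the eta function and
  cancels against the denominator (\<open>sigma_A2_has_sum\<close>). So the quotient is a theta series of the dual
  lattice whose Fourier coefficients lie on \<open>2 * n = (l, l)\<close>, as is typical of singular weight.

  For the modular transformation it is enough to know that, for every matrix in \<open>SL\<^sub>2(\<int>)\<close>, eta has a
  multiplier \<open>v\<close> with \<open>v ^ 24 = 1\<close> and theta has the multiplier \<open>v\<^sup>3\<close>
  (\<open>eta_theta_multiplier_exists\<close>): three theta factors divided by one eta factor then have weight 1
  and multiplier \<open>v\<^sup>9 / v = v\<^sup>8\<close>, and the threefold product has weight 3 and multiplier \<open>v ^ 24 = 1\<close>.
  Translations are read off from the series. For the inversion \<open>\<tau> \<mapsto> - 1 / \<tau>\<close>, entire functions with the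
  quasi-periodicity of theta form a one-dimensional space
  (\<open>quasi_periodic_imp_multiple_of_theta\<close>), so theta is reproduced up to a factor depending
  on \<open>\<tau>\<close> only; by the heat equation the factor is \<open>C * csqrt \<tau>\<close>, and applying the inversion twice at
  \<open>\<tau> = \<i>\<close> gives \<open>C\<^sup>2 = \<i>\<close> (\<open>jacobi_theta_inversion\<close>). The pentagonal number theorem identifies eta with a
  value of theta at a 3-torsion point, and so the inversion formula of eta follows from that of theta.
  Euclid's algorithm reduces an arbitrary matrix to these two cases.

  The elliptic transformation and holomorphy follow from those of theta, together with the fact that
  the eta product has no zeros in the upper half-plane.
\<close>

section \<open>Theta series and their derivatives\<close>

text \<open>
  The functions \<open>\<Sum>n. a n * q ^ (n\<^sup>2 / 8) * \<zeta> ^ (n / 2)\<close> with \<open>q = exp (2 * pi * \<i> * \<tau>)\<close> and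
  \<open>\<zeta> = exp (2 * pi * \<i> * z)\<close>, for arbitrary coefficients \<open>a\<close>. Differentiating termwise only changes
  the coefficients, so that this family contains the theta function and all its derivatives.
\<close>

definition theta_term :: "(int \<Rightarrow> complex) \<Rightarrow> complex \<Rightarrow> complex \<Rightarrow> int \<Rightarrow> complex" where
  "theta_term a \<tau> z n =
     a n * exp (2 * of_real pi * \<i> * ((of_int n)\<^sup>2 / 8 * \<tau> + of_int n / 2 * z))"

definition theta_series :: "(int \<Rightarrow> complex) \<Rightarrow> complex \<Rightarrow> complex \<Rightarrow> complex" where
  "theta_series a \<tau> z = (\<Sum>\<^sub>\<infinity>n. theta_term a \<tau> z n)"

text \<open>
  At most exponential growth is enough for convergence against the Gaussian factor and, unlike
  boundedness, is preserved by the factor \<open>n\<close> that a derivative produces.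
\<close>

definition exp_bounded :: "(int \<Rightarrow> complex) \<Rightarrow> bool" where
  "exp_bounded a \<longleftrightarrow> (\<exists>C k. \<forall>n. norm (a n) \<le> C * exp (k * \<bar>real_of_int n\<bar>))"

lemma exp_boundedI_bound: "(\<And>n. norm (a n) \<le> C) \<Longrightarrow> exp_bounded a"
  unfolding exp_bounded_def by (rule exI[of _ C], rule exI[of _ 0]) auto

lemma exp_bounded_cmult_of_int:
  assumes "exp_bounded a"
  shows "exp_bounded (\<lambda>n. c * of_int n * a n)"
proof -
  obtain C k where C: "\<And>n. norm (a n) \<le> C * exp (k * \<bar>real_of_int n\<bar>)"
    using assms unfolding exp_bounded_def by blast
  have "norm (c * of_int n * a n) \<le> (norm c * C) * exp ((k + 1) * \<bar>real_of_int n\<bar>)" for n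
  proof -
    have "\<bar>real_of_int n\<bar> \<le> exp \<bar>real_of_int n\<bar>"
      using exp_ge_add_one_self[of "\<bar>real_of_int n\<bar>"] by linarith
    hence "\<bar>real_of_int n\<bar> * norm (a n) \<le> exp \<bar>real_of_int n\<bar> * (C * exp (k * \<bar>real_of_int n\<bar>))"
      using C by (intro mult_mono) auto
    also have "\<dots> = C * exp ((k + 1) * \<bar>real_of_int n\<bar>)"
      by (simp add: exp_add algebra_simps)
    finally have "norm c * (\<bar>real_of_int n\<bar> * norm (a n)) \<le> norm c * (C * exp ((k + 1) * \<bar>real_of_int n\<bar>))"
      by (intro mult_left_mono) auto
    thus ?thesis by (simp add: norm_mult mult_ac)
  qed
  thus ?thesis unfolding exp_bounded_def by blast
qed

lemma summable_on_exp_minus_abs: "(\<lambda>n::int. exp (- \<bar>real_of_int n\<bar>)) summable_on UNIV"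
proof -
  have geo: "(\<lambda>n::nat. exp (- real n)) summable_on UNIV"
  proof -
    have "summable (\<lambda>n. exp (- 1 :: real) ^ n)"
      by (rule summable_geometric) simp
    moreover have "exp (- real n) = exp (- 1 :: real) ^ n" for n
      by (simp add: exp_of_nat_mult[symmetric])
    ultimately have "summable (\<lambda>n. exp (- real n))" by simp
    thus ?thesis by (subst summable_on_UNIV_nonneg_real_iff) auto
  qed
  have 1: "(\<lambda>n::int. exp (- \<bar>real_of_int n\<bar>)) summable_on (int ` UNIV)"
    by (subst summable_on_reindex) (auto simp: o_def intro!: geo)
  have 2: "(\<lambda>n::int. exp (- \<bar>real_of_int n\<bar>)) summable_on ((\<lambda>n. - int n) ` UNIV)"
    by (subst summable_on_reindex) (auto simp: o_def inj_on_def intro!: geo)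
  have "UNIV = int ` UNIV \<union> (\<lambda>n. - int n) ` UNIV"
    by (auto simp: image_iff) (metis int_cases2)
  thus ?thesis using summable_on_union[OF 1 2] by simp
qed

text \<open>
  One summable majorant for the region \<open>Im \<tau> \<ge> \<delta>\<close>, \<open>\<bar>Im z\<bar> \<le> R\<close>.
\<close>

lemma theta_term_majorant:
  assumes "exp_bounded a" "\<delta> > 0"
  obtains M where "M summable_on UNIV"
    "\<And>\<tau> z n. Im \<tau> \<ge> \<delta> \<Longrightarrow> \<bar>Im z\<bar> \<le> R \<Longrightarrow> norm (theta_term a \<tau> z n) \<le> M n"
proof -
  obtain C k where C: "\<And>n. norm (a n) \<le> C * exp (k * \<bar>real_of_int n\<bar>)"
    using assms unfolding exp_bounded_def by blast
  have C0: "C \<ge> 0" using C[of 0] norm_ge_zero[of "a 0"] by (simp, linarith)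
  define \<alpha> where "\<alpha> = pi * \<delta> / 4"
  define \<beta> where "\<beta> = k + pi * R"
  have \<alpha>: "\<alpha> > 0" using assms by (simp add: \<alpha>_def)
  define M where "M = (\<lambda>n::int. C * exp ((\<beta> + 1)\<^sup>2 / (4 * \<alpha>)) * exp (- \<bar>real_of_int n\<bar>))"
  have "M summable_on UNIV"
    unfolding M_def by (intro summable_on_cmult_right summable_on_exp_minus_abs)
  moreover have "norm (theta_term a \<tau> z n) \<le> M n" if "Im \<tau> \<ge> \<delta>" "\<bar>Im z\<bar> \<le> R" for \<tau> z n
  proof -
    define x where "x = \<bar>real_of_int n\<bar>"
    have x0: "x \<ge> 0" by (simp add: x_def)
    have xsq: "(real_of_int n)\<^sup>2 = x\<^sup>2" by (simp add: x_def)
    have re: "Re (2 * of_real pi * \<i> * ((of_int n)\<^sup>2 / 8 * \<tau> + of_int n / 2 * z))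
        = - (pi * x\<^sup>2 / 4 * Im \<tau>) - pi * (of_int n * Im z)"
    proof -
      have e: "((of_int n)\<^sup>2 :: complex) = of_real (x\<^sup>2)"
        by (simp flip: xsq)
      show ?thesis unfolding e by (simp add: algebra_simps)
    qed
    have "- (of_int n * Im z) \<le> x * R"
    proof -
      have "- (of_int n * Im z) \<le> \<bar>of_int n * Im z\<bar>" by linarith
      also have "\<dots> = x * \<bar>Im z\<bar>" by (simp add: abs_mult x_def)
      also have "\<dots> \<le> x * R" using that x0 by (intro mult_left_mono)
      finally show ?thesis .
    qed
    hence 1: "- pi * (of_int n * Im z) \<le> pi * R * x"
      using mult_left_mono[of _ _ pi] by (fastforce simp: mult_ac)
    have 2: "\<alpha> * x\<^sup>2 \<le> pi * x\<^sup>2 / 4 * Im \<tau>"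
      unfolding \<alpha>_def using mult_left_mono[OF that(1), of "pi * x\<^sup>2 / 4"] by (simp add: mult_ac)
    \<comment> \<open>Completing the square bounds \<open>\<beta> * x - \<alpha> * x\<^sup>2\<close> by a constant minus \<open>x\<close>.\<close>
    have "(2 * \<alpha> * x - (\<beta> + 1))\<^sup>2 / (4 * \<alpha>) \<ge> 0" using \<alpha> by simp
    also have "(2 * \<alpha> * x - (\<beta> + 1))\<^sup>2 / (4 * \<alpha>) = \<alpha> * x\<^sup>2 - (\<beta> + 1) * x + (\<beta> + 1)\<^sup>2 / (4 * \<alpha>)"
      using \<alpha> by (simp add: field_simps power2_eq_square)
    finally have 3: "k * x - pi * x\<^sup>2 / 4 * Im \<tau> - pi * (of_int n * Im z)
        \<le> (\<beta> + 1)\<^sup>2 / (4 * \<alpha>) - x"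
      using 1 2 unfolding \<beta>_def by (simp add: algebra_simps)
    have "norm (theta_term a \<tau> z n) = norm (a n) * exp (- (pi * x\<^sup>2 / 4 * Im \<tau>) - pi * (of_int n * Im z))"
      unfolding theta_term_def norm_mult norm_exp_eq_Re re ..
    also have "\<dots> \<le> (C * exp (k * x)) * exp (- (pi * x\<^sup>2 / 4 * Im \<tau>) - pi * (of_int n * Im z))"
      using C[of n] by (intro mult_right_mono) (auto simp: x_def)
    also have "\<dots> = C * exp (k * x - pi * x\<^sup>2 / 4 * Im \<tau> - pi * (of_int n * Im z))"
      by (simp flip: exp_add add: algebra_simps)
    also have "\<dots> \<le> C * exp ((\<beta> + 1)\<^sup>2 / (4 * \<alpha>) - x)"
      using 3 C0 by (intro mult_left_mono) auto
    also have "\<dots> = M n" by (simp add: M_def x_def exp_diff exp_minus field_simps)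
    finally show ?thesis .
  qed
  ultimately show ?thesis using that by blast
qed

lemma theta_term_abs_summable:
  assumes "exp_bounded a" "Im \<tau> > 0"
  shows "(\<lambda>n. norm (theta_term a \<tau> z n)) summable_on UNIV"
proof -
  obtain M where M: "M summable_on UNIV"
    "\<And>\<tau>' z' n. Im \<tau>' \<ge> Im \<tau> \<Longrightarrow> \<bar>Im z'\<bar> \<le> \<bar>Im z\<bar> \<Longrightarrow> norm (theta_term a \<tau>' z' n) \<le> M n"
    using theta_term_majorant[OF assms, of "\<bar>Im z\<bar>"] by blast
  show ?thesis
    by (rule summable_on_comparison_test[OF M(1)]) (use M(2) in auto)
qed

lemma theta_term_summable:
  assumes "exp_bounded a" "Im \<tau> > 0"
  shows "theta_term a \<tau> z summable_on UNIV"
  using theta_term_abs_summable[OF assms] by (rule abs_summable_summable)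

lemma theta_series_has_sum:
  assumes "exp_bounded a" "Im \<tau> > 0"
  shows "(theta_term a \<tau> z has_sum theta_series a \<tau> z) UNIV"
  unfolding theta_series_def using theta_term_summable[OF assms] by (rule has_sum_infsum)

lemma theta_term_has_derivative:
  "((\<lambda>(\<tau>, z). theta_term a \<tau> z n) has_derivative
     (\<lambda>(t, w). theta_term (\<lambda>n. (of_real pi * \<i> / 4 * of_int n) * of_int n * a n) \<tau> z n * t +
               theta_term (\<lambda>n. (of_real pi * \<i>) * of_int n * a n) \<tau> z n * w)) (at (\<tau>, z) within S)"
proof -
  define E where "E = (\<lambda>\<tau> z. exp (2 * of_real pi * \<i> * ((of_int n)\<^sup>2 / 8 * \<tau> + of_int n / 2 * z)))"
  have "((\<lambda>p. a n * E (fst p) (snd p)) has_derivative (\<lambda>h. a n * (E \<tau> z *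
          (2 * of_real pi * \<i> * ((of_int n)\<^sup>2 / 8 * fst h + of_int n / 2 * snd h))))) (at (\<tau>, z) within S)"
  proof -
    let ?l = "\<lambda>p. 2 * of_real pi * \<i> * ((of_int n)\<^sup>2 / 8 * fst p + of_int n / 2 * snd p)"
    have l: "(?l has_derivative ?l) (at (\<tau>, z) within S)"
      by (intro has_derivative_mult_right has_derivative_add has_derivative_fst has_derivative_snd
        has_derivative_ident)
    have "(exp has_derivative (*) (exp (?l (\<tau>, z)))) (at (?l (\<tau>, z)))"
      using DERIV_exp unfolding has_field_derivative_def .
    from has_derivative_mult_right[OF has_derivative_compose[OF l this], of "a n"]
    show ?thesis by (simp add: E_def)
  qed
  hence "((\<lambda>p. a n * E (fst p) (snd p)) has_derivative
      (\<lambda>h. (of_real pi * \<i> / 4 * of_int n) * of_int n * a n * E \<tau> z * fst h +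
           (of_real pi * \<i>) * of_int n * a n * E \<tau> z * snd h)) (at (\<tau>, z) within S)"
    by (rule has_derivative_eq_rhs) (simp add: fun_eq_iff field_simps power2_eq_square)
  thus ?thesis
    unfolding theta_term_def case_prod_beta E_def by simp
qed

lemma exp_bounded_deriv:
  assumes "exp_bounded a"
  shows "exp_bounded (\<lambda>n. (of_real pi * \<i> / 4 * of_int n) * of_int n * a n)"
        "exp_bounded (\<lambda>n. (of_real pi * \<i>) * of_int n * a n)"
proof -
  have "(\<lambda>n. (of_real pi * \<i> / 4 * of_int n) * of_int n * a n) =
        (\<lambda>n. (of_real pi * \<i> / 4) * of_int n * (1 * of_int n * a n))"
    by (simp add: mult_ac)
  thus "exp_bounded (\<lambda>n. (of_real pi * \<i> / 4 * of_int n) * of_int n * a n)"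
    by (metis exp_bounded_cmult_of_int assms)
  show "exp_bounded (\<lambda>n. (of_real pi * \<i>) * of_int n * a n)"
    by (rule exp_bounded_cmult_of_int[OF assms])
qed

text \<open>
  The total derivative in \<open>(\<tau>, z)\<close>, from uniform convergence of the derivatives of the partial
  sums on a convex neighbourhood.
\<close>

lemma theta_series_has_derivative:
  assumes a: "exp_bounded a" and \<tau>0: "Im \<tau>0 > 0"
  shows "((\<lambda>(\<tau>, z). theta_series a \<tau> z) has_derivative
     (\<lambda>(t, w). theta_series (\<lambda>n. (of_real pi * \<i> / 4 * of_int n) * of_int n * a n) \<tau>0 z0 * t +
               theta_series (\<lambda>n. (of_real pi * \<i>) * of_int n * a n) \<tau>0 z0 * w)) (at (\<tau>0, z0))"
proof -
  define ad where "ad = (\<lambda>n. (of_real pi * \<i> / 4 * of_int n) * of_int n * a n)"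
  define az where "az = (\<lambda>n. (of_real pi * \<i>) * of_int n * a n)"
  have eb: "exp_bounded ad" "exp_bounded az"
    unfolding ad_def az_def using exp_bounded_deriv[OF a] .
  define \<delta> where "\<delta> = Im \<tau>0 / 2"
  define R where "R = \<bar>Im z0\<bar> + 1"
  have \<delta>: "\<delta> > 0" using \<tau>0 by (simp add: \<delta>_def)
  have \<delta>': "\<delta> < Im \<tau>0" using \<tau>0 by (simp add: \<delta>_def)
  define S where "S = {\<tau>. Im \<tau> > \<delta>} \<times> ({z. Im z < R} \<inter> {z. Im z > - R})"
  have S: "open S" "convex S" "(\<tau>0, z0) \<in> S"
    unfolding S_def using \<delta>'
    by (auto simp: R_def abs_if intro!: open_Times open_Int open_halfspace_Im_gt
      open_halfspace_Im_lt convex_Times convex_Int convex_halfspace_Im_gt convex_halfspace_Im_lt)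
  obtain M1 where M1: "M1 summable_on UNIV"
    "\<And>\<tau> z n. Im \<tau> \<ge> \<delta> \<Longrightarrow> \<bar>Im z\<bar> \<le> R \<Longrightarrow> norm (theta_term ad \<tau> z n) \<le> M1 n"
    using theta_term_majorant[OF eb(1) \<delta>] by blast
  obtain M2 where M2: "M2 summable_on UNIV"
    "\<And>\<tau> z n. Im \<tau> \<ge> \<delta> \<Longrightarrow> \<bar>Im z\<bar> \<le> R \<Longrightarrow> norm (theta_term az \<tau> z n) \<le> M2 n"
    using theta_term_majorant[OF eb(2) \<delta>] by blast
  have M1nn: "M1 n \<ge> 0" and M2nn: "M2 n \<ge> 0" for n
    by (rule order_trans[OF norm_ge_zero M1(2)[of "Complex 0 \<delta>" 0]], auto simp: R_def)
       (rule order_trans[OF norm_ge_zero M2(2)[of "Complex 0 \<delta>" 0]], auto simp: R_def)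
  have bij: "bij_betw int_decode UNIV UNIV" by (rule bij_int_decode)
  define M where "M = (\<lambda>i. M1 (int_decode i) + M2 (int_decode i))"
  have "(\<lambda>n. M1 n + M2 n) summable_on UNIV" using M1 M2 by (intro summable_on_add)
  hence "M summable_on UNIV"
    unfolding M_def using summable_on_reindex_bij_betw[OF bij, of "\<lambda>n. M1 n + M2 n"] by simp
  hence summM: "summable M" by (rule summable_on_imp_summable)
  have bnd: "norm (theta_term ad \<tau> z (int_decode i) * t + theta_term az \<tau> z (int_decode i) * w)
      \<le> M i * norm (t, w)" if "(\<tau>, z) \<in> S" for \<tau> z t w i
  proof -
    have "norm (theta_term ad \<tau> z (int_decode i) * t) \<le> M1 (int_decode i) * norm (t, w)"
      unfolding norm_mult using that norm_fst_le[of t w]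
      by (intro mult_mono M1) (auto simp: S_def intro: M1nn)
    moreover have "norm (theta_term az \<tau> z (int_decode i) * w) \<le> M2 (int_decode i) * norm (t, w)"
      unfolding norm_mult using that norm_snd_le[of w t]
      by (intro mult_mono M2) (auto simp: S_def intro: M2nn)
    ultimately show ?thesis unfolding M_def distrib_right by (rule norm_triangle_mono)
  qed
  have sums: "(\<lambda>i. theta_term b \<tau> z (int_decode i)) sums theta_series b \<tau> z"
    if "exp_bounded b" "(\<tau>, z) \<in> S" for b \<tau> z
  proof -
    have "Im \<tau> > 0" using that \<delta> by (auto simp: S_def)
    from theta_series_has_sum[OF that(1) this] show ?thesis
      by (intro has_sum_imp_sums) (subst has_sum_reindex_bij_betw[OF bij])
  qed
  define f where "f = (\<lambda>i p. case p of (\<tau>, z) \<Rightarrow> theta_term a \<tau> z (int_decode i))"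
  define f' where "f' = (\<lambda>i p h. case p of (\<tau>, z) \<Rightarrow> case h of (t, w) \<Rightarrow>
     theta_term ad \<tau> z (int_decode i) * t + theta_term az \<tau> z (int_decode i) * w)"
  define g' where "g' = (\<lambda>p h. case p of (\<tau>, z) \<Rightarrow> case h of (t, w) \<Rightarrow>
     theta_series ad \<tau> z * t + theta_series az \<tau> z * w)"
  have "\<exists>g. \<forall>p\<in>S. (\<lambda>i. f i p) sums g p \<and> (g has_derivative g' p) (at p within S)"
  proof (rule has_derivative_series[where f' = f'])
    show "convex S" by fact
    show "(f n has_derivative f' n p) (at p within S)" if "p \<in> S" for n p
    proof -
      obtain \<tau> z where p: "p = (\<tau>, z)" by (cases p)
      show ?thesis
        unfolding p f_def f'_def ad_def az_def prod.case by (rule theta_term_has_derivative)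
    qed
    show "\<forall>\<^sub>F n in sequentially. \<forall>p\<in>S. \<forall>h. norm ((\<Sum>i<n. f' i p h) - g' p h) \<le> e * norm h"
      if "e > 0" for e
    proof -
      have "(\<lambda>n. \<Sum>i. M (i + n)) \<longlonglongrightarrow> 0" by (rule suminf_exist_split2[OF summM])
      hence "\<forall>\<^sub>F n in sequentially. (\<Sum>i. M (i + n)) < e" using that by (rule order_tendstoD)
      thus ?thesis
      proof eventually_elim
        case (elim n)
        show ?case
        proof safe
          fix \<tau> z t w assume p: "(\<tau>, z) \<in> S"
          let ?F = "\<lambda>i. f' i (\<tau>, z) (t, w)"
          have s: "?F sums g' (\<tau>, z) (t, w)"
            unfolding f'_def g'_def using sums[OF eb(1) p] sums[OF eb(2) p]
            by (auto intro!: sums_add sums_mult2)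
          have sM: "summable (\<lambda>i. M (i + n) * norm (t, w))"
            using summM by (intro summable_mult2) (subst summable_iff_shift)
          have nb: "norm (?F (i + n)) \<le> M (i + n) * norm (t, w)" for i
            using bnd[OF p] by (simp add: f'_def)
          have sn: "summable (\<lambda>i. norm (?F (i + n)))"
            by (rule summable_comparison_test'[OF sM, of 0]) (use nb in auto)
          have "g' (\<tau>, z) (t, w) - (\<Sum>i<n. ?F i) = (\<Sum>i. ?F (i + n))"
            using suminf_minus_initial_segment[OF sums_summable[OF s], of n] sums_unique[OF s] by simp
          hence "norm ((\<Sum>i<n. ?F i) - g' (\<tau>, z) (t, w)) = norm (\<Sum>i. ?F (i + n))"
            by (simp add: norm_minus_commute)
          also have "\<dots> \<le> (\<Sum>i. norm (?F (i + n)))" by (rule summable_norm[OF sn])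
          also have "\<dots> \<le> (\<Sum>i. M (i + n) * norm (t, w))" by (rule suminf_le[OF nb sn sM])
          also have "\<dots> = (\<Sum>i. M (i + n)) * norm (t, w)"
            using summM by (intro suminf_mult2[symmetric]) (subst summable_iff_shift)
          also have "\<dots> \<le> e * norm (t, w)" using elim by (intro mult_right_mono) auto
          finally show "norm ((\<Sum>i<n. ?F i) - g' (\<tau>, z) (t, w)) \<le> e * norm (t, w)" .
        qed
      qed
    qed
    show "(\<tau>0, z0) \<in> S" by fact
    show "(\<lambda>i. f i (\<tau>0, z0)) sums theta_series a \<tau>0 z0"
      using sums[OF a S(3)] by (simp add: f_def)
  qed
  then obtain g where g: "\<And>p. p \<in> S \<Longrightarrow> (\<lambda>i. f i p) sums g p"
    "\<And>p. p \<in> S \<Longrightarrow> (g has_derivative g' p) (at p within S)" by blast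
  have eq: "g (\<tau>, z) = theta_series a \<tau> z" if "(\<tau>, z) \<in> S" for \<tau> z
  proof -
    have "(\<lambda>i. f i (\<tau>, z)) sums theta_series a \<tau> z"
      using sums[OF a that] by (simp add: f_def)
    thus ?thesis by (rule sums_unique2[OF g(1)[OF that]])
  qed
  have "(g has_derivative g' (\<tau>0, z0)) (at (\<tau>0, z0))"
    using g(2)[OF S(3)] unfolding at_within_open[OF S(3) S(1)] .
  hence "(g has_derivative
      (\<lambda>(t, w). theta_series ad \<tau>0 z0 * t + theta_series az \<tau>0 z0 * w)) (at (\<tau>0, z0))"
    unfolding g'_def prod.case .
  hence "((\<lambda>(\<tau>, z). theta_series a \<tau> z) has_derivative
      (\<lambda>(t, w). theta_series ad \<tau>0 z0 * t + theta_series az \<tau>0 z0 * w)) (at (\<tau>0, z0))"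
    by (rule has_derivative_transform_within_open[OF _ S(1) S(3)]) (auto simp: eq)
  thus ?thesis unfolding ad_def az_def .
qed

lemma theta_series_deriv_comp [derivative_intros]:
  assumes a: "exp_bounded a" and u: "(u has_field_derivative u') (at x within X)"
    and v: "(v has_field_derivative v') (at x within X)" and "Im (u x) > 0"
  shows "((\<lambda>x. theta_series a (u x) (v x)) has_field_derivative
     theta_series (\<lambda>n. (of_real pi * \<i> / 4 * of_int n) * of_int n * a n) (u x) (v x) * u' +
     theta_series (\<lambda>n. (of_real pi * \<i>) * of_int n * a n) (u x) (v x) * v') (at x within X)"
proof -
  have "((\<lambda>x. (u x, v x)) has_derivative (\<lambda>h. (u' * h, v' * h))) (at x within X)"
    using u v by (intro has_derivative_Pair) (auto simp: has_field_derivative_def)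
  from has_derivative_compose[OF this theta_series_has_derivative[OF a assms(4)]]
  have *: "((\<lambda>x. theta_series a (u x) (v x)) has_derivative
     (\<lambda>h. theta_series (\<lambda>n. (of_real pi * \<i> / 4 * of_int n) * of_int n * a n) (u x) (v x) * (u' * h) +
     theta_series (\<lambda>n. (of_real pi * \<i>) * of_int n * a n) (u x) (v x) * (v' * h))) (at x within X)"
    by simp
  show ?thesis unfolding has_field_derivative_def
    by (rule has_derivative_eq_rhs[OF *]) (simp add: fun_eq_iff algebra_simps)
qed

section \<open>The pentagonal number theorem\<close>

text \<open>
The sign \<open>(-1) ^ k\<close> for an integer \<open>k\<close>.
\<close>

definition alt_sign :: "int \<Rightarrow> complex" where
  "alt_sign k = (if even k then 1 else -1)"

lemma alt_sign_simps [simp]: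
  "alt_sign 0 = 1" "alt_sign 1 = -1" "alt_sign (- k) = alt_sign k"
  "alt_sign (k + 1) = - alt_sign k" "alt_sign (1 + k) = - alt_sign k" "alt_sign (k - 1) = - alt_sign k"
  "alt_sign k * alt_sign k = 1" "norm (alt_sign k) = 1"
  by (auto simp: alt_sign_def)

lemma alt_sign_add: "alt_sign (j + k) = alt_sign j * alt_sign k"
  by (auto simp: alt_sign_def)

lemma alt_sign_int: "alt_sign (int n) = (-1) ^ n"
  by (auto simp: alt_sign_def minus_one_power_iff)

text \<open>
The triangular numbers \<open>n * (n + 1) / 2\<close>.
\<close>

definition triangular :: "nat \<Rightarrow> nat" where "triangular n = (\<Sum>i\<le>n. i)"

lemma triangular_Suc: "triangular (Suc n) = triangular n + Suc n"
  by (simp add: triangular_def)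

lemma triangular_0 [simp]: "triangular 0 = 0"
  by (simp add: triangular_def)

lemma of_nat_triangular: "of_nat (triangular n) = (of_nat n * (of_nat n + 1) / 2 :: 'a :: field_char_0)"
  by (induction n) (auto simp: triangular_Suc field_simps)

text \<open>
  Shanks's finite form of the pentagonal number theorem. The exponents
  \<open>(Suc k)\<^sup>2 + triangular (Suc k)\<close> and \<open>(Suc k)\<^sup>2 + triangular k\<close> are the pentagonal numbers
  \<open>m * (3 * m + 1) / 2\<close> for \<open>m = \<plusminus> (Suc k)\<close>; the term \<open>s = 0\<close> on the left is the partial product.
\<close>

lemma shanks_identity:
  fixes x :: "'a :: comm_ring_1"
  shows "(\<Sum>s\<le>n. (-1) ^ s * (\<Prod>i=s..<n. 1 - x ^ Suc i) * x ^ (s * n + triangular s)) =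
         1 + (\<Sum>k<n. (-1) ^ Suc k * (x ^ ((Suc k)\<^sup>2 + triangular (Suc k)) + x ^ ((Suc k)\<^sup>2 + triangular k)))"
proof (induction n)
  case 0
  show ?case by simp
next
  case (Suc n)
  define Q where "Q = (\<lambda>n s. \<Prod>i=s..<n. 1 - x ^ Suc i)"
  define A where "A = (\<lambda>s. (-1) ^ s * Q n s * x ^ (s * n + triangular s))"
  define B where "B = (\<lambda>s. (-1) ^ s * Q n s * x ^ (s * Suc n + triangular s))"
  have Qs: "Q n s = (1 - x ^ Suc s) * Q n (Suc s)" if "s < n" for s
    using that unfolding Q_def by (rule prod.atLeast_Suc_lessThan)
  have QS: "Q (Suc n) s = Q n s * (1 - x ^ Suc n)" if "s \<le> n" for s
    using that unfolding Q_def by (simp add: prod.atLeastLessThan_Suc)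
  have B: "B (Suc s) = A (Suc s) + x ^ Suc n * B s" if "s < n" for s
  proof -
    have "x ^ Suc n * B s = (-1) ^ s * Q n (Suc s) * (1 - x ^ Suc s) * x ^ (Suc s * n + triangular (Suc s))"
      unfolding B_def Qs[OF that] by (simp add: triangular_Suc power_add algebra_simps)
    moreover have "B (Suc s) = (-1) ^ Suc s * Q n (Suc s) * x ^ (Suc s * n + triangular (Suc s)) * x ^ Suc s"
      unfolding B_def by (simp add: power_add algebra_simps)
    ultimately show ?thesis unfolding A_def by (simp add: algebra_simps)
  qed
  have "(\<Sum>s\<le>n. B s) = B 0 + (\<Sum>s<n. B (Suc s))"
    by (simp add: lessThan_Suc_atMost[symmetric] sum.lessThan_Suc_shift del: sum.lessThan_Suc)
  also have "B 0 = A 0" by (simp add: A_def B_def)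
  also have "(\<Sum>s<n. B (Suc s)) = (\<Sum>s<n. A (Suc s) + x ^ Suc n * B s)"
    by (intro sum.cong refl B) auto
  also have "A 0 + \<dots> = A 0 + (\<Sum>s<n. A (Suc s)) + x ^ Suc n * (\<Sum>s<n. B s)"
    by (simp only: sum.distrib sum_distrib_left add.assoc)
  also have "A 0 + (\<Sum>s<n. A (Suc s)) = (\<Sum>s\<le>n. A s)"
    by (simp add: lessThan_Suc_atMost[symmetric] sum.lessThan_Suc_shift del: sum.lessThan_Suc)
  finally have sumB: "(\<Sum>s\<le>n. B s) = (\<Sum>s\<le>n. A s) + x ^ Suc n * (\<Sum>s<n. B s)" .
  have "(\<Sum>s\<le>Suc n. (-1) ^ s * Q (Suc n) s * x ^ (s * Suc n + triangular s)) =
      (\<Sum>s\<le>n. (1 - x ^ Suc n) * B s) + (-1) ^ Suc n * x ^ (Suc n * Suc n + triangular (Suc n))"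
    unfolding sum.atMost_Suc by (intro arg_cong2[where f = "(+)"] sum.cong) (auto simp: QS B_def, auto simp: Q_def)
  also have "(\<Sum>s\<le>n. (1 - x ^ Suc n) * B s) = (\<Sum>s\<le>n. B s) - x ^ Suc n * (\<Sum>s\<le>n. B s)"
    by (simp only: sum_distrib_left sum_subtractf left_diff_distrib mult_1)
  also have "\<dots> = (\<Sum>s\<le>n. A s) - x ^ Suc n * B n"
    by (subst (1) sumB) (simp add: lessThan_Suc_atMost[symmetric] algebra_simps)
  also have "B n = (-1) ^ n * x ^ (n * Suc n + triangular n)"
    by (simp add: B_def Q_def)
  also have "x ^ Suc n * \<dots> = (-1) ^ n * x ^ ((Suc n)\<^sup>2 + triangular n)"
    by (simp add: power_add power2_eq_square algebra_simps)
  finally show ?case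
    using Suc.IH unfolding A_def Q_def by (simp add: power2_eq_square algebra_simps)
qed

text \<open>
  In Shanks's identity every term with \<open>s \<ge> 1\<close> contains the factor \<open>x ^ n\<close>, so only the partial
  product survives in the limit.
\<close>

lemma euler_partial_products:
  fixes x :: complex
  assumes x: "norm x < 1"
  shows "convergent_prod (\<lambda>n. 1 - x ^ Suc n)"
    and "(\<lambda>n. 1 + (\<Sum>k<n. (-1) ^ Suc k * (x ^ ((Suc k)\<^sup>2 + triangular (Suc k)) + x ^ ((Suc k)\<^sup>2 + triangular k))))
      \<longlonglongrightarrow> (\<Prod>n. 1 - x ^ Suc n)"
proof -
  have sumx: "summable (\<lambda>n. norm x ^ Suc n)"
    using x by (simp add: summable_geometric)
  have "abs_convergent_prod (\<lambda>n. 1 - x ^ Suc n)"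
    by (rule summable_imp_abs_convergent_prod) (use sumx in \<open>simp add: norm_mult norm_power\<close>)
  thus conv: "convergent_prod (\<lambda>n. 1 - x ^ Suc n)"
    by (rule abs_convergent_prod_imp_convergent_prod)
  define C where "C = exp (\<Sum>n. norm x ^ Suc n)"
  have Q: "norm (\<Prod>i=s..<n. 1 - x ^ Suc i) \<le> C" for s n
  proof -
    have "norm (\<Prod>i=s..<n. 1 - x ^ Suc i) \<le> (\<Prod>i=s..<n. exp (norm x ^ Suc i))"
      unfolding prod_norm[symmetric]
    proof (intro prod_mono conjI norm_ge_zero)
      fix i
      have "norm (1 - x ^ Suc i) \<le> 1 + norm x ^ Suc i"
        using norm_triangle_ineq4[of 1 "x ^ Suc i"] by (simp add: norm_mult norm_power)
      also have "\<dots> \<le> exp (norm x ^ Suc i)" by (rule exp_ge_add_one_self)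
      finally show "norm (1 - x ^ Suc i) \<le> exp (norm x ^ Suc i)" .
    qed
    also have "\<dots> = exp (\<Sum>i=s..<n. norm x ^ Suc i)" by (simp add: exp_sum)
    also have "\<dots> \<le> C" unfolding C_def
      using sum_le_suminf[OF sumx, of "{s..<n}"] by simp
    finally show ?thesis .
  qed
  let ?t = "\<lambda>n s. (-1) ^ s * (\<Prod>i=s..<n. 1 - x ^ Suc i) * x ^ (s * n + triangular s)"
  have tail: "(\<lambda>n. \<Sum>s=1..n. ?t n s) \<longlonglongrightarrow> 0"
  proof (rule Lim_null_comparison)
    show "\<forall>\<^sub>F n in sequentially. norm (\<Sum>s=1..n. ?t n s) \<le> C * (real n * norm x ^ n)"
    proof (intro always_eventually allI)
      fix n
      have "norm (\<Sum>s=1..n. ?t n s) \<le> of_nat (card {1..n}) * (C * norm x ^ n)"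
      proof (rule sum_norm_bound)
        fix s assume s: "s \<in> {1..n}"
        have "norm (?t n s) = norm (\<Prod>i=s..<n. 1 - x ^ Suc i) * norm x ^ (s * n + triangular s)"
          by (simp add: norm_mult norm_power)
        also have "\<dots> \<le> C * norm x ^ n"
          using s x by (intro mult_mono Q power_decreasing) (auto simp: C_def intro: trans_le_add1)
        finally show "norm (?t n s) \<le> C * norm x ^ n" .
      qed
      thus "norm (\<Sum>s=1..n. ?t n s) \<le> C * (real n * norm x ^ n)" by (simp add: mult_ac)
    qed
    have "(\<lambda>n. C * (real n * norm x ^ n)) \<longlonglongrightarrow> C * 0"
      by (intro tendsto_mult_left powser_times_n_limit_0) (use x in simp)
    thus "(\<lambda>n. C * (real n * norm x ^ n)) \<longlonglongrightarrow> 0" by simp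
  qed
  have "(\<lambda>n. \<Prod>i<n. 1 - x ^ Suc i) \<longlonglongrightarrow> (\<Prod>n. 1 - x ^ Suc n)"
    using convergent_prod_LIMSEQ[OF conv] by (subst (asm) lessThan_Suc_atMost[symmetric])
      (rule LIMSEQ_imp_Suc)
  from tendsto_add[OF this tail]
  have "(\<lambda>n. (\<Prod>i<n. 1 - x ^ Suc i) + (\<Sum>s=1..n. ?t n s)) \<longlonglongrightarrow> (\<Prod>n. 1 - x ^ Suc n)"
    by simp
  moreover have "(\<Prod>i<n. 1 - x ^ Suc i) + (\<Sum>s=1..n. ?t n s) = (\<Sum>s\<le>n. ?t n s)" for n
  proof -
    have "{..n} = insert 0 {1..n}" by auto
    thus ?thesis by (simp add: lessThan_atLeast0)
  qed
  ultimately show "(\<lambda>n. 1 + (\<Sum>k<n. (-1) ^ Suc k * (x ^ ((Suc k)\<^sup>2 + triangular (Suc k)) + x ^ ((Suc k)\<^sup>2 + triangular k))))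
      \<longlonglongrightarrow> (\<Prod>n. 1 - x ^ Suc n)"
    by (simp only: shanks_identity)
qed

lemma has_sum_int_imp_LIMSEQ:
  fixes f :: "int \<Rightarrow> 'a :: {topological_comm_monoid_add}"
  assumes "(f has_sum S) UNIV"
  shows "(\<lambda>n. \<Sum>k\<in>{- int n..int n}. f k) \<longlonglongrightarrow> S"
proof -
  have "filterlim (\<lambda>n. {- int n..int n}) (finite_subsets_at_top UNIV) sequentially"
    unfolding filterlim_finite_subsets_at_top
  proof safe
    fix X :: "int set" assume X: "finite X"
    have "X \<subseteq> {- int n..int n}" if "n \<ge> nat (Max (insert 0 (abs ` X)))" for n
    proof
      fix k assume "k \<in> X"
      hence "\<bar>k\<bar> \<le> Max (insert 0 (abs ` X))" using X by (intro Max_ge) auto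
      thus "k \<in> {- int n..int n}" using that by auto
    qed
    thus "\<forall>\<^sub>F n in sequentially. finite {- int n..int n} \<and> X \<subseteq> {- int n..int n} \<and> {- int n..int n} \<subseteq> UNIV"
      unfolding eventually_sequentially by blast
  qed
  thus ?thesis using assms unfolding has_sum_def by (rule filterlim_compose[rotated])
qed

text \<open>
  The summands of \<open>\<Sum>k. (-1) ^ k * q ^ ((6 * k + c)\<^sup>2 / 24)\<close>. For \<open>c = 1\<close> the sum is the eta function,
  by the pentagonal number theorem; so it is for \<open>c = -1\<close>, and for \<open>c = 3\<close> it vanishes by symmetry.
\<close>

definition pentagonal_term :: "int \<Rightarrow> complex \<Rightarrow> int \<Rightarrow> complex" where
  "pentagonal_term c \<tau> k = alt_sign k * exp (2 * of_real pi * \<i> * ((of_int (6 * k + c))\<^sup>2 / 24 * \<tau>))"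

lemma pentagonal_term_summable:
  assumes "Im \<tau> > 0"
  shows "pentagonal_term c \<tau> summable_on UNIV"
proof -
  have "(\<lambda>n. norm (theta_term (\<lambda>_. 1) (\<tau> / 3) 0 n)) summable_on range (\<lambda>k. 6 * k + c)"
    using assms by (intro summable_on_subset[OF theta_term_abs_summable] exp_boundedI_bound[of _ 1]) auto
  hence "(\<lambda>k. norm (theta_term (\<lambda>_. 1) (\<tau> / 3) 0 (6 * k + c))) summable_on UNIV"
    by (subst (asm) summable_on_reindex) (auto simp: inj_on_def o_def)
  moreover have "norm (theta_term (\<lambda>_. 1) (\<tau> / 3) 0 (6 * k + c)) = norm (pentagonal_term c \<tau> k)" for k
    by (simp add: theta_term_def pentagonal_term_def norm_mult)
  ultimately show ?thesis by (intro abs_summable_summable[of "pentagonal_term c \<tau>"]) simp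
qed

theorem eta_has_sum:
  assumes \<tau>: "Im \<tau> > 0"
  shows "(pentagonal_term 1 \<tau> has_sum dedekind_eta \<tau>) UNIV"
    and "dedekind_eta \<tau> \<noteq> 0"
proof -
  define x where "x = exp (2 * of_real pi * \<i> * \<tau>)"
  define e where "e = exp (of_real pi * \<i> * \<tau> / 12)"
  have x: "norm x < 1" using \<tau> by (simp add: x_def)
  have xpow: "x ^ n = exp (2 * of_real pi * \<i> * of_nat n * \<tau>)" for n
    unfolding x_def exp_of_nat_mult[symmetric] by (simp add: mult_ac)
  have eta: "dedekind_eta \<tau> = e * (\<Prod>n. 1 - x ^ Suc n)"
    unfolding dedekind_eta_def e_def xpow ..
  have "1 - x ^ Suc n \<noteq> 0" for n
  proof
    assume "1 - x ^ Suc n = 0"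
    hence "norm (x ^ Suc n) = 1" by (metis eq_iff_diff_eq_0 norm_one)
    moreover have "norm x ^ Suc n \<le> norm x ^ 1"
      using x by (intro power_decreasing) auto
    hence "norm (x ^ Suc n) < 1" unfolding norm_power using x by simp
    ultimately show False by simp
  qed
  thus "dedekind_eta \<tau> \<noteq> 0"
    unfolding eta using prodinf_nonzero[OF euler_partial_products(1)[OF x]] by (simp add: e_def)
  have p: "pentagonal_term 1 \<tau> (int m) = e * ((-1) ^ m * x ^ (m\<^sup>2 + triangular m))" for m
  proof -
    have "pentagonal_term 1 \<tau> (int m) = (-1) ^ m * (e * x ^ (m\<^sup>2 + triangular m))"
    proof -
      have eq: "2 * of_real pi * \<i> * ((of_int (6 * (int m) + 1))\<^sup>2 / 24 * \<tau>) =
          of_real pi * \<i> * \<tau> / 12 + 2 * of_real pi * \<i> * of_nat (m\<^sup>2 + triangular m) * \<tau>"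
        unfolding of_nat_add of_nat_triangular by (simp add: field_simps power2_eq_square)
      show ?thesis unfolding pentagonal_term_def alt_sign_simps alt_sign_int xpow e_def mult_exp_exp eq ..
    qed
    thus ?thesis by (simp add: mult_ac)
  qed
  have m: "pentagonal_term 1 \<tau> (- int (Suc m)) = e * ((-1) ^ Suc m * x ^ ((Suc m)\<^sup>2 + triangular m))" for m
  proof -
    have "pentagonal_term 1 \<tau> (- int (Suc m)) = (-1) ^ Suc m * (e * x ^ ((Suc m)\<^sup>2 + triangular m))"
    proof -
      have eq: "2 * of_real pi * \<i> * ((of_int (6 * (- int (Suc m)) + 1))\<^sup>2 / 24 * \<tau>) =
          of_real pi * \<i> * \<tau> / 12 + 2 * of_real pi * \<i> * of_nat ((Suc m)\<^sup>2 + triangular m) * \<tau>"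
        unfolding of_nat_add of_nat_triangular by (simp add: field_simps power2_eq_square)
      show ?thesis unfolding pentagonal_term_def alt_sign_simps alt_sign_int xpow e_def mult_exp_exp eq ..
    qed
    thus ?thesis by (simp add: mult_ac)
  qed
  have part: "(\<Sum>k\<in>{- int n..int n}. pentagonal_term 1 \<tau> k) = e *
     (1 + (\<Sum>k<n. (-1) ^ Suc k * (x ^ ((Suc k)\<^sup>2 + triangular (Suc k)) + x ^ ((Suc k)\<^sup>2 + triangular k))))" for n
  proof (induction n)
    case 0
    show ?case using p[of 0] by simp
  next
    case (Suc n)
    have "{- int (Suc n)..int (Suc n)} = insert (int (Suc n)) (insert (- int (Suc n)) {- int n..int n})"
      by auto
    hence "(\<Sum>k\<in>{- int (Suc n)..int (Suc n)}. pentagonal_term 1 \<tau> k) =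
        pentagonal_term 1 \<tau> (int (Suc n)) + (pentagonal_term 1 \<tau> (- int (Suc n)) + (\<Sum>k\<in>{- int n..int n}. pentagonal_term 1 \<tau> k))"
      by simp
    thus ?case unfolding p m Suc.IH by (simp add: algebra_simps)
  qed
  obtain H where H: "(pentagonal_term 1 \<tau> has_sum H) UNIV"
    using pentagonal_term_summable[OF \<tau>] unfolding summable_on_def by blast
  have "(\<lambda>n. \<Sum>k\<in>{- int n..int n}. pentagonal_term 1 \<tau> k) \<longlonglongrightarrow> dedekind_eta \<tau>"
    unfolding part eta by (intro tendsto_mult_left euler_partial_products(2)[OF x])
  with has_sum_int_imp_LIMSEQ[OF H] have "H = dedekind_eta \<tau>" by (rule LIMSEQ_unique)
  thus "(pentagonal_term 1 \<tau> has_sum dedekind_eta \<tau>) UNIV" using H by simp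
qed

lemma pentagonal_term_minus_one_has_sum:
  assumes "Im \<tau> > 0"
  shows "(pentagonal_term (-1) \<tau> has_sum dedekind_eta \<tau>) UNIV"
proof -
  have "pentagonal_term (-1) \<tau> k = pentagonal_term 1 \<tau> (- k)" for k
    by (simp add: pentagonal_term_def power2_eq_square algebra_simps)
  hence "(pentagonal_term (-1) \<tau> has_sum dedekind_eta \<tau>) UNIV \<longleftrightarrow> (pentagonal_term 1 \<tau> has_sum dedekind_eta \<tau>) UNIV"
    by (intro has_sum_reindex_bij_witness[of _ uminus uminus]) auto
  thus ?thesis using eta_has_sum(1)[OF assms] by simp
qed

lemma pentagonal_term_three_has_sum:
  assumes "Im \<tau> > 0"
  shows "(pentagonal_term 3 \<tau> has_sum 0) UNIV"
proof -
  obtain H where H: "(pentagonal_term 3 \<tau> has_sum H) UNIV"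
    using pentagonal_term_summable[OF assms] unfolding summable_on_def by blast
  have "(of_int (6 * (- k - 1) + 3) :: complex)\<^sup>2 = (of_int (6 * k + 3))\<^sup>2" for k
    by (simp add: power2_eq_square algebra_simps)
  hence "pentagonal_term 3 \<tau> (- k - 1) = - pentagonal_term 3 \<tau> k" for k
    unfolding pentagonal_term_def by simp
  hence "((\<lambda>k. - pentagonal_term 3 \<tau> k) has_sum H) UNIV \<longleftrightarrow> (pentagonal_term 3 \<tau> has_sum H) UNIV"
    by (intro has_sum_reindex_bij_witness[of _ "\<lambda>k. - k - 1" "\<lambda>k. - k - 1"]) auto
  moreover have "((\<lambda>k. - pentagonal_term 3 \<tau> k) has_sum (- H)) UNIV"
    using H by (rule has_sum_uminusI)
  ultimately have "H = - H" using H by (metis has_sum_unique)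
  thus ?thesis using H by simp
qed

section \<open>Elementary transformations of theta and eta\<close>

definition theta_coeff :: "int \<Rightarrow> complex" where
  "theta_coeff n = of_int (kronecker_minus4 n)"

lemma theta_coeff_exp_bounded: "exp_bounded theta_coeff"
  by (rule exp_boundedI_bound[of _ 1]) (auto simp: theta_coeff_def kronecker_minus4_def)

lemma jacobi_theta_eq_series: "jacobi_theta = theta_series theta_coeff"
  by (simp add: fun_eq_iff jacobi_theta_def theta_series_def theta_term_def theta_coeff_def)

lemma theta_coeff_odd: "theta_coeff (2 * k + 1) = alt_sign k"
proof -
  have "(2 * k + 1) mod 4 = (if even k then 1 else 3)"
    by presburger
  thus ?thesis by (simp add: theta_coeff_def kronecker_minus4_def alt_sign_def)
qed

lemma theta_coeff_even: "even n \<Longrightarrow> theta_coeff n = 0"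
proof -
  assume "even n"
  hence "n mod 4 \<noteq> 1" "n mod 4 \<noteq> 3" by presburger+
  thus ?thesis by (simp add: theta_coeff_def kronecker_minus4_def)
qed

text \<open>
  The theta function as a sum over the odd integers \<open>2 * k + 1\<close>, on which the character
  is \<open>(-1) ^ k\<close>.
\<close>

definition odd_theta_term :: "complex \<Rightarrow> complex \<Rightarrow> int \<Rightarrow> complex" where
  "odd_theta_term \<tau> z k = alt_sign k *
     exp (2 * of_real pi * \<i> * ((of_int (2 * k + 1))\<^sup>2 / 8 * \<tau> + of_int (2 * k + 1) / 2 * z))"

lemma odd_theta_term_eq: "odd_theta_term \<tau> z k = theta_term theta_coeff \<tau> z (2 * k + 1)"
  unfolding odd_theta_term_def theta_term_def theta_coeff_odd ..

lemma range_odd_int: "range (\<lambda>k::int. 2 * k + 1) = {n. odd n}"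
  by (auto elim!: oddE)

lemma jacobi_theta_has_sum:
  assumes "Im \<tau> > 0"
  shows "(odd_theta_term \<tau> z has_sum jacobi_theta \<tau> z) UNIV"
proof -
  have "(theta_term theta_coeff \<tau> z has_sum jacobi_theta \<tau> z) UNIV"
    unfolding jacobi_theta_eq_series by (rule theta_series_has_sum[OF theta_coeff_exp_bounded assms])
  hence "(theta_term theta_coeff \<tau> z has_sum jacobi_theta \<tau> z) (range (\<lambda>k::int. 2 * k + 1))"
    by (subst has_sum_cong_neutral[where T = UNIV and g = "theta_term theta_coeff \<tau> z"])
       (auto simp: range_odd_int theta_term_def theta_coeff_even)
  thus ?thesis
    by (subst (asm) has_sum_reindex) (auto simp: inj_on_def o_def odd_theta_term_eq[abs_def])
qed

lemma exp_pi_i_int: "exp (of_real pi * \<i> * of_int n) = alt_sign n"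
proof (cases "even n")
  case True
  then obtain m where "n = 2 * m" by (elim evenE)
  thus ?thesis using exp_integer_2pi[of "of_int m"] by (simp add: alt_sign_def mult_ac)
next
  case False
  then obtain m where m: "n = 2 * m + 1" by (elim oddE)
  have "exp (of_real pi * \<i> * of_int n) = exp ((2 * of_int m * of_real pi) * \<i>) * exp (of_real pi * \<i>)"
    unfolding mult_exp_exp by (simp add: m algebra_simps)
  also have "\<dots> = -1" using exp_integer_2pi[of "of_int m"] exp_pi_i by (simp add: mult_ac)
  finally show ?thesis using False by (simp add: alt_sign_def)
qed

lemma exp_2pi_i_int: "exp (2 * of_real pi * \<i> * of_int n) = 1"
  using exp_pi_i_int[of "2 * n"] by (simp add: alt_sign_def mult_ac)

lemma jacobi_theta_elliptic:
  assumes "Im \<tau> > 0"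
  shows "jacobi_theta \<tau> (z + of_int x * \<tau> + of_int y) =
    alt_sign (x + y) * exp (- (of_real pi * \<i> * ((of_int x)\<^sup>2 * \<tau> + 2 * of_int x * z))) * jacobi_theta \<tau> z"
proof -
  define c where "c = alt_sign (x + y) * exp (- (of_real pi * \<i> * ((of_int x)\<^sup>2 * \<tau> + 2 * of_int x * z)))"
  have t: "odd_theta_term \<tau> (z + of_int x * \<tau> + of_int y) k = c * odd_theta_term \<tau> z (k + x)" for k
  proof -
    define E where "E = exp (2 * of_real pi * \<i> * ((of_int (2 * (k + x) + 1))\<^sup>2 / 8 * \<tau> + of_int (2 * (k + x) + 1) / 2 * z))"
    have "2 * of_real pi * \<i> * ((of_int (2 * k + 1))\<^sup>2 / 8 * \<tau> + of_int (2 * k + 1) / 2 * (z + of_int x * \<tau> + of_int y))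
      = of_real pi * \<i> * of_int ((2 * k + 1) * y) + - (of_real pi * \<i> * ((of_int x)\<^sup>2 * \<tau> + 2 * of_int x * z))
        + 2 * of_real pi * \<i> * ((of_int (2 * (k + x) + 1))\<^sup>2 / 8 * \<tau> + of_int (2 * (k + x) + 1) / 2 * z)"
      by (simp add: field_simps power2_eq_square)
    hence j: "odd_theta_term \<tau> (z + of_int x * \<tau> + of_int y) k = alt_sign k * (alt_sign ((2 * k + 1) * y) *
        exp (- (of_real pi * \<i> * ((of_int x)\<^sup>2 * \<tau> + 2 * of_int x * z))) * E)"
      unfolding odd_theta_term_def E_def exp_pi_i_int[symmetric] mult_exp_exp by (simp only:)
    have s: "alt_sign k * alt_sign ((2 * k + 1) * y) = alt_sign (x + y) * alt_sign (k + x)"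
      by (auto simp: alt_sign_def)
    show ?thesis
      unfolding j c_def odd_theta_term_def[of \<tau> z] E_def[symmetric] mult.assoc[symmetric] s
      by (simp only: mult_ac)
  qed
  have "((\<lambda>k. c * odd_theta_term \<tau> z (k + x)) has_sum c * jacobi_theta \<tau> z) UNIV"
  proof (rule has_sum_cmult_right)
    show "((\<lambda>k. odd_theta_term \<tau> z (k + x)) has_sum jacobi_theta \<tau> z) UNIV"
      using jacobi_theta_has_sum[OF assms, of z]
      by (subst has_sum_reindex_bij_witness[of _ "\<lambda>k. k - x" "\<lambda>k. k + x"]) auto
  qed
  hence "(odd_theta_term \<tau> (z + of_int x * \<tau> + of_int y) has_sum c * jacobi_theta \<tau> z) UNIV"
    unfolding t .
  from has_sum_unique[OF jacobi_theta_has_sum[OF assms] this] show ?thesis unfolding c_def .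
qed

lemma jacobi_theta_minus:
  assumes "Im \<tau> > 0"
  shows "jacobi_theta \<tau> (- z) = - jacobi_theta \<tau> z"
proof -
  have t: "odd_theta_term \<tau> (- z) k = - odd_theta_term \<tau> z (- k - 1)" for k
  proof -
    have "2 * of_real pi * \<i> * ((of_int (2 * k + 1))\<^sup>2 / 8 * \<tau> + of_int (2 * k + 1) / 2 * (- z)) =
      2 * of_real pi * \<i> * ((of_int (2 * (- k - 1) + 1))\<^sup>2 / 8 * \<tau> + of_int (2 * (- k - 1) + 1) / 2 * z)"
      by (simp add: field_simps power2_eq_square)
    thus ?thesis unfolding odd_theta_term_def by (simp only: alt_sign_simps) simp
  qed
  have "((\<lambda>k. odd_theta_term \<tau> z (- k - 1)) has_sum jacobi_theta \<tau> z) UNIV"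
    using jacobi_theta_has_sum[OF assms, of z]
    by (subst has_sum_reindex_bij_witness[of _ "\<lambda>k. - k - 1" "\<lambda>k. - k - 1"]) auto
  from has_sum_uminusI[OF this]
  have "(odd_theta_term \<tau> (- z) has_sum - jacobi_theta \<tau> z) UNIV" unfolding t .
  from has_sum_unique[OF jacobi_theta_has_sum[OF assms] this] show ?thesis .
qed

lemma jacobi_theta_shift:
  assumes "Im \<tau> > 0"
  shows "jacobi_theta (\<tau> + of_int b) z = exp (of_real pi * \<i> * of_int b / 4) * jacobi_theta \<tau> z"
proof -
  have t: "odd_theta_term (\<tau> + of_int b) z k = exp (of_real pi * \<i> * of_int b / 4) * odd_theta_term \<tau> z k" for k
  proof -
    obtain m where m: "k * (k + 1) = 2 * m" by (rule evenE[of "k * (k + 1)"]) auto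
    hence "of_int (k * (k + 1)) = (of_int (2 * m) :: complex)" by (simp only: m)
    hence m': "of_int k * (of_int k + 1) = (2 * of_int m :: complex)"
      by (simp only: of_int_mult of_int_add of_int_1 of_int_numeral)
    have "(of_int (2 * k + 1))\<^sup>2 / 8 = of_int k * (of_int k + 1) / 2 + (1 / 8 :: complex)"
      by (simp add: field_simps power2_eq_square)
    hence e: "(of_int (2 * k + 1))\<^sup>2 / 8 = (of_int m + 1 / 8 :: complex)"
      unfolding m' by simp
    have "2 * of_real pi * \<i> * ((of_int (2 * k + 1))\<^sup>2 / 8 * (\<tau> + of_int b) + of_int (2 * k + 1) / 2 * z) =
      of_real pi * \<i> * of_int b / 4 +
      2 * of_real pi * \<i> * ((of_int (2 * k + 1))\<^sup>2 / 8 * \<tau> + of_int (2 * k + 1) / 2 * z)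
      + 2 * of_real pi * \<i> * of_int (m * b)"
      unfolding e by (simp add: algebra_simps)
    thus ?thesis unfolding odd_theta_term_def by (simp only: exp_add exp_2pi_i_int) simp
  qed
  have "((\<lambda>k. exp (of_real pi * \<i> * of_int b / 4) * odd_theta_term \<tau> z k) has_sum
     exp (of_real pi * \<i> * of_int b / 4) * jacobi_theta \<tau> z) UNIV"
    by (intro has_sum_cmult_right jacobi_theta_has_sum assms)
  moreover have "(odd_theta_term (\<tau> + of_int b) z has_sum jacobi_theta (\<tau> + of_int b) z) UNIV"
    by (rule jacobi_theta_has_sum) (use assms in simp)
  ultimately show ?thesis unfolding t by (metis has_sum_unique)
qed

lemma dedekind_eta_shift:
  assumes "Im \<tau> > 0"
  shows "dedekind_eta (\<tau> + of_int b) = exp (of_real pi * \<i> * of_int b / 12) * dedekind_eta \<tau>"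
proof -
  have t: "pentagonal_term 1 (\<tau> + of_int b) k = exp (of_real pi * \<i> * of_int b / 12) * pentagonal_term 1 \<tau> k" for k
  proof -
    obtain m where m: "k * (3 * k + 1) = 2 * m" by (rule evenE[of "k * (3 * k + 1)"]) auto
    hence "of_int (k * (3 * k + 1)) = (of_int (2 * m) :: complex)" by (simp only: m)
    hence m': "of_int k * (3 * of_int k + 1) = (2 * of_int m :: complex)"
      by (simp only: of_int_mult of_int_add of_int_1 of_int_numeral)
    have "(of_int (6 * k + 1))\<^sup>2 / 24 = of_int k * (3 * of_int k + 1) / 2 + (1 / 24 :: complex)"
      by (simp add: field_simps power2_eq_square)
    hence e: "(of_int (6 * k + 1))\<^sup>2 / 24 = (of_int m + 1 / 24 :: complex)"
      unfolding m' by simp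
    have "2 * of_real pi * \<i> * ((of_int (6 * k + 1))\<^sup>2 / 24 * (\<tau> + of_int b)) =
      of_real pi * \<i> * of_int b / 12 + 2 * of_real pi * \<i> * ((of_int (6 * k + 1))\<^sup>2 / 24 * \<tau>)
      + 2 * of_real pi * \<i> * of_int (m * b)"
      unfolding e by (simp add: algebra_simps)
    thus ?thesis unfolding pentagonal_term_def by (simp only: exp_add exp_2pi_i_int) simp
  qed
  have "((\<lambda>k. exp (of_real pi * \<i> * of_int b / 12) * pentagonal_term 1 \<tau> k) has_sum
     exp (of_real pi * \<i> * of_int b / 12) * dedekind_eta \<tau>) UNIV"
    by (intro has_sum_cmult_right eta_has_sum assms)
  moreover have "(pentagonal_term 1 (\<tau> + of_int b) has_sum dedekind_eta (\<tau> + of_int b)) UNIV"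
    by (rule eta_has_sum) (use assms in simp)
  ultimately show ?thesis unfolding t by (metis has_sum_unique)
qed

lemma exp_third: "exp (2 * of_real pi * \<i> / 3) - exp (- (2 * of_real pi * \<i> / 3)) = \<i> * of_real (sqrt 3)"
proof -
  have "sin (2 * pi / 3) = sqrt 3 / 2" by (simp add: sin_120)
  hence "sin (of_real (2 * pi / 3) :: complex) = of_real (sqrt 3 / 2)"
    by (simp only: sin_of_real)
  moreover have "sin (of_real (2 * pi / 3) :: complex) =
     (exp (2 * of_real pi * \<i> / 3) - exp (- (2 * of_real pi * \<i> / 3))) / (2 * \<i>)"
    by (simp add: sin_exp_eq mult_ac)
  ultimately show ?thesis by (simp add: field_simps)
qed

lemma int_mod3_partition: "(UNIV :: int set) = range (\<lambda>m. 3 * m) \<union> range (\<lambda>m. 3 * m + 1) \<union> range (\<lambda>m. 3 * m - 1)"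
proof -
  have "k \<in> range (\<lambda>m. 3 * m) \<union> range (\<lambda>m. 3 * m + 1) \<union> range (\<lambda>m. 3 * m - 1)" for k :: int
  proof -
    have "(\<exists>m. k = 3 * m) \<or> (\<exists>m. k = 3 * m + 1) \<or> (\<exists>m. k = 3 * m - 1)" by presburger
    thus ?thesis by blast
  qed
  thus ?thesis by blast
qed

text \<open>
  The summation index is split modulo 3. This expresses eta through theta, and is used both to
  transfer the inversion formula and holomorphy to eta and, since the eta product does not vanish,
  to see that \<open>jacobi_theta \<tau>\<close> is not identically zero.
\<close>

theorem jacobi_theta_third:
  assumes \<tau>: "Im \<tau> > 0"
  shows "jacobi_theta (\<tau> / 3) (2 / 3) = \<i> * of_real (sqrt 3) * dedekind_eta \<tau>"
proof -
  define w where "w = exp (2 * of_real pi * \<i> / 3)"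
  let ?f = "odd_theta_term (\<tau> / 3) (2 / 3)"
  have 0: "?f (3 * m) = w * pentagonal_term 1 \<tau> m" for m
  proof -
    have "2 * of_real pi * \<i> * ((of_int (2 * (3 * m) + 1))\<^sup>2 / 8 * (\<tau> / 3) + of_int (2 * (3 * m) + 1) / 2 * (2 / 3))
      = 2 * of_real pi * \<i> / 3 + 2 * of_real pi * \<i> * ((of_int (6 * m + 1))\<^sup>2 / 24 * \<tau>) + 2 * of_real pi * \<i> * of_int (2 * m)"
      by (simp add: field_simps)
    thus ?thesis unfolding odd_theta_term_def pentagonal_term_def w_def
      by (simp only: exp_add exp_2pi_i_int) (simp add: alt_sign_def)
  qed
  have 1: "?f (3 * m + 1) = - pentagonal_term 3 \<tau> m" for m
  proof -
    have "2 * of_real pi * \<i> * ((of_int (2 * (3 * m + 1) + 1))\<^sup>2 / 8 * (\<tau> / 3) + of_int (2 * (3 * m + 1) + 1) / 2 * (2 / 3))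
      = 2 * of_real pi * \<i> * ((of_int (6 * m + 3))\<^sup>2 / 24 * \<tau>) + 2 * of_real pi * \<i> * of_int (2 * m + 1)"
      by (simp add: field_simps)
    thus ?thesis unfolding odd_theta_term_def pentagonal_term_def
      by (simp only: exp_add exp_2pi_i_int) (simp add: alt_sign_def)
  qed
  have 2: "?f (3 * m - 1) = - inverse w * pentagonal_term (-1) \<tau> m" for m
  proof -
    have "2 * of_real pi * \<i> * ((of_int (2 * (3 * m - 1) + 1))\<^sup>2 / 8 * (\<tau> / 3) + of_int (2 * (3 * m - 1) + 1) / 2 * (2 / 3))
      = - (2 * of_real pi * \<i> / 3) + 2 * of_real pi * \<i> * ((of_int (6 * m + -1))\<^sup>2 / 24 * \<tau>) + 2 * of_real pi * \<i> * of_int (2 * m)"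
      by (simp add: field_simps)
    thus ?thesis unfolding odd_theta_term_def pentagonal_term_def w_def
      by (simp only: exp_add exp_2pi_i_int exp_minus) (simp add: alt_sign_def)
  qed
  have "(?f has_sum w * dedekind_eta \<tau>) (range (\<lambda>m. 3 * m))"
    by (subst has_sum_reindex)
       (auto simp: inj_on_def o_def 0 intro!: has_sum_cmult_right eta_has_sum \<tau>)
  moreover have "(?f has_sum - 0) (range (\<lambda>m. 3 * m + 1))"
    by (subst has_sum_reindex)
       (auto simp: inj_on_def o_def 1 simp del: neg_0_equal_iff_equal minus_zero
         intro!: has_sum_uminusI pentagonal_term_three_has_sum \<tau>)
  moreover have "(?f has_sum - inverse w * dedekind_eta \<tau>) (range (\<lambda>m. 3 * m - 1))"
  proof (subst has_sum_reindex)
    show "inj (\<lambda>m::int. 3 * m - 1)" by (simp add: inj_on_def)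
    show "(?f \<circ> (\<lambda>m. 3 * m - 1) has_sum - inverse w * dedekind_eta \<tau>) UNIV"
      unfolding o_def 2 by (intro has_sum_cmult_right pentagonal_term_minus_one_has_sum \<tau>)
  qed
  ultimately have "(?f has_sum w * dedekind_eta \<tau> + - 0 + - inverse w * dedekind_eta \<tau>)
      (range (\<lambda>m. 3 * m) \<union> range (\<lambda>m. 3 * m + 1) \<union> range (\<lambda>m. 3 * m - 1))"
    by (intro has_sum_Un_disjoint) (auto, presburger+)
  hence "(?f has_sum w * dedekind_eta \<tau> + - 0 + - inverse w * dedekind_eta \<tau>) UNIV"
    by (simp only: int_mod3_partition[symmetric])
  moreover have "(?f has_sum jacobi_theta (\<tau> / 3) (2 / 3)) UNIV"
    by (rule jacobi_theta_has_sum) (use \<tau> in simp)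
  ultimately have "w * dedekind_eta \<tau> + - 0 + - inverse w * dedekind_eta \<tau> = jacobi_theta (\<tau> / 3) (2 / 3)"
    by (rule has_sum_unique)
  hence "jacobi_theta (\<tau> / 3) (2 / 3) = (w - inverse w) * dedekind_eta \<tau>"
    by (simp add: left_diff_distrib)
  thus ?thesis using exp_third unfolding w_def exp_minus by simp
qed

lemma jacobi_theta_third_nonzero:
  assumes "Im \<tau> > 0"
  shows "jacobi_theta \<tau> (2 / 3) \<noteq> 0"
  using jacobi_theta_third[of "3 * \<tau>"] eta_has_sum(2)[of "3 * \<tau>"] assms by simp

text \<open>
  The value at the 3-torsion point \<open>2 * \<tau>\<close> for the modulus \<open>3 * \<tau>\<close>, which inversion carries to the
  3-torsion point \<open>2 / 3\<close> for the modulus \<open>- 1 / (3 * \<tau>)\<close>.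
\<close>

lemma jacobi_theta_tau_third:
  assumes \<tau>: "Im \<tau> > 0"
  shows "exp (4 * of_real pi * \<i> * \<tau> / 3) * jacobi_theta (3 * \<tau>) (2 * \<tau>) = - dedekind_eta \<tau>"
proof -
  have t: "exp (4 * of_real pi * \<i> * \<tau> / 3) * odd_theta_term (3 * \<tau>) (2 * \<tau>) k = - pentagonal_term 1 \<tau> (k + 1)" for k
  proof -
    have "4 * of_real pi * \<i> * \<tau> / 3 +
      2 * of_real pi * \<i> * ((of_int (2 * k + 1))\<^sup>2 / 8 * (3 * \<tau>) + of_int (2 * k + 1) / 2 * (2 * \<tau>)) =
      2 * of_real pi * \<i> * ((of_int (6 * (k + 1) + 1))\<^sup>2 / 24 * \<tau>)"
      by (simp add: field_simps power2_eq_square)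
    hence "exp (4 * of_real pi * \<i> * \<tau> / 3) *
      exp (2 * of_real pi * \<i> * ((of_int (2 * k + 1))\<^sup>2 / 8 * (3 * \<tau>) + of_int (2 * k + 1) / 2 * (2 * \<tau>))) =
      exp (2 * of_real pi * \<i> * ((of_int (6 * (k + 1) + 1))\<^sup>2 / 24 * \<tau>))"
      unfolding mult_exp_exp by (simp only:)
    thus ?thesis unfolding odd_theta_term_def pentagonal_term_def by (simp only: alt_sign_simps mult.left_commute mult_minus_left minus_minus)
  qed
  have "((\<lambda>k. exp (4 * of_real pi * \<i> * \<tau> / 3) * odd_theta_term (3 * \<tau>) (2 * \<tau>) k) has_sum
     exp (4 * of_real pi * \<i> * \<tau> / 3) * jacobi_theta (3 * \<tau>) (2 * \<tau>)) UNIV"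
    by (intro has_sum_cmult_right jacobi_theta_has_sum) (use \<tau> in simp)
  moreover have "((\<lambda>k. - pentagonal_term 1 \<tau> (k + 1)) has_sum - dedekind_eta \<tau>) UNIV"
  proof (rule has_sum_uminusI)
    show "((\<lambda>k. pentagonal_term 1 \<tau> (k + 1)) has_sum dedekind_eta \<tau>) UNIV"
      using eta_has_sum(1)[OF \<tau>]
      by (subst has_sum_reindex_bij_witness[of _ "\<lambda>k. k - 1" "\<lambda>k. k + 1"]) auto
  qed
  ultimately show ?thesis unfolding t by (rule has_sum_unique)
qed

section \<open>Entire functions with the quasi-periodicity of theta\<close>

text \<open>
  A continuous function on \<open>[0, 1]\<close> all of whose Fourier coefficients vanish.
\<close>

definition fourier_null :: "(real \<Rightarrow> complex) \<Rightarrow> bool" where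
  "fourier_null g \<longleftrightarrow> continuous_on {0..1} g \<and>
     (\<forall>n::int. integral {0..1} (\<lambda>t. g t * cis (2 * pi * of_int n * t)) = 0)"

lemma fourier_null_trig_polynomial:
  assumes "real_polynomial_function p" "fourier_null g"
  shows "fourier_null (\<lambda>t. g t * of_real (p (cis (2 * pi * t))))"
  using assms
proof (induction p arbitrary: g rule: real_polynomial_function.induct)
  case (linear p)
  interpret p: bounded_linear p by fact
  define E where "E = (\<lambda>(n::int) t. cis (2 * pi * of_int n * t))"
  define \<alpha> where "\<alpha> = of_real (p 1) / 2 + of_real (p \<i>) / (2 * \<i>)"
  define \<beta> where "\<beta> = of_real (p 1) / 2 - of_real (p \<i>) / (2 * \<i>)"
  have cg: "continuous_on {0..1} g" and zero: "integral {0..1} (\<lambda>t. g t * E n t) = 0" for n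
    using linear.prems by (auto simp: fourier_null_def E_def)
  have cE: "continuous_on {0..1} (E n)" for n
    unfolding E_def by (intro continuous_intros)
  have pE: "of_real (p (cis (2 * pi * t))) = \<alpha> * E 1 t + \<beta> * E (-1) t" for t
  proof -
    have "p (cis (2 * pi * t)) = p (cos (2 * pi * t) *\<^sub>R 1 + sin (2 * pi * t) *\<^sub>R \<i>)"
      by (rule arg_cong[of _ _ p]) (simp add: complex_eq_iff)
    also have "\<dots> = cos (2 * pi * t) * p 1 + sin (2 * pi * t) * p \<i>"
      by (simp add: p.add p.scaleR)
    finally show ?thesis
      by (simp add: \<alpha>_def \<beta>_def E_def complex_eq_iff field_simps)
  qed
  have mul: "E m t * E n t = E (m + n) t" for m n t
    by (simp add: E_def cis_mult algebra_simps)
  have "integral {0..1} (\<lambda>t. g t * of_real (p (cis (2 * pi * t))) * E n t) = 0" for n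
  proof -
    have "g t * of_real (p (cis (2 * pi * t))) * E n t =
        \<alpha> * (g t * E (1 + n) t) + \<beta> * (g t * E (-1 + n) t)" for t
      unfolding pE mul[symmetric] by (simp only: algebra_simps)
    moreover have "integral {0..1} (\<lambda>t. \<alpha> * (g t * E (1 + n) t) + \<beta> * (g t * E (-1 + n) t)) =
        \<alpha> * integral {0..1} (\<lambda>t. g t * E (1 + n) t) + \<beta> * integral {0..1} (\<lambda>t. g t * E (-1 + n) t)"
      by (subst integral_add) (auto intro!: integrable_continuous_real continuous_intros cg cE)
    ultimately show ?thesis by (simp add: zero)
  qed
  moreover have "continuous_on {0..1} (\<lambda>t. g t * of_real (p (cis (2 * pi * t))))"
    unfolding pE by (intro continuous_intros cg cE)
  ultimately show ?case by (simp add: fourier_null_def E_def)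
next
  case (const c)
  thus ?case
    by (auto simp: fourier_null_def mult.assoc mult.left_commute[of _ "of_real c"] intro!: continuous_intros)
next
  case (add p q)
  let ?P = "\<lambda>t. g t * of_real (p (cis (2 * pi * t)))" and ?Q = "\<lambda>t. g t * of_real (q (cis (2 * pi * t)))"
  have P: "fourier_null ?P" and Q: "fourier_null ?Q" using add by auto
  have "integral {0..1} (\<lambda>t. (?P t + ?Q t) * cis (2 * pi * of_int n * t)) = 0" for n
    unfolding distrib_right using P Q unfolding fourier_null_def
    by (subst integral_add) (auto intro!: integrable_continuous_real continuous_intros)
  moreover have "continuous_on {0..1} (\<lambda>t. ?P t + ?Q t)"
    using P Q unfolding fourier_null_def by (auto intro!: continuous_intros)
  ultimately have "fourier_null (\<lambda>t. ?P t + ?Q t)" unfolding fourier_null_def by blast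
  thus ?case by (simp add: distrib_left)
next
  case (mult p q)
  have "fourier_null (\<lambda>t. g t * of_real (p (cis (2 * pi * t))) * of_real (q (cis (2 * pi * t))))"
    by (rule mult.IH(2)[OF mult.IH(1)[OF mult.prems]])
  thus ?case by (simp add: mult.assoc)
qed

text \<open>
  Every continuous function on the circle is a uniform limit of real polynomials in the real and
  imaginary part, by Stone-Weierstrass, and these restrict to trigonometric polynomials.
\<close>

lemma fourier_null_orthogonal:
  assumes g: "fourier_null g" and u: "continuous_on (sphere 0 1) (u :: complex \<Rightarrow> real)"
  shows "integral {0..1} (\<lambda>t. g t * of_real (u (cis (2 * pi * t)))) = 0"
proof -
  have cg: "continuous_on {0..1} g" using g by (simp add: fourier_null_def)
  have cu: "continuous_on {0..1} (\<lambda>t. u (cis (2 * pi * t)))"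
    by (rule continuous_on_compose2[OF u]) (auto intro!: continuous_intros)
  have "bounded (g ` {0..1})"
    using compact_continuous_image[OF cg] by (intro compact_imp_bounded) simp
  then obtain B where "B > 0" "\<forall>x\<in>g ` {0..1}. norm x \<le> B" unfolding bounded_pos by blast
  hence B: "\<And>t. t \<in> {0..1} \<Longrightarrow> norm (g t) \<le> B" "B > 0" by auto
  have "norm (integral {0..1} (\<lambda>t. g t * of_real (u (cis (2 * pi * t))))) \<le> 0 + e" if "e > 0" for e
  proof -
    have "0 < e / B" using that B by simp
    then obtain p where p: "real_polynomial_function p"
      "\<And>x. x \<in> sphere 0 1 \<Longrightarrow> \<bar>u x - p x\<bar> < e / B"
      using Stone_Weierstrass_real_polynomial_function[OF compact_sphere u] by blast
    have np: "fourier_null (\<lambda>t. g t * of_real (p (cis (2 * pi * t))))"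
      by (rule fourier_null_trig_polynomial[OF p(1) g])
    hence cp: "continuous_on {0..1} (\<lambda>t. g t * of_real (p (cis (2 * pi * t))))"
      by (simp add: fourier_null_def)
    have ip: "integral {0..1} (\<lambda>t. g t * of_real (p (cis (2 * pi * t)))) = 0"
      using np unfolding fourier_null_def by (metis (no_types, lifting) cis_zero integral_cong
        mult.right_neutral mult_zero_left mult_zero_right of_int_0)
    have "integral {0..1} (\<lambda>t. g t * of_real (u (cis (2 * pi * t)))) =
      integral {0..1} (\<lambda>t. g t * of_real (u (cis (2 * pi * t))) - g t * of_real (p (cis (2 * pi * t))))"
      by (subst integral_diff) (auto simp: ip intro!: integrable_continuous_real continuous_intros cp cg cu)
    also have "norm \<dots> \<le> e * (1 - 0)"
    proof (rule integral_bound)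
      show "continuous_on {0..1} (\<lambda>t. g t * of_real (u (cis (2 * pi * t))) - g t * of_real (p (cis (2 * pi * t))))"
        by (intro continuous_intros cp cg cu)
      fix t :: real assume t: "t \<in> {0..1}"
      have "norm (g t * of_real (u (cis (2 * pi * t))) - g t * of_real (p (cis (2 * pi * t)))) =
        norm (g t) * \<bar>u (cis (2 * pi * t)) - p (cis (2 * pi * t))\<bar>"
        by (simp add: right_diff_distrib[symmetric] norm_mult flip: of_real_diff)
      also have "\<dots> \<le> B * (e / B)"
        using p(2)[of "cis (2 * pi * t)"] B t by (intro mult_mono) auto
      finally show "norm (g t * of_real (u (cis (2 * pi * t))) - g t * of_real (p (cis (2 * pi * t)))) \<le> e"
        using B by simp
    qed simp
    finally show ?thesis by simp
  qed
  hence "norm (integral {0..1} (\<lambda>t. g t * of_real (u (cis (2 * pi * t))))) \<le> 0"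
    by (rule field_le_epsilon)
  thus ?thesis by simp
qed

lemma fourier_null_circle_imp_zero:
  assumes h: "continuous_on (sphere 0 1) h" and g: "fourier_null (\<lambda>t. h (cis (2 * pi * t)))"
    and t: "t \<in> {0..1}"
  shows "h (cis (2 * pi * t)) = 0"
proof -
  let ?g = "\<lambda>t. h (cis (2 * pi * t))"
  have cg: "continuous_on {0..1} ?g" using g by (simp add: fourier_null_def)
  have re: "integral {0..1} (\<lambda>t. ?g t * of_real (Re (?g t))) = 0"
    by (rule fourier_null_orthogonal[OF g, of "\<lambda>z. Re (h z)"]) (intro continuous_intros h)
  have im: "integral {0..1} (\<lambda>t. ?g t * of_real (Im (?g t))) = 0"
    by (rule fourier_null_orthogonal[OF g, of "\<lambda>z. Im (h z)"]) (intro continuous_intros h)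
  have "of_real ((norm (?g t))\<^sup>2) = ?g t * of_real (Re (?g t)) - \<i> * (?g t * of_real (Im (?g t)))" for t
    unfolding cmod_power2 by (simp add: complex_eq_iff power2_eq_square)
  hence "integral {0..1} (\<lambda>t. complex_of_real ((norm (?g t))\<^sup>2)) =
     integral {0..1} (\<lambda>t. ?g t * of_real (Re (?g t)) - \<i> * (?g t * of_real (Im (?g t))))"
    by simp
  also have "\<dots> = 0"
    by (subst integral_diff) (auto simp: re im intro!: integrable_continuous_real continuous_intros cg)
  finally have "integral {0..1} (\<lambda>t. complex_of_real ((norm (?g t))\<^sup>2)) = 0" .
  moreover have "((\<lambda>t. (norm (?g t))\<^sup>2) has_integral integral {0..1} (\<lambda>t. (norm (?g t))\<^sup>2)) {0..1}"
    by (intro integrable_integral integrable_continuous_real continuous_intros cg)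
  hence "((\<lambda>t. complex_of_real ((norm (?g t))\<^sup>2)) has_integral
      of_real (integral {0..1} (\<lambda>t. (norm (?g t))\<^sup>2))) {0..1}"
    by (rule has_integral_of_real)
  ultimately have "complex_of_real (integral {0..1} (\<lambda>t. (norm (?g t))\<^sup>2)) = 0"
    using integral_unique by metis
  hence "integral {0..1} (\<lambda>t. (norm (?g t))\<^sup>2) = 0" by simp
  hence "\<forall>t\<in>{0..1}. (norm (?g t))\<^sup>2 = 0"
    by (subst (asm) integral_eq_0_iff) (auto intro!: continuous_intros cg)
  thus ?thesis using t by simp
qed

lemma periodic_of_int:
  fixes g :: "complex \<Rightarrow> 'a"
  assumes "\<And>z. g (z + 1) = g z"
  shows "g (z + of_int n) = g z"
proof (induction n arbitrary: z rule: int_induct[where k = 0])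
  case (step1 i)
  show ?case using step1(2)[of z] assms[of "z + of_int i"] by (simp add: add.assoc)
next
  case (step2 i)
  show ?case using step2(2)[of z] assms[of "z + of_int (i - 1)"] by (simp add: add.assoc)
qed simp

lemma periodic_entire_fourier_null_imp_zero:
  assumes g: "g holomorphic_on UNIV" and per: "\<And>z. g (z + 1) = g z"
    and null: "\<And>n::int. integral {0..1} (\<lambda>t. g (of_real t) * cis (2 * pi * of_int n * t)) = 0"
  shows "g z = 0"
proof -
  have cong: "g a = g b" if "exp (2 * of_real pi * \<i> * a) = exp (2 * of_real pi * \<i> * b)" for a b
  proof -
    obtain n :: int where "2 * of_real pi * \<i> * a = 2 * of_real pi * \<i> * b + of_int (2 * n) * of_real pi * \<i>"
      using \<open>exp _ = exp _\<close> unfolding exp_eq by auto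
    hence "2 * of_real pi * \<i> * a = 2 * of_real pi * \<i> * (b + of_int n)" by (simp add: algebra_simps)
    hence "a = b + of_int n" by simp
    thus ?thesis using periodic_of_int[of g b n] per by simp
  qed
  \<comment> \<open>The function on the punctured plane induced by \<open>g\<close>; it does not see the branch cut.\<close>
  define h where "h = (\<lambda>w. g (Ln w / (2 * of_real pi * \<i>)))"
  have isc: "isCont g z" for z
    using holomorphic_on_imp_differentiable_at[OF g, of z] by (auto intro: field_differentiable_imp_continuous_at)
  have ch: "isCont h w" if "w \<noteq> 0" for w
  proof (cases "w \<in> \<real>\<^sub>\<le>\<^sub>0")
    case False
    thus ?thesis unfolding h_def
      by (intro isCont_o2[of w _ g] continuous_intros isc) auto
  next
    case True
    define k where "k = (\<lambda>w. g (Ln (- w) / (2 * of_real pi * \<i>) + 1 / 2))"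
    have nz: "- w \<notin> \<real>\<^sub>\<le>\<^sub>0" using True that by (auto simp: complex_nonpos_Reals_iff complex_eq_iff)
    have "isCont k w" unfolding k_def
      by (intro isCont_o2[of w _ g] continuous_intros isc nz) auto
    moreover have "\<forall>\<^sub>F v in nhds w. k v = h v"
    proof -
      have "\<forall>\<^sub>F v in nhds w. v \<noteq> 0" using that by (rule t1_space_nhds)
      thus ?thesis
      proof eventually_elim
        case (elim v)
        have "exp (2 * of_real pi * \<i> * (Ln (- v) / (2 * of_real pi * \<i>) + 1 / 2)) = exp (Ln (- v) + of_real pi * \<i>)"
          by (rule arg_cong[of _ _ exp]) (simp add: distrib_left)
        also have "\<dots> = exp (2 * of_real pi * \<i> * (Ln v / (2 * of_real pi * \<i>)))"
          using elim by (simp add: exp_add)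
        finally show ?case unfolding k_def h_def by (rule cong)
      qed
    qed
    ultimately show ?thesis using isCont_cong by blast
  qed
  have hg: "h (cis (2 * pi * t)) = g (of_real t)" for t
    unfolding h_def by (rule cong) (simp add: cis_conv_exp mult_ac)
  have "continuous_on (sphere 0 1) h"
    by (intro continuous_at_imp_continuous_on ballI ch) auto
  moreover have "continuous_on {0..1} (\<lambda>t. g (of_real t))"
    by (intro continuous_on_compose2[OF holomorphic_on_imp_continuous_on[OF g]] continuous_intros) auto
  hence "fourier_null (\<lambda>t. h (cis (2 * pi * t)))"
    unfolding fourier_null_def hg using null by simp
  ultimately have z: "g (of_real t) = 0" if "t \<in> {0..1}" for t
    using fourier_null_circle_imp_zero[of h t] that hg by metis
  show ?thesis
  proof (rule analytic_continuation[of g UNIV "of_real ` {0..1}" 0 z])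
    show "(0::complex) islimpt of_real ` {0..1}"
    proof -
      have "(of_real 0 :: complex) islimpt of_real ` {0..1}"
        unfolding islimpt_sequential
      proof (intro exI conjI allI)
        show "(\<lambda>n. complex_of_real (inverse (real (Suc n)))) \<longlonglongrightarrow> of_real 0"
          by (intro tendsto_of_real LIMSEQ_inverse_real_of_nat)
        show "complex_of_real (inverse (real (Suc n))) \<in> of_real ` {0..1} - {of_real 0}" for n
        proof -
          have "inverse (real (Suc n)) \<in> {0..1}" "inverse (real (Suc n)) \<noteq> 0"
            by (auto simp: field_simps)
          thus ?thesis by (metis DiffI imageI of_real_eq_iff singletonD)
        qed
      qed
      thus ?thesis by simp
    qed
  qed (use g z in auto)
qed

text \<open>
  A primitive of \<open>g\<close> changes by a constant under \<open>z \<mapsto> z + 1\<close>, which replaces a contour shift.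
\<close>

lemma periodic_entire_integral_shift:
  assumes g: "g holomorphic_on UNIV" and per: "\<And>z. g (z + 1) = g z"
  shows "integral {0..1} (\<lambda>t. g (w + of_real t)) = integral {0..1} (\<lambda>t. g (of_real t))"
proof -
  obtain G where G: "\<And>z. (G has_field_derivative g z) (at z)"
    using holomorphic_convex_primitive'[of UNIV g] g by auto
  have int: "integral {0..1} (\<lambda>t. g (v + of_real t)) = G (v + 1) - G v" for v
  proof -
    have "((\<lambda>t. g (v + of_real t)) has_integral G (v + of_real 1) - G (v + of_real 0)) {0..1}"
    proof (rule fundamental_theorem_of_calculus)
      fix t :: real
      have "((\<lambda>z. G (v + z)) has_field_derivative g (v + of_real t)) (at (of_real t))"
      proof -
        have "((\<lambda>z. v + z) has_field_derivative 1) (at (of_real t))"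
          by (auto intro!: derivative_eq_intros)
        from DERIV_chain2[OF G this] show ?thesis by simp
      qed
      thus "((\<lambda>t. G (v + of_real t)) has_vector_derivative g (v + of_real t)) (at t within {0..1})"
        by (rule has_vector_derivative_real_field)
    qed simp
    thus ?thesis by (simp add: integral_unique)
  qed
  have "\<exists>c. \<forall>z\<in>UNIV. G (z + 1) - G z = c"
  proof (rule has_field_derivative_zero_constant)
    fix z
    have "((\<lambda>z. G (z + 1) - G z) has_field_derivative g (z + 1) * 1 - g z) (at z)"
      by (intro DERIV_diff DERIV_chain2[OF G] G derivative_eq_intros) auto
    thus "((\<lambda>z. G (z + 1) - G z) has_field_derivative 0) (at z)"
      by (simp add: per)
  qed simp
  then obtain c where c: "\<And>z. G (z + 1) - G z = c" by auto
  show ?thesis using int[of w] int[of 0] c[of w] c[of 0] by simp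
qed

text \<open>
  Under \<open>z \<mapsto> z + \<tau>\<close> the quasi-periodicity turns into a two-term recursion for the Fourier
  coefficients, so that a single vanishing coefficient forces all of them to vanish.
\<close>

lemma quasi_periodic_eq_zero:
  fixes \<tau> :: complex
  assumes f: "f holomorphic_on UNIV" and per: "\<And>z. f (z + 1) = - f z"
    and qper: "\<And>z. f (z + \<tau>) = - exp (- (of_real pi * \<i> * (\<tau> + 2 * z))) * f z"
    and c0: "integral {0..1} (\<lambda>t. f (of_real t) * exp (- (of_real pi * \<i> * of_real t))) = 0"
  shows "f z = 0"
proof -
  define g where "g = (\<lambda>(n::int) z. f z * exp (- (of_real pi * \<i> * of_int (2 * n + 1) * z)))"
  define c where "c = (\<lambda>n. integral {0..1} (\<lambda>t. g n (of_real t)))"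
  have hol: "g n holomorphic_on UNIV" for n
    unfolding g_def by (intro holomorphic_intros f)
  have gper: "g n (z + 1) = g n z" for n z
  proof -
    have "- (of_real pi * \<i> * of_int (2 * n + 1) * (z + 1)) =
      - (of_real pi * \<i> * of_int (2 * n + 1) * z) + of_real pi * \<i> * of_int (- (2 * n + 1))"
      by (simp add: algebra_simps)
    thus ?thesis unfolding g_def by (simp only: exp_add exp_pi_i_int per) (simp add: alt_sign_def)
  qed
  have rec: "c n = - exp (- (of_real pi * \<i> * (2 * of_int n + 2) * \<tau>)) * c (n + 1)" for n
  proof -
    have "g n (\<tau> + z) = - exp (- (of_real pi * \<i> * (2 * of_int n + 2) * \<tau>)) * g (n + 1) z" for z
    proof -
      have "- (of_real pi * \<i> * (\<tau> + 2 * z)) + - (of_real pi * \<i> * of_int (2 * n + 1) * (\<tau> + z)) =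
        - (of_real pi * \<i> * (2 * of_int n + 2) * \<tau>) + - (of_real pi * \<i> * of_int (2 * (n + 1) + 1) * z)"
        by (simp add: algebra_simps)
      hence "exp (- (of_real pi * \<i> * (\<tau> + 2 * z))) * exp (- (of_real pi * \<i> * of_int (2 * n + 1) * (\<tau> + z))) =
        exp (- (of_real pi * \<i> * (2 * of_int n + 2) * \<tau>)) * exp (- (of_real pi * \<i> * of_int (2 * (n + 1) + 1) * z))"
        unfolding mult_exp_exp by (simp only:)
      thus ?thesis unfolding g_def using qper[of z] by (simp add: add.commute mult_ac)
    qed
    hence "integral {0..1} (\<lambda>t. g n (\<tau> + of_real t)) =
      - exp (- (of_real pi * \<i> * (2 * of_int n + 2) * \<tau>)) * c (n + 1)"
      by (simp add: c_def)
    thus ?thesis using periodic_entire_integral_shift[OF hol gper, of n \<tau>] by (simp add: c_def)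
  qed
  have c: "c n = 0" for n
  proof (induction n rule: int_induct[where k = 0])
    case base
    show ?case using c0 by (simp add: c_def g_def)
  next
    case (step1 i)
    thus ?case using rec[of i] by simp
  next
    case (step2 i)
    thus ?case using rec[of "i - 1"] by simp
  qed
  have "g 0 z = 0"
  proof (rule periodic_entire_fourier_null_imp_zero[OF hol gper])
    fix n :: int
    have "g 0 (of_real t) * cis (2 * pi * of_int n * t) = g (- n) (of_real t)" for t
      unfolding g_def cis_conv_exp mult.assoc mult_exp_exp by (simp add: algebra_simps)
    thus "integral {0..1} (\<lambda>t. g 0 (of_real t) * cis (2 * pi * of_int n * t)) = 0"
      using c[of "- n"] by (simp add: c_def)
  qed
  thus ?thesis by (simp add: g_def)
qed

lemma jacobi_theta_holomorphic:
  assumes "Im \<tau> > 0"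
  shows "jacobi_theta \<tau> holomorphic_on UNIV"
  unfolding jacobi_theta_eq_series holomorphic_on_def field_differentiable_def
  using theta_series_deriv_comp[OF theta_coeff_exp_bounded DERIV_const DERIV_ident, of \<tau>] assms
  by fast

text \<open>
  The space of entire functions with the quasi-periodicity of theta is one-dimensional.
\<close>

theorem quasi_periodic_imp_multiple_of_theta:
  assumes \<tau>: "Im \<tau> > 0"
    and f: "f holomorphic_on UNIV" and per: "\<And>z. f (z + 1) = - f z"
    and qper: "\<And>z. f (z + \<tau>) = - exp (- (of_real pi * \<i> * (\<tau> + 2 * z))) * f z"
  shows "\<exists>K. \<forall>z. f z = K * jacobi_theta \<tau> z"
proof -
  define c where "c = (\<lambda>f :: complex \<Rightarrow> complex. integral {0..1} (\<lambda>t. f (of_real t) * exp (- (of_real pi * \<i> * of_real t))) :: complex)"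
  have th: "jacobi_theta \<tau> (z + 1) = - jacobi_theta \<tau> z"
    "jacobi_theta \<tau> (z + \<tau>) = - exp (- (of_real pi * \<i> * (\<tau> + 2 * z))) * jacobi_theta \<tau> z" for z
    using jacobi_theta_elliptic[OF \<tau>, of z 0 1] jacobi_theta_elliptic[OF \<tau>, of z 1 0] by simp_all
  have "c (jacobi_theta \<tau>) \<noteq> 0"
  proof
    assume "c (jacobi_theta \<tau>) = 0"
    hence "jacobi_theta \<tau> (2 / 3) = 0"
      by (intro quasi_periodic_eq_zero[OF jacobi_theta_holomorphic[OF \<tau>] th]) (simp add: c_def)
    thus False using jacobi_theta_third_nonzero[OF \<tau>] by simp
  qed
  define K where "K = c f / c (jacobi_theta \<tau>)"
  have int: "(\<lambda>t. h (of_real t) * exp (- (of_real pi * \<i> * of_real t))) integrable_on {0..1}"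
    if "h holomorphic_on UNIV" for h :: "complex \<Rightarrow> complex"
    by (intro integrable_continuous_real continuous_intros
        continuous_on_compose2[OF holomorphic_on_imp_continuous_on[OF that]]) auto
  have "f z - K * jacobi_theta \<tau> z = 0" for z
  proof (rule quasi_periodic_eq_zero[of "\<lambda>z. f z - K * jacobi_theta \<tau> z" \<tau>])
    show "(\<lambda>z. f z - K * jacobi_theta \<tau> z) holomorphic_on UNIV"
      by (intro holomorphic_intros f jacobi_theta_holomorphic \<tau>)
    have "integral {0..1} (\<lambda>t. (f (of_real t) - K * jacobi_theta \<tau> (of_real t)) * exp (- (of_real pi * \<i> * of_real t)))
       = c f - K * c (jacobi_theta \<tau>)"
      unfolding c_def left_diff_distrib mult.assoc[of K]
      by (subst integral_diff[OF int[OF f] integrable_on_mult_right[OF int[OF jacobi_theta_holomorphic[OF \<tau>]]]])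
         simp
    also have "\<dots> = 0" using \<open>c (jacobi_theta \<tau>) \<noteq> 0\<close> by (simp add: K_def)
    finally show "integral {0..1} (\<lambda>t. (f (of_real t) - K * jacobi_theta \<tau> (of_real t)) * exp (- (of_real pi * \<i> * of_real t))) = 0" .
  qed (simp_all add: per qper th algebra_simps)
  thus ?thesis by (intro exI[of _ K]) simp
qed

section \<open>The inversion formula\<close>

lemma theta_series_cmult: "theta_series (\<lambda>n. c * a n) \<tau> z = c * theta_series a \<tau> z"
  unfolding theta_series_def theta_term_def by (simp add: mult.assoc infsum_cmult_right')

text \<open>
  The factor between \<open>jacobi_theta (- 1 / \<tau>) (z / \<tau>) * exp (- pi * \<i> * z\<^sup>2 / \<tau>)\<close> and
  \<open>jacobi_theta \<tau> z\<close>. It does not depend on \<open>z\<close>; it is written down at \<open>z = 2 / 3\<close>, where the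
  denominator never vanishes.
\<close>

definition theta_ratio :: "complex \<Rightarrow> complex" where
  "theta_ratio \<tau> = jacobi_theta (- 1 / \<tau>) ((2 / 3) / \<tau>) * exp (- (of_real pi * \<i> * (2 / 3)\<^sup>2 / \<tau>)) /
     jacobi_theta \<tau> (2 / 3)"

lemma Im_minus_inverse:
  assumes "Im \<tau> > 0"
  shows "Im (- 1 / \<tau>) > 0"
proof -
  have "Im (- 1 / \<tau>) = Im \<tau> / (norm \<tau>)\<^sup>2" by (simp add: Im_divide cmod_power2)
  thus ?thesis using assms by (auto intro!: divide_pos_pos)
qed

lemma theta_inversion_ratio:
  assumes \<tau>: "Im \<tau> > 0"
  shows "jacobi_theta (- 1 / \<tau>) (z / \<tau>) * exp (- (of_real pi * \<i> * z\<^sup>2 / \<tau>)) = theta_ratio \<tau> * jacobi_theta \<tau> z"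
proof -
  have nz: "\<tau> \<noteq> 0" using \<tau> by auto
  note \<tau>' = Im_minus_inverse[OF \<tau>]
  define f where "f = (\<lambda>z. jacobi_theta (- 1 / \<tau>) (z / \<tau>) * exp (- (of_real pi * \<i> * z\<^sup>2 / \<tau>)))"
  have "\<exists>K. \<forall>z. f z = K * jacobi_theta \<tau> z"
  proof (rule quasi_periodic_imp_multiple_of_theta[OF \<tau>])
    have "(jacobi_theta (- 1 / \<tau>) \<circ> (\<lambda>z. z / \<tau>)) holomorphic_on UNIV"
      by (rule holomorphic_on_compose_gen[OF _ jacobi_theta_holomorphic[OF \<tau>']])
         (auto intro!: holomorphic_intros nz)
    thus "f holomorphic_on UNIV"
      unfolding f_def o_def by (intro holomorphic_intros nz) auto
    fix z
    show "f (z + 1) = - f z"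
    proof -
      have "jacobi_theta (- 1 / \<tau>) ((z + 1) / \<tau>) = jacobi_theta (- 1 / \<tau>) (z / \<tau> + of_int (- 1) * (- 1 / \<tau>) + of_int 0)"
        by (simp add: add_divide_distrib)
      also have "\<dots> = - exp (- (of_real pi * \<i> * (- 1 / \<tau> - 2 * (z / \<tau>)))) * jacobi_theta (- 1 / \<tau>) (z / \<tau>)"
        unfolding jacobi_theta_elliptic[OF \<tau>'] by simp
      finally have "f (z + 1) = - (exp (- (of_real pi * \<i> * (- 1 / \<tau> - 2 * (z / \<tau>)))) *
          exp (- (of_real pi * \<i> * (z + 1)\<^sup>2 / \<tau>))) * jacobi_theta (- 1 / \<tau>) (z / \<tau>)"
        unfolding f_def by simp
      also have "exp (- (of_real pi * \<i> * (- 1 / \<tau> - 2 * (z / \<tau>)))) * exp (- (of_real pi * \<i> * (z + 1)\<^sup>2 / \<tau>)) =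
          exp (- (of_real pi * \<i> * z\<^sup>2 / \<tau>))"
        unfolding mult_exp_exp
        by (rule arg_cong[of _ _ exp]) (use nz in \<open>simp add: field_simps power2_eq_square\<close>)
      finally show ?thesis unfolding f_def by simp
    qed
    show "f (z + \<tau>) = - exp (- (of_real pi * \<i> * (\<tau> + 2 * z))) * f z"
    proof -
      have "jacobi_theta (- 1 / \<tau>) ((z + \<tau>) / \<tau>) = jacobi_theta (- 1 / \<tau>) (z / \<tau> + of_int 0 * (- 1 / \<tau>) + of_int 1)"
        using nz by (simp add: add_divide_distrib)
      also have "\<dots> = - jacobi_theta (- 1 / \<tau>) (z / \<tau>)"
        unfolding jacobi_theta_elliptic[OF \<tau>'] by simp
      finally have th: "jacobi_theta (- 1 / \<tau>) ((z + \<tau>) / \<tau>) = - jacobi_theta (- 1 / \<tau>) (z / \<tau>)" .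
      have "exp (- (of_real pi * \<i> * (z + \<tau>)\<^sup>2 / \<tau>)) =
          exp (- (of_real pi * \<i> * (\<tau> + 2 * z))) * exp (- (of_real pi * \<i> * z\<^sup>2 / \<tau>))"
        unfolding mult_exp_exp
        by (rule arg_cong[of _ _ exp]) (use nz in \<open>simp add: field_simps power2_eq_square\<close>)
      thus ?thesis unfolding f_def th by simp
    qed
  qed
  then obtain K where K: "\<And>z. f z = K * jacobi_theta \<tau> z" by blast
  have "K = theta_ratio \<tau>"
    using K[of "2 / 3"] jacobi_theta_third_nonzero[OF \<tau>]
    by (simp add: theta_ratio_def f_def field_simps)
  thus ?thesis using K[of z] by (simp add: f_def)
qed

text \<open>
  The heat equation \<open>4 * pi * \<i> * \<partial>\<^sub>\<tau> \<theta> = \<partial>\<^sub>z\<^sup>2 \<theta>\<close> holds for theta. Its transform under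
  inversion satisfies the same equation up to the term \<open>1 / (2 * \<tau>)\<close>, which is therefore the
  logarithmic derivative of the ratio.
\<close>

lemma theta_ratio_deriv:
  assumes \<tau>: "Im \<tau> > 0"
  shows "(theta_ratio has_field_derivative theta_ratio \<tau> / (2 * \<tau>)) (at \<tau>)"
proof -
  define K where "K = theta_ratio \<tau>"
  define a1 where "a1 = (\<lambda>n. (of_real pi * \<i>) * of_int n * theta_coeff n)"
  define a2 where "a2 = (\<lambda>n. (of_real pi * \<i>) * of_int n * a1 n)"
  have eb: "exp_bounded theta_coeff" "exp_bounded a1" "exp_bounded a2"
    unfolding a1_def a2_def by (intro exp_bounded_deriv theta_coeff_exp_bounded)+
  have at: "theta_series (\<lambda>n. (of_real pi * \<i> / 4 * of_int n) * of_int n * theta_coeff n) \<tau> z =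
      theta_series a2 \<tau> z / (4 * of_real pi * \<i>)" for \<tau> z
  proof -
    have "(\<lambda>n. (of_real pi * \<i> / 4 * of_int n) * of_int n * theta_coeff n) =
        (\<lambda>n. (1 / (4 * of_real pi * \<i>)) * a2 n)"
      by (simp add: fun_eq_iff a2_def a1_def field_simps)
    thus ?thesis by (simp only: theta_series_cmult) simp
  qed
  have nz: "\<tau> \<noteq> 0" using \<tau> by auto
  note \<tau>' = Im_minus_inverse[OF \<tau>]
  define T0 where "T0 = (\<lambda>z. jacobi_theta (- 1 / \<tau>) (z / \<tau>))"
  define T1 where "T1 = (\<lambda>z. theta_series a1 (- 1 / \<tau>) (z / \<tau>))"
  define T2 where "T2 = (\<lambda>z. theta_series a2 (- 1 / \<tau>) (z / \<tau>))"
  define e where "e = (\<lambda>z. exp (- (of_real pi * \<i> * z\<^sup>2 / \<tau>)))"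
  have dT0: "(T0 has_field_derivative T1 z / \<tau>) (at z)" for z
  proof -
    have "((\<lambda>z. z / \<tau>) has_field_derivative 1 / \<tau>) (at z)"
      by (rule DERIV_cdivide[OF DERIV_ident])
    from theta_series_deriv_comp[OF eb(1) DERIV_const this \<tau>'] show ?thesis
      by (simp add: T0_def T1_def a1_def jacobi_theta_eq_series)
  qed
  have dT1: "(T1 has_field_derivative T2 z / \<tau>) (at z)" for z
  proof -
    have "((\<lambda>z. z / \<tau>) has_field_derivative 1 / \<tau>) (at z)"
      by (rule DERIV_cdivide[OF DERIV_ident])
    from theta_series_deriv_comp[OF eb(2) DERIV_const this \<tau>'] show ?thesis
      by (simp add: T1_def T2_def a2_def)
  qed
  have de: "(e has_field_derivative - (2 * of_real pi * \<i> * z / \<tau>) * e z) (at z)" for z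
    unfolding e_def by (rule derivative_eq_intros refl nz | simp)+
  have dth: "(jacobi_theta \<tau> has_field_derivative theta_series a1 \<tau> z) (at z)" for z
    using theta_series_deriv_comp[OF eb(1) DERIV_const DERIV_ident \<tau>]
    by (simp add: a1_def jacobi_theta_eq_series)
  have dth1: "(theta_series a1 \<tau> has_field_derivative theta_series a2 \<tau> z) (at z)" for z
    using theta_series_deriv_comp[OF eb(2) DERIV_const DERIV_ident \<tau>]
    by (simp add: a2_def)
  \<comment> \<open>The inversion identity and its first two derivatives with respect to \<open>z\<close>.\<close>
  have 0: "(\<lambda>z. T0 z * e z) = (\<lambda>z. K * jacobi_theta \<tau> z)"
    unfolding T0_def e_def K_def using theta_inversion_ratio[OF \<tau>] by (simp add: fun_eq_iff)
  have 1: "(\<lambda>z. (T1 z / \<tau> - 2 * of_real pi * \<i> * z / \<tau> * T0 z) * e z) = (\<lambda>z. K * theta_series a1 \<tau> z)"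
  proof
    fix z
    have "((\<lambda>z. T0 z * e z) has_field_derivative (T1 z / \<tau> - 2 * of_real pi * \<i> * z / \<tau> * T0 z) * e z) (at z)"
      by (rule DERIV_cong[OF DERIV_mult[OF dT0 de]]) (simp add: algebra_simps)
    moreover have "((\<lambda>z. T0 z * e z) has_field_derivative K * theta_series a1 \<tau> z) (at z)"
      unfolding 0 by (rule DERIV_cmult[OF dth])
    ultimately show "(T1 z / \<tau> - 2 * of_real pi * \<i> * z / \<tau> * T0 z) * e z = K * theta_series a1 \<tau> z"
      by (rule DERIV_unique)
  qed
  have 2: "(T2 z / \<tau>\<^sup>2 - 4 * of_real pi * \<i> * z / \<tau>\<^sup>2 * T1 z - 2 * of_real pi * \<i> / \<tau> * T0 z
      + (2 * of_real pi * \<i> * z / \<tau>)\<^sup>2 * T0 z) * e z = K * theta_series a2 \<tau> z" for z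
  proof -
    have "((\<lambda>z. (T1 z / \<tau> - 2 * of_real pi * \<i> * z / \<tau> * T0 z) * e z) has_field_derivative
       (T2 z / \<tau>\<^sup>2 - 4 * of_real pi * \<i> * z / \<tau>\<^sup>2 * T1 z - 2 * of_real pi * \<i> / \<tau> * T0 z
      + (2 * of_real pi * \<i> * z / \<tau>)\<^sup>2 * T0 z) * e z) (at z)"
    proof -
      have "((\<lambda>z. 2 * of_real pi * \<i> * z / \<tau>) has_field_derivative 2 * of_real pi * \<i> / \<tau>) (at z)"
        using DERIV_cdivide[OF DERIV_cmult[OF DERIV_ident], of "2 * of_real pi * \<i>" \<tau>] by simp
      from DERIV_mult[OF DERIV_diff[OF DERIV_cdivide[OF dT1] DERIV_mult[OF this dT0]] de]
      show ?thesis
        by (rule DERIV_cong) (use nz in \<open>simp add: field_simps power2_eq_square\<close>)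
    qed
    moreover have "((\<lambda>z. (T1 z / \<tau> - 2 * of_real pi * \<i> * z / \<tau> * T0 z) * e z) has_field_derivative
        K * theta_series a2 \<tau> z) (at z)"
      unfolding 1 by (rule DERIV_cmult[OF dth1])
    ultimately show ?thesis by (rule DERIV_unique)
  qed
  define z :: complex where "z = 2 / 3"
  define \<theta> where "\<theta> = jacobi_theta \<tau> z"
  have \<theta>: "\<theta> \<noteq> 0" unfolding \<theta>_def z_def by (rule jacobi_theta_third_nonzero[OF \<tau>])
  define X where "X = (T2 z / (4 * of_real pi * \<i>) / \<tau>\<^sup>2 - z / \<tau>\<^sup>2 * T1 z + of_real pi * \<i> * z\<^sup>2 / \<tau>\<^sup>2 * T0 z) * e z"
  \<comment> \<open>Differentiation with respect to \<open>\<tau>\<close> at the fixed point \<open>z = 2 / 3\<close>.\<close>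
  have dnum: "((\<lambda>\<tau>. jacobi_theta (- 1 / \<tau>) (z / \<tau>) * exp (- (of_real pi * \<i> * z\<^sup>2 / \<tau>))) has_field_derivative X) (at \<tau>)"
  proof -
    have d1: "((\<lambda>\<tau>. - 1 / \<tau>) has_field_derivative 1 / \<tau>\<^sup>2) (at \<tau>)"
      and d2: "((\<lambda>\<tau>. z / \<tau>) has_field_derivative - z / \<tau>\<^sup>2) (at \<tau>)"
      and d3: "((\<lambda>\<tau>. exp (- (of_real pi * \<i> * z\<^sup>2 / \<tau>))) has_field_derivative
        e z * (of_real pi * \<i> * z\<^sup>2 / \<tau>\<^sup>2)) (at \<tau>)"
      unfolding e_def using nz by (auto intro!: derivative_eq_intros simp: power2_eq_square field_simps)
    from DERIV_mult[OF theta_series_deriv_comp[OF eb(1) d1 d2 \<tau>'] d3]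
    have "((\<lambda>\<tau>. theta_series theta_coeff (- 1 / \<tau>) (z / \<tau>) * exp (- (of_real pi * \<i> * z\<^sup>2 / \<tau>)))
       has_field_derivative (T2 z / (4 * of_real pi * \<i>) * (1 / \<tau>\<^sup>2) + T1 z * (- z / \<tau>\<^sup>2)) * e z +
          e z * (of_real pi * \<i> * z\<^sup>2 / \<tau>\<^sup>2) * T0 z) (at \<tau>)"
      unfolding at by (simp add: T0_def T1_def T2_def e_def a1_def jacobi_theta_eq_series)
    thus ?thesis unfolding jacobi_theta_eq_series X_def
      by (rule DERIV_cong) (simp add: algebra_simps)
  qed
  have dden: "((\<lambda>\<tau>. jacobi_theta \<tau> z) has_field_derivative theta_series a2 \<tau> z / (4 * of_real pi * \<i>)) (at \<tau>)"
    using theta_series_deriv_comp[OF eb(1) DERIV_ident DERIV_const[where k = z] \<tau>]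
    unfolding at jacobi_theta_eq_series by simp
  have num: "T0 z * e z = K * \<theta>" unfolding \<theta>_def using 0 by (rule fun_cong)
  have "theta_ratio = (\<lambda>\<tau>. jacobi_theta (- 1 / \<tau>) (z / \<tau>) * exp (- (of_real pi * \<i> * z\<^sup>2 / \<tau>)) / jacobi_theta \<tau> z)"
    by (simp add: fun_eq_iff theta_ratio_def z_def)
  moreover have "((\<lambda>\<tau>. jacobi_theta (- 1 / \<tau>) (z / \<tau>) * exp (- (of_real pi * \<i> * z\<^sup>2 / \<tau>)) / jacobi_theta \<tau> z)
      has_field_derivative (X * \<theta> - T0 z * e z * (theta_series a2 \<tau> z / (4 * of_real pi * \<i>))) / (\<theta> * \<theta>)) (at \<tau>)"
    using DERIV_divide[OF dnum dden] \<theta> unfolding \<theta>_def T0_def e_def by simp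
  moreover have "(X * \<theta> - T0 z * e z * (theta_series a2 \<tau> z / (4 * of_real pi * \<i>))) / (\<theta> * \<theta>) = K / (2 * \<tau>)"
  proof -
    have "X - K * theta_series a2 \<tau> z / (4 * of_real pi * \<i>) = T0 z * e z / (2 * \<tau>)"
      unfolding 2[symmetric] X_def using nz by (simp add: field_simps power2_eq_square)
    hence "X - K * theta_series a2 \<tau> z / (4 * of_real pi * \<i>) = K * \<theta> / (2 * \<tau>)" unfolding num .
    hence "(X - K * theta_series a2 \<tau> z / (4 * of_real pi * \<i>)) * \<theta> / (\<theta> * \<theta>) = K / (2 * \<tau>)"
      using \<theta> by simp
    moreover have "X * \<theta> - T0 z * e z * (theta_series a2 \<tau> z / (4 * of_real pi * \<i>)) =
      (X - K * theta_series a2 \<tau> z / (4 * of_real pi * \<i>)) * \<theta>"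
      unfolding num by (simp add: algebra_simps)
    ultimately show ?thesis by simp
  qed
  ultimately show ?thesis unfolding K_def by simp
qed

lemma upper_half_plane_not_nonpos: "Im \<tau> > 0 \<Longrightarrow> \<tau> \<notin> \<real>\<^sub>\<le>\<^sub>0"
  by (auto simp: complex_nonpos_Reals_iff)

theorem jacobi_theta_inversion:
  obtains C :: complex where "C\<^sup>2 = \<i>"
    "\<And>\<tau> z. Im \<tau> > 0 \<Longrightarrow> jacobi_theta (- 1 / \<tau>) (z / \<tau>) =
       C * csqrt \<tau> * exp (of_real pi * \<i> * z\<^sup>2 / \<tau>) * jacobi_theta \<tau> z"
proof -
  have "\<exists>C. \<forall>\<tau>\<in>{\<tau>. Im \<tau> > 0}. theta_ratio \<tau> / csqrt \<tau> = C"
  proof (rule has_field_derivative_zero_constant)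
    show "convex {\<tau>. Im \<tau> > 0}" by (rule convex_halfspace_Im_gt)
    fix \<tau> assume "\<tau> \<in> {\<tau>. Im \<tau> > 0}"
    hence \<tau>: "Im \<tau> > 0" by simp
    have nz: "\<tau> \<noteq> 0" "csqrt \<tau> \<noteq> 0" using \<tau> by auto
    have d: "((\<lambda>\<tau>. theta_ratio \<tau> / csqrt \<tau>) has_field_derivative
      (theta_ratio \<tau> / (2 * \<tau>) * csqrt \<tau> - theta_ratio \<tau> * inverse (2 * csqrt \<tau>)) / (csqrt \<tau> * csqrt \<tau>)) (at \<tau>)"
      by (intro DERIV_divide theta_ratio_deriv \<tau> has_field_derivative_csqrt upper_half_plane_not_nonpos nz)
    have z: "theta_ratio \<tau> / (2 * \<tau>) * csqrt \<tau> - theta_ratio \<tau> * inverse (2 * csqrt \<tau>) = 0"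
    proof -
      have "csqrt \<tau> / \<tau> = inverse (csqrt \<tau>)"
        using nz power2_csqrt[of \<tau>] by (simp add: field_simps power2_eq_square)
      thus ?thesis using nz by (simp add: field_simps)
    qed
    show "((\<lambda>\<tau>. theta_ratio \<tau> / csqrt \<tau>) has_field_derivative 0) (at \<tau> within {\<tau>. Im \<tau> > 0})"
      using has_field_derivative_at_within[OF d] unfolding z by simp
  qed
  then obtain C where C: "\<And>\<tau>. Im \<tau> > 0 \<Longrightarrow> theta_ratio \<tau> / csqrt \<tau> = C" by auto
  have R: "theta_ratio \<tau> = C * csqrt \<tau>" if "Im \<tau> > 0" for \<tau>
  proof -
    have "csqrt \<tau> \<noteq> 0" using that by auto
    thus ?thesis using C[OF that] by (simp add: field_simps)
  qed
  have inv: "jacobi_theta (- 1 / \<tau>) (z / \<tau>) =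
       C * csqrt \<tau> * exp (of_real pi * \<i> * z\<^sup>2 / \<tau>) * jacobi_theta \<tau> z" if "Im \<tau> > 0" for \<tau> z
    using theta_inversion_ratio[OF that, of z] unfolding R[OF that] exp_minus
    by (simp add: field_simps)
  \<comment> \<open>Inversion fixes \<open>\<i>\<close>, and applying it twice there is \<open>z \<mapsto> - z\<close>, under which theta is odd.\<close>
  have "C\<^sup>2 = \<i>"
  proof -
    define K where "K = C * csqrt \<i>"
    have 1: "jacobi_theta \<i> (z / \<i>) = K * exp (of_real pi * \<i> * z\<^sup>2 / \<i>) * jacobi_theta \<i> z" for z
      using inv[of \<i> z] by (simp add: K_def)
    have "- jacobi_theta \<i> (2 / 3) = jacobi_theta \<i> ((2 / 3) / \<i> / \<i>)"
      using jacobi_theta_minus[of \<i> "2 / 3"] by simp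
    also have "\<dots> = K * exp (of_real pi * \<i> * ((2 / 3) / \<i>)\<^sup>2 / \<i>) *
        (K * exp (of_real pi * \<i> * (2 / 3)\<^sup>2 / \<i>) * jacobi_theta \<i> (2 / 3))"
      by (simp only: 1)
    also have "\<dots> = K\<^sup>2 * (exp (of_real pi * \<i> * ((2 / 3) / \<i>)\<^sup>2 / \<i>) * exp (of_real pi * \<i> * (2 / 3)\<^sup>2 / \<i>)) *
        jacobi_theta \<i> (2 / 3)"
      by (simp add: power2_eq_square)
    also have "exp (of_real pi * \<i> * ((2 / 3) / \<i>)\<^sup>2 / \<i>) * exp (of_real pi * \<i> * (2 / 3)\<^sup>2 / \<i>) = 1"
      unfolding mult_exp_exp by (simp add: power_divide)
    finally have "K\<^sup>2 * jacobi_theta \<i> (2 / 3) = (- 1) * jacobi_theta \<i> (2 / 3)" by simp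
    hence "K\<^sup>2 = - 1" using jacobi_theta_third_nonzero[of \<i>] by (subst (asm) mult_right_cancel) simp_all
    hence "C\<^sup>2 * \<i> = - 1" by (simp only: K_def power_mult_distrib power2_csqrt)
    hence "C\<^sup>2 * \<i> = \<i> * \<i>" by simp
    thus ?thesis by (subst (asm) mult_right_cancel) simp_all
  qed
  thus ?thesis using inv that by blast
qed

lemma dedekind_eta_inversion:
  assumes inv: "\<And>\<tau> z. Im \<tau> > 0 \<Longrightarrow> jacobi_theta (- 1 / \<tau>) (z / \<tau>) =
       C * csqrt \<tau> * exp (of_real pi * \<i> * z\<^sup>2 / \<tau>) * jacobi_theta \<tau> z"
    and \<tau>: "Im \<tau> > 0"
  shows "dedekind_eta (- 1 / \<tau>) = \<i> * C * csqrt \<tau> * dedekind_eta \<tau>"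
proof -
  have nz: "\<tau> \<noteq> 0" using \<tau> by auto
  have s: "csqrt (3 * \<tau>) = of_real (sqrt 3) * csqrt \<tau>"
  proof (rule csqrt_unique)
    show "(of_real (sqrt 3) * csqrt \<tau>)\<^sup>2 = 3 * \<tau>"
      by (simp add: power_mult_distrib flip: of_real_power)
    show "0 < Re (of_real (sqrt 3) * csqrt \<tau>) \<or>
        Re (of_real (sqrt 3) * csqrt \<tau>) = 0 \<and> 0 \<le> Im (of_real (sqrt 3) * csqrt \<tau>)"
      using csqrt_principal[of \<tau>] by (auto simp del: csqrt.sel)
  qed
  have "\<i> * of_real (sqrt 3) * dedekind_eta (- 1 / \<tau>) = jacobi_theta (- 1 / \<tau> / 3) (2 / 3)"
    by (rule jacobi_theta_third[symmetric]) (rule Im_minus_inverse[OF \<tau>])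
  also have "\<dots> = jacobi_theta (- 1 / (3 * \<tau>)) (2 * \<tau> / (3 * \<tau>))"
    using nz by (simp add: field_simps)
  also have "\<dots> = C * csqrt (3 * \<tau>) * exp (of_real pi * \<i> * (2 * \<tau>)\<^sup>2 / (3 * \<tau>)) * jacobi_theta (3 * \<tau>) (2 * \<tau>)"
    by (rule inv) (use \<tau> in simp)
  also have "of_real pi * \<i> * (2 * \<tau>)\<^sup>2 / (3 * \<tau>) = 4 * of_real pi * \<i> * \<tau> / 3"
    using nz by (simp add: field_simps power2_eq_square)
  also have "C * csqrt (3 * \<tau>) * exp (4 * of_real pi * \<i> * \<tau> / 3) * jacobi_theta (3 * \<tau>) (2 * \<tau>) =
      - (C * csqrt (3 * \<tau>) * dedekind_eta \<tau>)"
    using jacobi_theta_tau_third[OF \<tau>] by (simp add: mult.assoc)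
  finally have "\<i> * of_real (sqrt 3) * dedekind_eta (- 1 / \<tau>) = - (C * (of_real (sqrt 3) * csqrt \<tau>) * dedekind_eta \<tau>)"
    unfolding s .
  hence "of_real (sqrt 3) * (\<i> * dedekind_eta (- 1 / \<tau>)) = of_real (sqrt 3) * (- (C * csqrt \<tau> * dedekind_eta \<tau>))"
    by (simp only: mult_ac mult_minus_right)
  hence "\<i> * dedekind_eta (- 1 / \<tau>) = - (C * csqrt \<tau> * dedekind_eta \<tau>)" 
    by (subst (asm) mult_cancel_left) auto
  hence "(- \<i>) * (\<i> * dedekind_eta (- 1 / \<tau>)) = (- \<i>) * (- (C * csqrt \<tau> * dedekind_eta \<tau>))" by simp
  thus ?thesis by simp
qed

section \<open>The multiplier systems of eta and theta\<close>

lemma moebius_denominator_nonzero: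
  assumes "a * d - b * c = (1::int)" "Im \<tau> > 0"
  shows "of_int c * \<tau> + of_int d \<noteq> 0"
proof
  assume 0: "of_int c * \<tau> + of_int d = 0"
  hence "Im (of_int c * \<tau> + of_int d) = 0" by simp
  hence "c = 0" using assms(2) by simp
  with 0 have "d = 0" by simp
  with \<open>c = 0\<close> show False using assms(1) by simp
qed

lemma Im_moebius_pos:
  assumes "a * d - b * c = (1::int)" "Im \<tau> > 0"
  shows "Im ((of_int a * \<tau> + of_int b) / (of_int c * \<tau> + of_int d)) > 0"
proof -
  let ?j = "of_int c * \<tau> + of_int d"
  have "?j \<noteq> 0" by (rule moebius_denominator_nonzero[OF assms])
  hence pos: "(Re ?j)\<^sup>2 + (Im ?j)\<^sup>2 > 0"
    by (metis complex_neq_0)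
  have "Im (of_int a * \<tau> + of_int b) * Re ?j - Re (of_int a * \<tau> + of_int b) * Im ?j =
      real_of_int (a * d - b * c) * Im \<tau>"
    by (simp add: algebra_simps)
  hence "Im ((of_int a * \<tau> + of_int b) / ?j) = Im \<tau> / ((Re ?j)\<^sup>2 + (Im ?j)\<^sup>2)"
    using assms(1) by (simp add: Im_divide)
  thus ?thesis using pos assms(2) by simp
qed

text \<open>
  For the matrix with rows \<open>(a, b)\<close> and \<open>(c, d)\<close>: the number \<open>v\<close> is a 24th root of unity, eta
  transforms with multiplier \<open>v\<close> and theta, of the same weight \<open>1 / 2\<close>, with multiplier \<open>v\<^sup>3\<close>.
  The principal branch makes the multipliers of a product agree with the product of the multipliers
  only up to a sign; this sign is compatible with the relation between eta and theta because it
  equals its own cube.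
\<close>

definition eta_theta_multiplier :: "complex \<Rightarrow> int \<Rightarrow> int \<Rightarrow> int \<Rightarrow> int \<Rightarrow> bool" where
  "eta_theta_multiplier v a b c d \<longleftrightarrow> v ^ 24 = 1 \<and>
     (\<forall>\<tau>. Im \<tau> > 0 \<longrightarrow>
        dedekind_eta ((of_int a * \<tau> + of_int b) / (of_int c * \<tau> + of_int d)) =
          v * csqrt (of_int c * \<tau> + of_int d) * dedekind_eta \<tau> \<and>
        (\<forall>z. jacobi_theta ((of_int a * \<tau> + of_int b) / (of_int c * \<tau> + of_int d)) (z / (of_int c * \<tau> + of_int d)) =
          v ^ 3 * csqrt (of_int c * \<tau> + of_int d) * exp (of_real pi * \<i> * of_int c * z\<^sup>2 / (of_int c * \<tau> + of_int d)) *
            jacobi_theta \<tau> z))"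

lemma eta_theta_multiplier_identity: "eta_theta_multiplier 1 1 0 0 1"
  by (simp add: eta_theta_multiplier_def)

lemma eta_theta_multiplier_translate:
  assumes det: "a * d - b * c = 1" and v: "eta_theta_multiplier v a b c d"
  shows "eta_theta_multiplier (exp (of_real pi * \<i> * of_int q / 12) * v) (a + q * c) (b + q * d) c d"
proof -
  let ?e = "exp (of_real pi * \<i> * of_int q / 12)"
  have e24: "?e ^ 24 = 1"
  proof -
    have "?e ^ 24 = exp (2 * of_real pi * \<i> * of_int q)"
      unfolding exp_of_nat_mult[symmetric] by (rule arg_cong[of _ _ exp]) simp
    thus ?thesis by (simp only: exp_2pi_i_int)
  qed
  have e3: "?e ^ 3 = exp (of_real pi * \<i> * of_int q / 4)"
    unfolding exp_of_nat_mult[symmetric] by (rule arg_cong[of _ _ exp]) simp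
  have shift: "(of_int (a + q * c) * \<tau> + of_int (b + q * d)) / (of_int c * \<tau> + of_int d) =
      (of_int a * \<tau> + of_int b) / (of_int c * \<tau> + of_int d) + of_int q" if "Im \<tau> > 0" for \<tau>
    using moebius_denominator_nonzero[OF det that] by (simp add: divide_simps) (simp add: algebra_simps)
  show ?thesis
    unfolding eta_theta_multiplier_def
  proof (intro conjI allI impI)
    show "(?e * v) ^ 24 = 1"
      using v by (simp add: power_mult_distrib e24 eta_theta_multiplier_def)
    fix \<tau> :: complex assume \<tau>: "Im \<tau> > 0"
    show "dedekind_eta ((of_int (a + q * c) * \<tau> + of_int (b + q * d)) / (of_int c * \<tau> + of_int d)) =
          ?e * v * csqrt (of_int c * \<tau> + of_int d) * dedekind_eta \<tau>"
      unfolding shift[OF \<tau>] dedekind_eta_shift[OF Im_moebius_pos[OF det \<tau>]]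
      using v \<tau> by (simp add: eta_theta_multiplier_def)
    fix z
    show "jacobi_theta ((of_int (a + q * c) * \<tau> + of_int (b + q * d)) / (of_int c * \<tau> + of_int d)) (z / (of_int c * \<tau> + of_int d)) =
          (?e * v) ^ 3 * csqrt (of_int c * \<tau> + of_int d) * exp (of_real pi * \<i> * of_int c * z\<^sup>2 / (of_int c * \<tau> + of_int d)) *
            jacobi_theta \<tau> z"
      unfolding shift[OF \<tau>] jacobi_theta_shift[OF Im_moebius_pos[OF det \<tau>]] power_mult_distrib e3
      using v \<tau> by (simp add: eta_theta_multiplier_def)
  qed
qed

lemma continuous_on_csqrt_linear:
  assumes "c \<noteq> 0 \<or> d \<noteq> (0::int)"
  shows "continuous_on {\<tau>. Im \<tau> > 0} (\<lambda>\<tau>. csqrt (of_int c * \<tau> + of_int d))"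
proof (cases "c = 0")
  case False
  have "of_int c * \<tau> + of_int d \<notin> \<real>\<^sub>\<le>\<^sub>0" if "Im \<tau> > 0" for \<tau>
    using that False by (auto simp: complex_nonpos_Reals_iff)
  thus ?thesis
    by (intro continuous_on_compose2[OF continuous_on_csqrt] continuous_intros) auto
qed simp

text \<open>
  The sign is constant in \<open>\<tau>\<close>, being continuous on the connected upper half-plane.
\<close>

lemma csqrt_cocycle:
  assumes det: "a * d - b * c = (1::int)"
  obtains \<epsilon> :: complex where "\<epsilon>\<^sup>2 = 1"
    "\<And>\<tau>. Im \<tau> > 0 \<Longrightarrow> csqrt ((of_int a * \<tau> + of_int b) / (of_int c * \<tau> + of_int d)) *
       csqrt (of_int c * \<tau> + of_int d) = \<epsilon> * csqrt (of_int a * \<tau> + of_int b)"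
proof -
  define H where "H = {\<tau>. Im \<tau> > 0}"
  define w :: "complex \<Rightarrow> complex" where "w = (\<lambda>\<tau>. (of_int a * \<tau> + of_int b) / (of_int c * \<tau> + of_int d))"
  define f where "f = (\<lambda>\<tau>. csqrt (w \<tau>) * csqrt (of_int c * \<tau> + of_int d) / csqrt (of_int a * \<tau> + of_int b))"
  have nz1: "of_int c * \<tau> + of_int d \<noteq> 0" and nz2: "of_int a * \<tau> + of_int b \<noteq> 0" if "\<tau> \<in> H" for \<tau>
    using moebius_denominator_nonzero[of a d b c \<tau>] moebius_denominator_nonzero[of "- c" b "- d" a \<tau>] det that
    by (auto simp: H_def algebra_simps)
  have sq: "(f \<tau>)\<^sup>2 = 1" if "\<tau> \<in> H" for \<tau>
    using nz1[OF that] nz2[OF that] by (simp add: f_def w_def power_mult_distrib power_divide)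
  have cw: "continuous_on H (\<lambda>\<tau>. csqrt (w \<tau>))"
  proof (rule continuous_on_compose2[OF continuous_on_csqrt])
    show "continuous_on H w" unfolding w_def
      by (intro continuous_intros) (use nz1 in auto)
    show "w ` H \<subseteq> - \<real>\<^sub>\<le>\<^sub>0"
      using Im_moebius_pos[OF det] upper_half_plane_not_nonpos by (fastforce simp: w_def H_def)
  qed
  have cf: "continuous_on H f"
    unfolding f_def
    by (intro continuous_on_divide continuous_on_mult cw
        continuous_on_csqrt_linear[folded H_def]) (use det nz2 in auto)
  have "f constant_on H"
  proof (rule continuous_finite_range_constant[OF _ cf])
    show "connected H" unfolding H_def by (intro convex_connected convex_halfspace_Im_gt)
    have "f ` H \<subseteq> {1, -1}" using sq by (auto simp: power2_eq_1_iff)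
    thus "finite (f ` H)" by (rule finite_subset) simp
  qed
  then obtain \<epsilon> where \<epsilon>: "\<And>\<tau>. \<tau> \<in> H \<Longrightarrow> f \<tau> = \<epsilon>" unfolding constant_on_def by blast
  have "\<epsilon>\<^sup>2 = 1" using \<epsilon>[of \<i>] sq[of \<i>] by (simp add: H_def)
  moreover have "csqrt (w \<tau>) * csqrt (of_int c * \<tau> + of_int d) = \<epsilon> * csqrt (of_int a * \<tau> + of_int b)"
    if "Im \<tau> > 0" for \<tau>
    using \<epsilon>[of \<tau>] nz2[of \<tau>] that by (auto simp: H_def f_def field_simps)
  ultimately show ?thesis using that unfolding w_def by blast
qed

lemma eta_theta_multiplier_invert:
  assumes det: "a * d - b * c = 1" and v: "eta_theta_multiplier v a b c d"
  shows "\<exists>v'. eta_theta_multiplier v' (- c) (- d) a b"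
proof -
  obtain C :: complex where C: "C\<^sup>2 = \<i>"
    and inv: "\<And>\<tau> z. Im \<tau> > 0 \<Longrightarrow> jacobi_theta (- 1 / \<tau>) (z / \<tau>) =
       C * csqrt \<tau> * exp (of_real pi * \<i> * z\<^sup>2 / \<tau>) * jacobi_theta \<tau> z"
    using jacobi_theta_inversion by blast
  obtain \<epsilon> :: complex where \<epsilon>: "\<epsilon>\<^sup>2 = 1"
    "\<And>\<tau>. Im \<tau> > 0 \<Longrightarrow> csqrt ((of_int a * \<tau> + of_int b) / (of_int c * \<tau> + of_int d)) *
       csqrt (of_int c * \<tau> + of_int d) = \<epsilon> * csqrt (of_int a * \<tau> + of_int b)"
    using csqrt_cocycle[OF det] by blast
  define v' where "v' = \<i> * C * v * \<epsilon>"
  have v'3: "v' ^ 3 = C * v ^ 3 * \<epsilon>"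
  proof -
    \<comment> \<open>Here \<open>C\<^sup>2 = \<i>\<close> gives \<open>(\<i> * C) ^ 3 = C\<close>: the multipliers of the inversion are related as required.\<close>
    have cube: "x ^ 3 = x\<^sup>2 * x" for x :: complex by (simp add: power3_eq_cube power2_eq_square)
    show ?thesis
      unfolding v'_def power_mult_distrib cube[of C] cube[of \<epsilon>] cube[of \<i>] C \<epsilon> by simp
  qed
  have v'24: "v' ^ 24 = 1"
  proof -
    have p: "x ^ 24 = (x\<^sup>2) ^ 12" for x :: complex by (simp flip: power_mult)
    have i12: "\<i> ^ 12 = (1::complex)"
    proof -
      have "\<i> ^ 12 = ((\<i>\<^sup>2) ^ 6 :: complex)" by (simp flip: power_mult)
      thus ?thesis by simp
    qed
    have "v' ^ 24 = (\<i>\<^sup>2) ^ 12 * (C\<^sup>2) ^ 12 * v ^ 24 * (\<epsilon>\<^sup>2) ^ 12"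
      unfolding v'_def power_mult_distrib by (simp only: p)
    thus ?thesis unfolding C \<epsilon> i12 using v by (simp add: eta_theta_multiplier_def)
  qed
  show ?thesis
  proof (rule exI[of _ v'], unfold eta_theta_multiplier_def, intro conjI allI impI)
    show "v' ^ 24 = 1" by (rule v'24)
    fix \<tau> :: complex assume \<tau>: "Im \<tau> > 0"
    define j where "j = of_int c * \<tau> + of_int d"
    define k where "k = of_int a * \<tau> + of_int b"
    have j: "j \<noteq> 0" unfolding j_def by (rule moebius_denominator_nonzero[OF det \<tau>])
    have w: "Im (k / j) > 0" unfolding k_def j_def by (rule Im_moebius_pos[OF det \<tau>])
    hence k: "k \<noteq> 0" by auto
    have mob: "(of_int (- c) * \<tau> + of_int (- d)) / k = - 1 / (k / j)"
    proof -
      have "of_int (- c) * \<tau> + of_int (- d) = - j" by (simp add: j_def)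
      thus ?thesis using j k by simp
    qed
    have eps: "csqrt (k / j) * csqrt j = \<epsilon> * csqrt k"
      unfolding k_def j_def by (rule \<epsilon>(2)[OF \<tau>])
    have "dedekind_eta (k / j) = v * csqrt j * dedekind_eta \<tau>"
      using v \<tau> unfolding eta_theta_multiplier_def k_def j_def by blast
    hence "dedekind_eta (- 1 / (k / j)) = \<i> * C * csqrt (k / j) * (v * csqrt j * dedekind_eta \<tau>)"
      using dedekind_eta_inversion[OF inv w] by simp
    also have "\<dots> = \<i> * C * v * (csqrt (k / j) * csqrt j) * dedekind_eta \<tau>" by (simp only: mult_ac)
    also have "\<dots> = v' * csqrt k * dedekind_eta \<tau>" unfolding eps v'_def by (simp only: mult_ac)
    finally show "dedekind_eta ((of_int (- c) * \<tau> + of_int (- d)) / (of_int a * \<tau> + of_int b)) =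
          v' * csqrt (of_int a * \<tau> + of_int b) * dedekind_eta \<tau>"
      unfolding k_def[symmetric] mob .
    fix z
    have arg: "z / k = (z / j) / (k / j)" using j k by simp
    have th: "jacobi_theta (k / j) (z / j) = v ^ 3 * csqrt j * exp (of_real pi * \<i> * of_int c * z\<^sup>2 / j) * jacobi_theta \<tau> z"
      using v \<tau> unfolding eta_theta_multiplier_def k_def j_def by blast
    have "of_int c * k + 1 = of_int a * j"
    proof -
      have "of_int a * j - of_int c * k = of_int (a * d - b * c)"
        by (simp add: j_def k_def algebra_simps)
      thus ?thesis unfolding det by (simp add: algebra_simps)
    qed
    hence "(of_int c * k + 1) / (j * k) = of_int a / k" using j by simp
    hence ck: "of_int c / j + 1 / (j * k) = of_int a / k" using j k by (simp add: field_simps)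
    have "of_real pi * \<i> * (z / j)\<^sup>2 / (k / j) + of_real pi * \<i> * of_int c * z\<^sup>2 / j =
        of_real pi * \<i> * z\<^sup>2 * (of_int c / j + 1 / (j * k))"
      using j k by (simp add: field_simps power2_eq_square)
    hence ex: "exp (of_real pi * \<i> * (z / j)\<^sup>2 / (k / j)) * exp (of_real pi * \<i> * of_int c * z\<^sup>2 / j) =
        exp (of_real pi * \<i> * of_int a * z\<^sup>2 / k)"
      unfolding mult_exp_exp ck by (simp add: mult_ac)
    have "jacobi_theta (- 1 / (k / j)) (z / k) = C * csqrt (k / j) * exp (of_real pi * \<i> * (z / j)\<^sup>2 / (k / j)) *
        (v ^ 3 * csqrt j * exp (of_real pi * \<i> * of_int c * z\<^sup>2 / j) * jacobi_theta \<tau> z)"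
      unfolding arg inv[OF w] th ..
    also have "\<dots> = C * v ^ 3 * (csqrt (k / j) * csqrt j) *
       (exp (of_real pi * \<i> * (z / j)\<^sup>2 / (k / j)) * exp (of_real pi * \<i> * of_int c * z\<^sup>2 / j)) * jacobi_theta \<tau> z"
      by (simp only: mult_ac)
    finally show "jacobi_theta ((of_int (- c) * \<tau> + of_int (- d)) / (of_int a * \<tau> + of_int b)) (z / (of_int a * \<tau> + of_int b)) =
          v' ^ 3 * csqrt (of_int a * \<tau> + of_int b) * exp (of_real pi * \<i> * of_int a * z\<^sup>2 / (of_int a * \<tau> + of_int b)) *
            jacobi_theta \<tau> z"
      unfolding k_def[symmetric] mob eps ex v'3 by (simp only: mult_ac)
  qed
qed

text \<open>
  Euclid's algorithm on the lower left entry, with translations as division steps and the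
  inversion exchanging the rows up to sign.
\<close>

theorem eta_theta_multiplier_exists:
  assumes "a * d - b * c = 1"
  shows "\<exists>v. eta_theta_multiplier v a b c d"
  using assms
proof (induction "nat \<bar>c\<bar>" arbitrary: a b c d rule: less_induct)
  case less
  show ?case
  proof (cases "c = 0")
    case False
    define q where "q = a div c"
    define r where "r = a mod c"
    have a: "a = r + q * c" by (simp add: q_def r_def)
    have "\<bar>r\<bar> < \<bar>c\<bar>" unfolding r_def using False by (rule abs_mod_less)
    hence smaller: "nat \<bar>- r\<bar> < nat \<bar>c\<bar>" by simp
    have det: "c * (- (b - q * d)) - d * (- r) = 1"
      using less.prems unfolding a by (simp add: algebra_simps)
    obtain v where "eta_theta_multiplier v c d (- r) (- (b - q * d))"
      using less.hyps[OF smaller det] by blast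
    from eta_theta_multiplier_invert[OF det this]
    obtain v' where v': "eta_theta_multiplier v' r (b - q * d) c d" by auto
    have "r * d - (b - q * d) * c = 1" using det by (simp add: algebra_simps)
    from eta_theta_multiplier_translate[OF this v', of q] show ?thesis
      unfolding a by auto
  next
    case True
    hence "a * d = 1" using less.prems by simp
    hence "a = 1 \<and> d = 1 \<or> a = -1 \<and> d = -1" by (simp add: zmult_eq_1_iff)
    thus ?thesis
    proof (elim disjE conjE)
      assume "a = 1" "d = 1"
      thus ?thesis using eta_theta_multiplier_translate[OF _ eta_theta_multiplier_identity, of b] True
        by auto
    next
      assume ad: "a = -1" "d = -1"
      obtain v where v: "eta_theta_multiplier v 0 (-1) 1 0"
        using eta_theta_multiplier_invert[OF _ eta_theta_multiplier_identity] by auto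
      obtain v' where "eta_theta_multiplier v' (-1) 0 0 (-1)"
        using eta_theta_multiplier_invert[OF _ v] by auto
      from eta_theta_multiplier_translate[OF _ this, of "- b"] show ?thesis using True ad by auto
    qed
  qed
qed

theorem eta_multiplier_properties:
  assumes det: "a * d - b * c = 1"
  shows "eta_theta_multiplier (eta_multiplier a b c d) a b c d"
proof -
  obtain v where v: "eta_theta_multiplier v a b c d" using eta_theta_multiplier_exists[OF det] by blast
  have "eta_multiplier a b c d = v"
    unfolding eta_multiplier_def
  proof (rule the_equality)
    show "\<forall>\<tau>\<in>upper_half_plane. dedekind_eta ((of_int a * \<tau> + of_int b) / (of_int c * \<tau> + of_int d)) =
          v * (of_int c * \<tau> + of_int d) powr (1 / 2) * dedekind_eta \<tau>"
      using v by (simp add: eta_theta_multiplier_def upper_half_plane_def csqrt_conv_powr[symmetric])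
    fix u
    assume "\<forall>\<tau>\<in>upper_half_plane. dedekind_eta ((of_int a * \<tau> + of_int b) / (of_int c * \<tau> + of_int d)) =
          u * (of_int c * \<tau> + of_int d) powr (1 / 2) * dedekind_eta \<tau>"
    hence "u * csqrt (of_int c * \<i> + of_int d) * dedekind_eta \<i> = v * csqrt (of_int c * \<i> + of_int d) * dedekind_eta \<i>"
      using v by (simp add: eta_theta_multiplier_def upper_half_plane_def csqrt_conv_powr[symmetric])
    moreover have "csqrt (of_int c * \<i> + of_int d) \<noteq> 0" "dedekind_eta \<i> \<noteq> 0"
      using moebius_denominator_nonzero[OF det, of \<i>] eta_has_sum(2)[of \<i>] by simp_all
    ultimately show "u = v" by simp
  qed
  thus ?thesis using v by simp
qed

section \<open>The theta quotient of the root lattice\<close>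

lemma has_sum_product:
  fixes f :: "'a \<Rightarrow> complex" and g :: "'b \<Rightarrow> complex"
  assumes f: "(f has_sum a) A" and g: "(g has_sum b) B"
  shows "((\<lambda>(x, y). f x * g y) has_sum a * b) (A \<times> B)"
proof -
  have sf: "(\<lambda>x. norm (f x)) summable_on A" and sg: "(\<lambda>x. norm (g x)) summable_on B"
    using f g by (auto simp: summable_on_iff_abs_summable_on_complex[symmetric] dest: has_sum_imp_summable)
  have "(\<lambda>p. norm (case p of (x, y) \<Rightarrow> f x * g y)) summable_on A \<times> B"
  proof (rule Infinite_Sum.abs_summable_on_Sigma_iff[THEN iffD2], intro conjI ballI)
    fix x
    show "(\<lambda>y. norm (case (x, y) of (x, y) \<Rightarrow> f x * g y)) summable_on B"
      by (simp add: norm_mult summable_on_cmult_right sg)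
  next
    have "infsum (\<lambda>y. norm (case (x, y) of (x, y) \<Rightarrow> f x * g y)) B = norm (f x) * infsum (\<lambda>y. norm (g y)) B" for x
      by (simp add: norm_mult infsum_cmult_right')
    moreover have "0 \<le> infsum (\<lambda>y. norm (g y)) B" by (rule infsum_nonneg) simp
    ultimately show "(\<lambda>x. norm (infsum (\<lambda>y. norm (case (x, y) of (x, y) \<Rightarrow> f x * g y)) B)) summable_on A"
      by (simp add: abs_mult summable_on_cmult_left sf)
  qed
  hence "(\<lambda>(x, y). f x * g y) summable_on A \<times> B" by (rule abs_summable_summable)
  then obtain S where S: "((\<lambda>(x, y). f x * g y) has_sum S) (A \<times> B)" unfolding summable_on_def by blast
  have "((\<lambda>x. f x * b) has_sum S) A"
    by (rule has_sum_SigmaD[OF S]) (use has_sum_cmult_right[OF g] in auto)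
  moreover have "((\<lambda>x. f x * b) has_sum a * b) A" by (rule has_sum_cmult_left[OF f])
  ultimately have "S = a * b" by (rule has_sum_unique)
  thus ?thesis using S by simp
qed

lemma pentagonal_term_shift: "pentagonal_term (c + 6 * j) \<tau> k = alt_sign j * pentagonal_term c \<tau> (k + j)"
proof -
  have "alt_sign k = alt_sign j * alt_sign (k + j)" by (auto simp: alt_sign_def)
  moreover have "6 * k + (c + 6 * j) = 6 * (k + j) + c" by simp
  ultimately show ?thesis unfolding pentagonal_term_def by (simp only: mult.assoc)
qed

lemma pentagonal_term_shift_has_sum:
  assumes "(pentagonal_term c \<tau> has_sum S) UNIV"
  shows "(pentagonal_term (c + 6 * j) \<tau> has_sum alt_sign j * S) UNIV"
proof -
  have "((\<lambda>k. pentagonal_term c \<tau> (k + j)) has_sum S) UNIV"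
    using assms by (subst has_sum_reindex_bij_witness[of _ "\<lambda>k. k - j" "\<lambda>k. k + j"]) auto
  from has_sum_cmult_right[OF this] show ?thesis unfolding pentagonal_term_shift[abs_def] .
qed

text \<open>
  The coefficients of \<open>sigma_A2\<close>, as a function of \<open>t = r + s\<close> for the monomial
  \<open>\<zeta>\<^sub>1 ^ r * \<zeta>\<^sub>2 ^ s\<close>.
\<close>

definition A2_sign :: "int \<Rightarrow> complex" where
  "A2_sign t = (if 3 dvd t then 0 else alt_sign (t + t div 3))"

lemma pentagonal_term_A2_has_sum:
  assumes \<tau>: "Im \<tau> > 0"
  shows "(pentagonal_term (3 - 2 * t) \<tau> has_sum alt_sign t * A2_sign t * dedekind_eta \<tau>) UNIV"
proof -
  define j where "j = t div 3"
  have tj: "t = 3 * j + t mod 3" by (simp add: j_def)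
  have "t mod 3 = 0 \<or> t mod 3 = 1 \<or> t mod 3 = 2" by presburger
  thus ?thesis
  proof (elim disjE)
    assume 0: "t mod 3 = 0"
    have t: "3 - 2 * t = 3 + 6 * (- j)" using tj 0 by simp
    have "A2_sign t = 0" using 0 by (auto simp: A2_sign_def)
    thus ?thesis using pentagonal_term_shift_has_sum[OF pentagonal_term_three_has_sum[OF \<tau>], of "- j"] unfolding t by simp
  next
    assume 1: "t mod 3 = 1"
    have t: "3 - 2 * t = 1 + 6 * (- j)" using tj 1 by simp
    have "alt_sign t * A2_sign t = alt_sign j" using 1 unfolding A2_sign_def j_def[symmetric]
      by (auto simp: alt_sign_add mult.assoc[symmetric] dvd_eq_mod_eq_0)
    thus ?thesis using pentagonal_term_shift_has_sum[OF eta_has_sum(1)[OF \<tau>], of "- j"] unfolding t by simp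
  next
    assume 2: "t mod 3 = 2"
    have t: "3 - 2 * t = -1 + 6 * (- j)" using tj 2 by simp
    have "alt_sign t * A2_sign t = alt_sign j" using 2 unfolding A2_sign_def j_def[symmetric]
      by (auto simp: alt_sign_add mult.assoc[symmetric] dvd_eq_mod_eq_0)
    thus ?thesis using pentagonal_term_shift_has_sum[OF pentagonal_term_minus_one_has_sum[OF \<tau>], of "- j"] unfolding t by simp
  qed
qed

text \<open>
  The denominator identity for \<open>A\<^sub>2\<close>. In the product of the three theta series, over odd integers
  \<open>a\<close>, \<open>b\<close>, \<open>c\<close>, the monomial \<open>\<zeta>\<^sub>1 ^ r * \<zeta>\<^sub>2 ^ s\<close> arises for \<open>a = 2 * r - c\<close> and \<open>b = 2 * s - c\<close>, and
  \<open>(a\<^sup>2 + b\<^sup>2 + c\<^sup>2) / 8 = (r\<^sup>2 - r * s + s\<^sup>2) / 3 + (3 * c - 2 * (r + s))\<^sup>2 / 24\<close>.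
  The sum over \<open>c\<close> is thus, up to sign, eta or zero, and cancels against the denominator.
\<close>

theorem sigma_A2_has_sum:
  assumes \<tau>: "Im \<tau> > 0"
  shows "((\<lambda>(r, s). A2_sign (r + s) * exp (2 * of_real pi * \<i> *
            (of_int (r\<^sup>2 - r * s + s\<^sup>2) / 3 * \<tau> + (of_int r * z1 + of_int s * z2))))
          has_sum sigma_A2 \<tau> z1 z2) UNIV"
proof -
  define P where "P = jacobi_theta \<tau> z1 * jacobi_theta \<tau> z2 * jacobi_theta \<tau> (z1 + z2)"
  define E where "E = (\<lambda>(r, s). exp (2 * of_real pi * \<i> *
            (of_int (r\<^sup>2 - r * s + s\<^sup>2) / 3 * \<tau> + (of_int r * z1 + of_int s * z2))))"
  let ?F = "\<lambda>(p, k3). (case p of (k1, k2) \<Rightarrow> odd_theta_term \<tau> z1 k1 * odd_theta_term \<tau> z2 k2) * odd_theta_term \<tau> (z1 + z2) k3"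
  let ?G = "\<lambda>(p, k). alt_sign (fst p + snd p) * E p * pentagonal_term (3 - 2 * (fst p + snd p)) \<tau> k"
  have "(?F has_sum P) ((UNIV \<times> UNIV) \<times> UNIV)"
    unfolding P_def by (intro has_sum_product jacobi_theta_has_sum \<tau>)
  moreover have FG: "?F ((r - k - 1, s - k - 1), k) = ?G ((r, s), k)" for r s k
  proof -
    have "2 * of_real pi * \<i> * ((of_int (2 * (r - k - 1) + 1))\<^sup>2 / 8 * \<tau> + of_int (2 * (r - k - 1) + 1) / 2 * z1) +
        2 * of_real pi * \<i> * ((of_int (2 * (s - k - 1) + 1))\<^sup>2 / 8 * \<tau> + of_int (2 * (s - k - 1) + 1) / 2 * z2) +
        2 * of_real pi * \<i> * ((of_int (2 * k + 1))\<^sup>2 / 8 * \<tau> + of_int (2 * k + 1) / 2 * (z1 + z2)) =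
        2 * of_real pi * \<i> * (of_int (r\<^sup>2 - r * s + s\<^sup>2) / 3 * \<tau> + (of_int r * z1 + of_int s * z2)) +
        2 * of_real pi * \<i> * ((of_int (6 * k + (3 - 2 * (r + s))))\<^sup>2 / 24 * \<tau>)"
      by (simp add: field_simps power2_eq_square)
    hence ex: "exp (2 * of_real pi * \<i> * ((of_int (2 * (r - k - 1) + 1))\<^sup>2 / 8 * \<tau> + of_int (2 * (r - k - 1) + 1) / 2 * z1)) *
        exp (2 * of_real pi * \<i> * ((of_int (2 * (s - k - 1) + 1))\<^sup>2 / 8 * \<tau> + of_int (2 * (s - k - 1) + 1) / 2 * z2)) *
        exp (2 * of_real pi * \<i> * ((of_int (2 * k + 1))\<^sup>2 / 8 * \<tau> + of_int (2 * k + 1) / 2 * (z1 + z2))) =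
        E (r, s) * exp (2 * of_real pi * \<i> * ((of_int (6 * k + (3 - 2 * (r + s))))\<^sup>2 / 24 * \<tau>))"
      unfolding E_def mult_exp_exp prod.case by (simp only:)
    have sg: "alt_sign (r - k - 1) * alt_sign (s - k - 1) * alt_sign k = alt_sign (r + s) * alt_sign k"
      by (auto simp: alt_sign_def)
    have comb: "(a * x) * (b * y) * (c * z) = (a * b * c) * (x * y * z)" for a b c x y z :: complex
      by (simp only: mult_ac)
    show ?thesis unfolding prod.case fst_conv snd_conv odd_theta_term_def pentagonal_term_def comb ex sg
      by (simp only: mult_ac)
  qed
  ultimately have "(?G has_sum P) (UNIV \<times> UNIV)"
    by (subst has_sum_reindex_bij_witness[of _
          "\<lambda>((k1, k2), k). ((k1 + k + 1, k2 + k + 1), k)"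
          "\<lambda>((r, s), k). ((r - k - 1, s - k - 1), k)" "(UNIV \<times> UNIV) \<times> UNIV" ?F _ P])
       (auto simp only: FG prod.case split: prod.splits)
  hence "((\<lambda>p. alt_sign (fst p + snd p) * E p *
      (alt_sign (fst p + snd p) * A2_sign (fst p + snd p) * dedekind_eta \<tau>)) has_sum P) UNIV"
  proof (rule has_sum_SigmaD)
    fix p :: "int \<times> int"
    show "((\<lambda>k. ?G (p, k)) has_sum alt_sign (fst p + snd p) * E p *
      (alt_sign (fst p + snd p) * A2_sign (fst p + snd p) * dedekind_eta \<tau>)) UNIV"
      unfolding prod.case by (intro has_sum_cmult_right pentagonal_term_A2_has_sum \<tau>)
  qed
  hence A: "((\<lambda>p. alt_sign (fst p + snd p) * E p *
      (alt_sign (fst p + snd p) * A2_sign (fst p + snd p) * dedekind_eta \<tau>) * inverse (dedekind_eta \<tau>))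
      has_sum P * inverse (dedekind_eta \<tau>)) UNIV"
    by (rule has_sum_cmult_left)
  have B: "alt_sign (fst p + snd p) * E p *
      (alt_sign (fst p + snd p) * A2_sign (fst p + snd p) * dedekind_eta \<tau>) * inverse (dedekind_eta \<tau>) =
      A2_sign (fst p + snd p) * E p" for p
  proof -
    have "alt_sign t * x * (alt_sign t * y * h) * inverse h = y * x" if "h \<noteq> 0" for t x y h
    proof -
      have "alt_sign t * x * (alt_sign t * y * h) * inverse h = (alt_sign t * alt_sign t) * (h * inverse h) * (y * x)"
        by (simp only: mult_ac)
      thus ?thesis using that by simp
    qed
    thus ?thesis using eta_has_sum(2)[OF \<tau>] by blast
  qed
  from A have "((\<lambda>p. A2_sign (fst p + snd p) * E p) has_sum sigma_A2 \<tau> z1 z2) UNIV"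
    unfolding B sigma_A2_def P_def divide_inverse .
  moreover have "(\<lambda>p. A2_sign (fst p + snd p) * E p) = (\<lambda>(r, s). A2_sign (r + s) *
      exp (2 * of_real pi * \<i> * (of_int (r\<^sup>2 - r * s + s\<^sup>2) / 3 * \<tau> + (of_int r * z1 + of_int s * z2))))"
    unfolding E_def by (rule ext) (simp only: split_beta)
  ultimately show ?thesis by (simp only:)
qed

lemma sigma_A2_modular:
  assumes det: "a * d - b * c = 1" and \<tau>: "Im \<tau> > 0"
  shows "sigma_A2 ((of_int a * \<tau> + of_int b) / (of_int c * \<tau> + of_int d))
       (z1 / (of_int c * \<tau> + of_int d)) (z2 / (of_int c * \<tau> + of_int d)) =
     eta_multiplier a b c d ^ 8 * (of_int c * \<tau> + of_int d) *
     exp (of_real pi * \<i> * (of_int c * (z1\<^sup>2 + z2\<^sup>2 + (z1 + z2)\<^sup>2) / (of_int c * \<tau> + of_int d))) * sigma_A2 \<tau> z1 z2"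
proof -
  define v where "v = eta_multiplier a b c d"
  define j where "j = of_int c * \<tau> + of_int d"
  define \<tau>' where "\<tau>' = (of_int a * \<tau> + of_int b) / j"
  define X where "X = (\<lambda>z. exp (of_real pi * \<i> * of_int c * z\<^sup>2 / j))"
  have v: "eta_theta_multiplier v a b c d" unfolding v_def by (rule eta_multiplier_properties[OF det])
  have j: "j \<noteq> 0" unfolding j_def by (rule moebius_denominator_nonzero[OF det \<tau>])
  have v0: "v \<noteq> 0" using v by (auto simp: eta_theta_multiplier_def)
  have eta: "dedekind_eta \<tau>' = v * csqrt j * dedekind_eta \<tau>"
    and th: "jacobi_theta \<tau>' (z / j) = v ^ 3 * csqrt j * X z * jacobi_theta \<tau> z" for z
    using v \<tau> unfolding eta_theta_multiplier_def \<tau>'_def j_def X_def by blast+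
  have s: "csqrt j * csqrt j = j" by (simp flip: power2_eq_square)
  have s0: "csqrt j \<noteq> 0" using j by simp
  have "sigma_A2 \<tau>' (z1 / j) (z2 / j) =
     (v ^ 3 * csqrt j * X z1 * jacobi_theta \<tau> z1) * (v ^ 3 * csqrt j * X z2 * jacobi_theta \<tau> z2) *
     (v ^ 3 * csqrt j * X (z1 + z2) * jacobi_theta \<tau> (z1 + z2)) / (v * csqrt j * dedekind_eta \<tau>)"
    unfolding sigma_A2_def eta add_divide_distrib[symmetric] th ..
  also have "\<dots> = (v * csqrt j) * (v ^ 8 * (csqrt j * csqrt j) * (X z1 * X z2 * X (z1 + z2)) *
      (jacobi_theta \<tau> z1 * jacobi_theta \<tau> z2 * jacobi_theta \<tau> (z1 + z2))) / ((v * csqrt j) * dedekind_eta \<tau>)"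
    by (simp add: power3_eq_cube eval_nat_numeral mult_ac)
  also have "\<dots> = v ^ 8 * j * (X z1 * X z2 * X (z1 + z2)) * sigma_A2 \<tau> z1 z2"
    unfolding s sigma_A2_def using v0 s0 by (subst mult_divide_mult_cancel_left) auto
  also have "X z1 * X z2 * X (z1 + z2) =
      exp (of_real pi * \<i> * (of_int c * (z1\<^sup>2 + z2\<^sup>2 + (z1 + z2)\<^sup>2) / j))"
    unfolding X_def mult_exp_exp
    by (rule arg_cong[of _ _ exp]) (simp add: algebra_simps add_divide_distrib[symmetric])
  finally show ?thesis unfolding v_def j_def \<tau>'_def .
qed

lemma sigma_A2_elliptic:
  assumes \<tau>: "Im \<tau> > 0"
  shows "sigma_A2 \<tau> (z1 + of_int x1 * \<tau> + of_int y1) (z2 + of_int x2 * \<tau> + of_int y2) =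
     exp (- of_real pi * \<i> * ((of_int x1 ^ 2 + of_int x2 ^ 2 + of_int (x1 + x2) ^ 2) * \<tau> +
        2 * (of_int x1 * z1 + of_int x2 * z2 + of_int (x1 + x2) * (z1 + z2)))) * sigma_A2 \<tau> z1 z2"
proof -
  define X where "X = (\<lambda>x z. exp (- (of_real pi * \<i> * ((of_int x)\<^sup>2 * \<tau> + 2 * of_int x * z))))"
  have th: "jacobi_theta \<tau> (z + of_int x * \<tau> + of_int y) = alt_sign (x + y) * X x z * jacobi_theta \<tau> z" for z x y
    unfolding X_def by (rule jacobi_theta_elliptic[OF \<tau>])
  have sum: "z1 + of_int x1 * \<tau> + of_int y1 + (z2 + of_int x2 * \<tau> + of_int y2) =
      (z1 + z2) + of_int (x1 + x2) * \<tau> + of_int (y1 + y2)" by (simp add: algebra_simps)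
  have sg: "alt_sign (x1 + y1) * alt_sign (x2 + y2) * alt_sign (x1 + x2 + (y1 + y2)) = 1"
    by (auto simp: alt_sign_def)
  have comb: "(a * x * t) * (b * y * u) * (c * z * w) / h = (a * b * c) * (x * y * z) * (t * u * w / h)"
    for a b c x y z t u w h :: complex by simp
  have X: "X x1 z1 * X x2 z2 * X (x1 + x2) (z1 + z2) =
     exp (- of_real pi * \<i> * ((of_int x1 ^ 2 + of_int x2 ^ 2 + of_int (x1 + x2) ^ 2) * \<tau> +
        2 * (of_int x1 * z1 + of_int x2 * z2 + of_int (x1 + x2) * (z1 + z2))))"
    unfolding X_def mult_exp_exp by (rule arg_cong[of _ _ exp]) (simp add: algebra_simps)
  show ?thesis unfolding sigma_A2_def sum th comb sg X by simp
qed

section \<open>The lattices and their orthogonal sums\<close>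

lemma lattice_basis_dim:
  fixes B :: "(real ^ 'n) set"
  assumes B: "finite B" "independent B" and L: "L = range (\<lambda>c. \<Sum>b\<in>B. real_of_int (c b) *\<^sub>R b)"
  shows "dim L = card B"
proof -
  have BL: "B \<subseteq> L"
  proof
    fix b assume b: "b \<in> B"
    have "(\<Sum>x\<in>B. real_of_int (if x = b then 1 else 0) *\<^sub>R x) = b"
      using B b by (simp add: if_distrib[of "\<lambda>n. real_of_int n *\<^sub>R _"] if_distribR sum.delta cong: if_cong)
    thus "b \<in> L" unfolding L by (intro image_eqI[of _ _ "\<lambda>x. if x = b then 1 else 0"]) auto
  qed
  have LB: "L \<subseteq> span B"
    unfolding L by (intro image_subsetI span_sum span_scale span_base)
  show "dim L = card B" by (rule dim_unique[OF BL LB B(2) refl])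
qed

text \<open>
The two simple roots of \<open>A\<^sub>2\<close>.
\<close>

definition A2_basis :: "(real ^ 3) set" where
  "A2_basis = {vector [1, -1, 0], vector [0, 1, -1]}"

lemma A2_basis_distinct: "(vector [1, -1, 0] :: real ^ 3) \<noteq> vector [0, 1, -1]"
  by (simp add: vec_eq_iff forall_3)

lemma A2_basis_independent: "finite A2_basis" "independent A2_basis" "card A2_basis = 2"
proof -
  show "finite A2_basis" "card A2_basis = 2"
    using A2_basis_distinct by (simp_all add: A2_basis_def)
  show "independent A2_basis"
    unfolding independent_explicit
  proof (intro conjI allI impI ballI)
    fix c :: "real ^ 3 \<Rightarrow> real" and v :: "real ^ 3"
    assume 0: "(\<Sum>v\<in>A2_basis. c v *\<^sub>R v) = 0" and v: "v \<in> A2_basis"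
    have "c (vector [1, -1, 0]) *\<^sub>R vector [1, -1, 0] + c (vector [0, 1, -1]) *\<^sub>R vector [0, 1, -1] = (0 :: real ^ 3)"
      using 0 A2_basis_distinct by (simp add: A2_basis_def)
    hence "c (vector [1, -1, 0]) = 0 \<and> c (vector [0, 1, -1]) = 0"
      by (auto simp: vec_eq_iff forall_3)
    thus "c v = 0" using v by (auto simp: A2_basis_def)
  qed fact
qed

lemma A2_eq_range: "A2 = range (\<lambda>c. \<Sum>b\<in>A2_basis. real_of_int (c b) *\<^sub>R b)"
proof safe
  fix x :: "real ^ 3" assume x: "x \<in> A2"
  then obtain m n k :: int where mnk: "x $ 1 = of_int m" "x $ 2 = of_int n" "x $ 3 = of_int k"
    unfolding A2_def by (auto elim!: Ints_cases) (metis Ints_cases)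
  have "real_of_int (m + n + k) = 0" using x mnk by (simp add: A2_def)
  hence k: "k = - m - n" by linarith
  define c where "c = (\<lambda>b :: real ^ 3. if b = vector [1, -1, 0] then m else m + n)"
  have "(\<Sum>b\<in>A2_basis. real_of_int (c b) *\<^sub>R b) = x"
    using A2_basis_distinct by (auto simp: A2_basis_def c_def vec_eq_iff forall_3 mnk k)
  thus "x \<in> range (\<lambda>c. \<Sum>b\<in>A2_basis. real_of_int (c b) *\<^sub>R b)" by (intro image_eqI[of _ _ c]) auto
next
  fix c :: "real ^ 3 \<Rightarrow> int"
  show "(\<Sum>b\<in>A2_basis. real_of_int (c b) *\<^sub>R b) \<in> A2"
    using A2_basis_distinct by (auto simp: A2_basis_def A2_def forall_3)
qed

lemma even_lattice_A2: "even_lattice A2"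
  unfolding even_lattice_def
proof (intro conjI ballI)
  show "\<exists>B. finite B \<and> independent B \<and> A2 = range (\<lambda>c. \<Sum>b\<in>B. real_of_int (c b) *\<^sub>R b)"
    using A2_basis_independent A2_eq_range by blast
  fix x :: "real ^ 3" assume x: "x \<in> A2"
  then obtain m n :: int where mn: "x $ 1 = of_int m" "x $ 2 = of_int n" "x $ 3 = - of_int m - of_int n"
    unfolding A2_def by (auto elim!: Ints_cases) (metis Ints_cases add.commute add_diff_cancel_left' diff_0 diff_diff_eq)
  have "x \<bullet> x = 2 * of_int (m * m + m * n + n * n)"
    by (simp add: inner_vec_def sum_3 mn algebra_simps)
  thus "\<exists>m. x \<bullet> x = 2 * real_of_int m" by blast
qed

lemma singular_weight_A2: "singular_weight A2 = 1"
  unfolding singular_weight_def lattice_basis_dim[OF A2_basis_independent(1,2) A2_eq_range]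
  by (simp add: A2_basis_independent)

lemma span_A2: "span A2 = {x :: real ^ 3. x $ 1 + x $ 2 + x $ 3 = 0}"
proof safe
  fix x :: "real ^ 3" assume "x \<in> span A2"
  thus "x $ 1 + x $ 2 + x $ 3 = 0"
  proof (induction rule: span_induct)
    case base
    show ?case by (rule subspaceI) (auto simp: algebra_simps, metis distrib_left mult_zero_right)
  qed (auto simp: A2_def)
next
  fix x :: "real ^ 3" assume x: "x $ 1 + x $ 2 + x $ 3 = 0"
  have "x = x $ 1 *\<^sub>R vector [1, -1, 0] + (x $ 1 + x $ 2) *\<^sub>R vector [0, 1, -1]"
    using x by (auto simp: vec_eq_iff forall_3)
  moreover have "vector [1, -1, 0] \<in> A2" "vector [0, 1, -1] \<in> A2"
    by (auto simp: A2_def forall_3)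
  ultimately show "x \<in> span A2" by (metis span_add span_scale span_base)
qed

lemma complexification_A2:
  fixes z :: "complex ^ 3"
  assumes "z \<in> complexification A2"
  shows "z $ 3 = - (z $ 1 + z $ 2)"
proof -
  have "z $ 1 + z $ 2 + z $ 3 = 0"
    using assms unfolding complexification_def
  proof (induction rule: vec.span_induct)
    case base
    show ?case by (rule vec.subspaceI) (auto simp: algebra_simps, metis distrib_left mult_zero_right)
  next
    case (step z)
    then obtain x where "x \<in> A2" "z = cvec x" by auto
    thus ?case by (auto simp: A2_def cvec_def simp flip: of_real_add)
  qed
  thus ?thesis by (rule minus_unique[symmetric])
qed

text \<open>
  The embedding of one summand: the vector with block \<open>j\<close> equal to \<open>v\<close> and all other blocks zero.
\<close>

definition unblock :: "'m::finite \<Rightarrow> 'a::zero ^ 'n::finite \<Rightarrow> 'a ^ ('m \<times> 'n)" where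
  "unblock j v = (\<chi> p. if fst p = j then v $ snd p else 0)"

lemma block_unblock: "block i (unblock j v) = (if i = j then v else 0)"
  by (auto simp: block_def unblock_def vec_eq_iff)

lemma vec_eq_blocks_iff: "x = y \<longleftrightarrow> (\<forall>j. block j x = block j y)"
  by (auto simp: block_def vec_eq_iff)

lemma block_linear:
  "block j (x + y) = block j x + block j y"
  "block j (r *\<^sub>R u) = r *\<^sub>R block j u"
  "block j (c *s z) = c *s block j z"
  "block j 0 = 0"
  by (simp_all add: block_def vec_eq_iff)

lemma block_sum: "block j (\<Sum>a\<in>A. f a) = (\<Sum>a\<in>A. block j (f a))"
  by (simp add: block_def vec_eq_iff)

lemma linear_block: "linear (block j :: real ^ ('m::finite \<times> 'n::finite) \<Rightarrow> real ^ 'n)"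
  by (rule linearI) (simp_all add: block_linear)

lemma linear_unblock: "linear (unblock j :: real ^ 'n::finite \<Rightarrow> real ^ ('m::finite \<times> 'n))"
  by (rule linearI) (auto simp: unblock_def vec_eq_iff)

lemma sum_unblock_block: "(\<Sum>j\<in>UNIV. unblock j (block j x)) = (x :: real ^ ('m::finite \<times> 'n::finite))"
  by (simp add: vec_eq_blocks_iff block_sum block_unblock)

lemma sum_blocks: "(\<Sum>p\<in>UNIV. f p) = (\<Sum>j\<in>UNIV. \<Sum>i\<in>UNIV. f (j, i))"
  by (simp add: sum.cartesian_product UNIV_Times_UNIV[symmetric] del: UNIV_Times_UNIV)

lemma inner_blocks: "x \<bullet> y = (\<Sum>j\<in>UNIV. block j x \<bullet> block j (y :: real ^ ('m::finite \<times> 'n::finite)))"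
  unfolding inner_vec_def block_def by (subst sum_blocks) simp

lemma cform_blocks: "cform x y = (\<Sum>j\<in>UNIV. cform (block j x) (block j y))"
  unfolding cform_def block_def by (subst sum_blocks) simp

lemma cvec_block: "block j (cvec x) = cvec (block j x)"
  by (simp add: block_def cvec_def vec_eq_iff)

text \<open>
  The orthogonal sum of copies of \<open>L\<close>, one for each element of the index type \<open>'m\<close>.
\<close>

definition lattice_power :: "(real ^ 'n::finite) set \<Rightarrow> (real ^ ('m::finite \<times> 'n)) set" where
  "lattice_power L = {x. \<forall>j. block j x \<in> L}"

lemma three_A2_eq: "three_A2 = lattice_power A2"
  by (auto simp: three_A2_def lattice_power_def forall_3)

lemma lattice_power_basis:
  fixes B :: "(real ^ 'n::finite) set"
  assumes B: "finite B" "independent B" and L: "L = range (\<lambda>c. \<Sum>b\<in>B. real_of_int (c b) *\<^sub>R b)"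
  defines "B' \<equiv> (\<lambda>(j, b). unblock j b) ` ((UNIV :: 'm::finite set) \<times> B)"
  shows "finite B'" "independent B'" "card B' = CARD('m) * card B"
    "(lattice_power L :: (real ^ ('m \<times> 'n)) set) = range (\<lambda>c. \<Sum>b\<in>B'. real_of_int (c b) *\<^sub>R b)"
proof -
  have nz: "b \<noteq> 0" if "b \<in> B" for b using B(2) that dependent_zero by blast
  have inj: "inj_on (\<lambda>(j :: 'm, b). unblock j b) (UNIV \<times> B)"
  proof (rule inj_onI, clarify)
    fix j j' :: 'm and b b' assume b: "b \<in> B" "b' \<in> B" and eq: "unblock j b = unblock j' b'"
    have "block j (unblock j b) = block j (unblock j' b')" using eq by simp
    hence "b = (if j = j' then b' else 0)" by (simp add: block_unblock)
    thus "j = j' \<and> b = b'" using nz[OF b(1)] by (auto split: if_splits)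
  qed
  show fin: "finite B'" unfolding B'_def using B(1) by simp
  show "card B' = CARD('m) * card B"
    unfolding B'_def by (subst card_image[OF inj]) (simp add: card_cartesian_product)
  have blk: "block i (\<Sum>b\<in>B'. c b *\<^sub>R b) = (\<Sum>b\<in>B. c (unblock i b) *\<^sub>R b)" for c i
  proof -
    have "(\<Sum>b\<in>B'. c b *\<^sub>R b) = (\<Sum>(j, b)\<in>UNIV \<times> B. c (unblock j b) *\<^sub>R unblock j b)"
      unfolding B'_def by (subst sum.reindex[OF inj]) (simp add: case_prod_beta o_def)
    also have "\<dots> = (\<Sum>j\<in>UNIV. \<Sum>b\<in>B. c (unblock j b) *\<^sub>R unblock j b)"
      by (simp add: sum.cartesian_product)
    also have "block i \<dots> = (\<Sum>j\<in>UNIV. \<Sum>b\<in>B. if i = j then c (unblock j b) *\<^sub>R b else 0)"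
      by (simp add: block_sum block_linear block_unblock if_distrib[of "\<lambda>x. _ *\<^sub>R x"] cong: if_cong)
    also have "\<dots> = (\<Sum>j\<in>UNIV. if i = j then \<Sum>b\<in>B. c (unblock j b) *\<^sub>R b else 0)"
      by (intro sum.cong) auto
    also have "\<dots> = (\<Sum>b\<in>B. c (unblock i b) *\<^sub>R b)" by simp
    finally show ?thesis .
  qed
  show "independent B'"
    unfolding independent_explicit
  proof (intro conjI allI impI ballI fin)
    fix c v assume 0: "(\<Sum>v\<in>B'. c v *\<^sub>R v) = 0" and v: "v \<in> B'"
    then obtain j b where jb: "b \<in> B" "v = unblock j b" unfolding B'_def by auto
    have "(\<Sum>b\<in>B. c (unblock j b) *\<^sub>R b) = 0"
      using blk[of j c] 0 by (simp add: block_linear)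
    hence "\<forall>b\<in>B. c (unblock j b) = 0"
      using B(2)[unfolded independent_explicit, THEN conjunct2, THEN spec, of "\<lambda>b. c (unblock j b)"]
      by simp
    thus "c v = 0" using jb by simp
  qed
  show "(lattice_power L :: (real ^ ('m \<times> 'n)) set) = range (\<lambda>c. \<Sum>b\<in>B'. real_of_int (c b) *\<^sub>R b)"
  proof safe
    fix x :: "real ^ ('m \<times> 'n)" assume "x \<in> lattice_power L"
    hence "\<forall>j. \<exists>c. block j x = (\<Sum>b\<in>B. real_of_int (c b) *\<^sub>R b)"
      unfolding lattice_power_def L by auto
    then obtain cc where cc: "\<And>j. block j x = (\<Sum>b\<in>B. real_of_int (cc j b) *\<^sub>R b)" by metis
    define inv where "inv = inv_into (UNIV \<times> B) (\<lambda>(j :: 'm, b). unblock j b)"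
    define c where "c = (\<lambda>v. cc (fst (inv v)) (snd (inv v)))"
    have "c (unblock j b) = cc j b" if "b \<in> B" for j b
      using inv_into_f_f[OF inj, of "(j, b)"] that by (simp add: c_def inv_def)
    hence "block j x = block j (\<Sum>b\<in>B'. real_of_int (c b) *\<^sub>R b)" for j
      unfolding blk cc by (intro sum.cong) auto
    hence "x = (\<Sum>b\<in>B'. real_of_int (c b) *\<^sub>R b)" by (simp add: vec_eq_blocks_iff)
    thus "x \<in> range (\<lambda>c. \<Sum>b\<in>B'. real_of_int (c b) *\<^sub>R b)" by (intro image_eqI[of _ _ c]) auto
  next
    fix c :: "real ^ ('m \<times> 'n) \<Rightarrow> int"
    show "(\<Sum>b\<in>B'. real_of_int (c b) *\<^sub>R b) \<in> lattice_power L"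
      unfolding lattice_power_def mem_Collect_eq blk L
      by (intro allI image_eqI[of _ _ "\<lambda>b. c (unblock _ b)"]) simp_all
  qed
qed

lemma even_lattice_power:
  assumes "even_lattice L"
  shows "even_lattice (lattice_power L :: (real ^ ('m::finite \<times> 'n::finite)) set)"
  unfolding even_lattice_def
proof (intro conjI ballI)
  obtain B where B: "finite B" "independent B" "L = range (\<lambda>c. \<Sum>b\<in>B. real_of_int (c b) *\<^sub>R b)"
    using assms unfolding even_lattice_def by blast
  show "\<exists>B. finite B \<and> independent B \<and>
      (lattice_power L :: (real ^ ('m \<times> 'n)) set) = range (\<lambda>c. \<Sum>b\<in>B. real_of_int (c b) *\<^sub>R b)"
    using lattice_power_basis[OF B] by blast
  fix x :: "real ^ ('m \<times> 'n)" assume "x \<in> lattice_power L"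
  hence "\<forall>j. \<exists>m::int. block j x \<bullet> block j x = 2 * of_int m"
    using assms unfolding even_lattice_def lattice_power_def by blast
  then obtain m :: "'m \<Rightarrow> int" where "\<And>j. block j x \<bullet> block j x = 2 * of_int (m j)" by metis
  hence "x \<bullet> x = 2 * of_int (\<Sum>j\<in>UNIV. m j)"
    unfolding inner_blocks by (simp add: sum_distrib_left)
  thus "\<exists>m. x \<bullet> x = 2 * real_of_int m" by blast
qed

lemma singular_weight_three_A2: "singular_weight three_A2 = 3"
proof -
  note B = lattice_power_basis[OF A2_basis_independent(1,2) A2_eq_range, where 'm = 3]
  have "dim (lattice_power A2 :: (real ^ (3 \<times> 3)) set) = 6"
    unfolding lattice_basis_dim[OF B(1,2,4)] B(3) A2_basis_independent(3) by simp
  thus ?thesis unfolding singular_weight_def three_A2_eq by simp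
qed

lemma dual_lattice_power_iff:
  fixes L :: "(real ^ 'n::finite) set" and l :: "real ^ ('m::finite \<times> 'n)"
  assumes 0: "0 \<in> L"
  shows "l \<in> dual_lattice (lattice_power L) \<longleftrightarrow> (\<forall>j. block j l \<in> dual_lattice L)"
proof
  assume l: "l \<in> dual_lattice (lattice_power L)"
  show "\<forall>j. block j l \<in> dual_lattice L"
  proof
    fix j
    have "block j l \<in> block j ` span (lattice_power L)" using l by (auto simp: dual_lattice_def)
    also have "\<dots> = span (block j ` lattice_power L)" by (rule linear_span_image[OF linear_block, symmetric])
    also have "\<dots> \<subseteq> span L" by (rule span_mono) (auto simp: lattice_power_def)
    finally have "block j l \<in> span L" .
    moreover have "block j l \<bullet> x \<in> \<int>" if "x \<in> L" for x
    proof -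
      have "unblock j x \<in> lattice_power L" using that 0 by (auto simp: lattice_power_def block_unblock)
      hence "l \<bullet> unblock j x \<in> \<int>" using l by (auto simp: dual_lattice_def)
      moreover have "l \<bullet> unblock j x = block j l \<bullet> x"
        unfolding inner_blocks block_unblock by (simp add: if_distrib[of "inner _"] cong: if_cong)
      ultimately show ?thesis by simp
    qed
    ultimately show "block j l \<in> dual_lattice L" by (simp add: dual_lattice_def)
  qed
next
  assume l: "\<forall>j. block j l \<in> dual_lattice L"
  have "unblock j (block j l) \<in> span (lattice_power L :: (real ^ ('m \<times> 'n)) set)" for j
  proof -
    have "unblock j (block j l) \<in> unblock j ` span L" using l by (auto simp: dual_lattice_def)
    also have "\<dots> = span (unblock j ` L)" by (rule linear_span_image[OF linear_unblock, symmetric])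
    also have "\<dots> \<subseteq> span (lattice_power L)"
      by (rule span_mono) (use 0 in \<open>auto simp: lattice_power_def block_unblock\<close>)
    finally show ?thesis .
  qed
  hence "(\<Sum>j\<in>UNIV. unblock j (block j l)) \<in> span (lattice_power L :: (real ^ ('m \<times> 'n)) set)"
    by (intro span_sum)
  hence "l \<in> span (lattice_power L)" unfolding sum_unblock_block .
  moreover have "l \<bullet> x \<in> \<int>" if "x \<in> lattice_power L" for x
    unfolding inner_blocks using l that by (intro Ints_sum) (auto simp: dual_lattice_def lattice_power_def)
  ultimately show "l \<in> dual_lattice (lattice_power L)" by (simp add: dual_lattice_def)
qed

lemma complexification_power_block:
  assumes "z \<in> complexification (lattice_power L)"
  shows "block j z \<in> complexification L"
  using assms unfolding complexification_def
proof (induction rule: vec.span_induct)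
  case base
  show ?case
    by (rule vec.subspaceI) (auto simp: block_linear intro: vec.span_add vec.span_scale vec.span_zero)
next
  case (step z)
  then obtain x where "x \<in> lattice_power L" "z = cvec x" by auto
  thus ?case by (auto simp: lattice_power_def cvec_block intro!: vec.span_base)
qed

section \<open>Fourier expansions\<close>

text \<open>
  A theta series \<open>\<Sum>l. g l * q ^ ((l, l) / 2) * exp (2 * pi * \<i> * (l, z))\<close> over the dual lattice is a
  Fourier expansion of the required shape, with coefficients on the boundary \<open>2 * n = (l, l)\<close> of
  the admissible region.
\<close>

lemma fourier_expansion_of_dual_sum:
  fixes L :: "(real ^ 'n) set"
  assumes sum: "((\<lambda>l. g l * exp (2 * of_real pi * \<i> * (of_real (l \<bullet> l / 2) * \<tau> + cform (cvec l) z))) has_sum S)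
      (dual_lattice L)"
    and supp: "\<And>l. l \<in> dual_lattice L \<Longrightarrow> g l \<noteq> 0 \<Longrightarrow> l \<bullet> l / 2 \<in> \<rat> \<and> l \<bullet> l / 2 - of_int D / 24 \<in> \<int>"
  shows "((\<lambda>(n, l). (if 2 * n = l \<bullet> l then g l else 0) *
        exp (2 * of_real pi * \<i> * (of_real n * \<tau> + cform (cvec l) z))) has_sum S)
      {(n, l). n \<in> \<rat> \<and> n \<ge> 0 \<and> n - of_int D / 24 \<in> \<int> \<and> l \<in> dual_lattice L \<and> 2 * n - l \<bullet> l \<ge> 0}"
    (is "(?F has_sum S) ?I")
proof -
  define T where "T = {l \<in> dual_lattice L. g l \<noteq> 0}"
  define h where "h = (\<lambda>l :: real ^ 'n. (l \<bullet> l / 2, l))"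
  have "((\<lambda>l. g l * exp (2 * of_real pi * \<i> * (of_real (l \<bullet> l / 2) * \<tau> + cform (cvec l) z))) has_sum S) T"
    using sum by (subst has_sum_cong_neutral[where T = "dual_lattice L"]) (auto simp: T_def)
  hence "((?F \<circ> h) has_sum S) T"
    by (simp add: h_def o_def)
  hence "(?F has_sum S) (h ` T)"
    by (subst has_sum_reindex) (auto simp: h_def inj_on_def)
  moreover have "h ` T \<subseteq> ?I"
    using supp by (auto simp: T_def h_def)
  moreover have "?F p = 0" if "p \<in> ?I - h ` T" for p
  proof -
    obtain n l where p: "p = (n, l)" by (cases p)
    have "(if 2 * n = l \<bullet> l then g l else 0) = 0"
    proof (rule ccontr)
      assume "(if 2 * n = l \<bullet> l then g l else 0) \<noteq> 0"
      hence "n = l \<bullet> l / 2" "g l \<noteq> 0" by (auto split: if_splits)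
      hence "p \<in> h ` T" using that p by (auto simp: T_def h_def)
      thus False using that by simp
    qed
    thus ?thesis unfolding p by simp
  qed
  ultimately show ?thesis
    by (subst has_sum_cong_neutral[where T = "h ` T" and g = ?F]) auto
qed

text \<open>
  The element \<open>l\<close> of the dual lattice with \<open>(l, z) = r * z\<^sub>1 + s * z\<^sub>2\<close> for all \<open>z\<close> with
  coordinate sum zero.
\<close>

definition A2_dual_point :: "int \<times> int \<Rightarrow> real ^ 3" where
  "A2_dual_point = (\<lambda>(r, s). vector [(2 * of_int r - of_int s) / 3, (2 * of_int s - of_int r) / 3,
     - (of_int r + of_int s) / 3])"

lemma dual_lattice_A2: "dual_lattice A2 = range A2_dual_point"
proof safe
  fix l :: "real ^ 3" assume l: "l \<in> dual_lattice A2"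
  have z: "l $ 1 + l $ 2 + l $ 3 = 0" using l by (simp add: dual_lattice_def span_A2)
  have "(vector [1, 0, -1] :: real ^ 3) \<in> A2" "(vector [0, 1, -1] :: real ^ 3) \<in> A2"
    by (auto simp: A2_def forall_3)
  hence "l \<bullet> vector [1, 0, -1] \<in> \<int>" "l \<bullet> vector [0, 1, -1] \<in> \<int>"
    using l by (auto simp: dual_lattice_def)
  hence "l $ 1 - l $ 3 \<in> \<int>" "l $ 2 - l $ 3 \<in> \<int>" by (simp_all add: inner_vec_def sum_3)
  then obtain r s where "l $ 1 - l $ 3 = of_int r" "l $ 2 - l $ 3 = of_int s" by (auto elim!: Ints_cases)
  hence "l = A2_dual_point (r, s)"
    using z by (simp add: A2_dual_point_def vec_eq_iff forall_3)
  thus "l \<in> range A2_dual_point" by blast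
next
  fix r s :: int
  have "A2_dual_point (r, s) \<bullet> x \<in> \<int>" if "x \<in> A2" for x
  proof -
    obtain m n where mn: "x $ 1 = of_int m" "x $ 2 = of_int n"
      using \<open>x \<in> A2\<close> by (auto simp: A2_def elim!: Ints_cases) (metis Ints_cases)
    have "x $ 1 + x $ 2 + x $ 3 = 0" using \<open>x \<in> A2\<close> by (simp add: A2_def)
    hence x3: "x $ 3 = - of_int m - of_int n" using mn by linarith
    have "A2_dual_point (r, s) \<bullet> x = of_int (r * m + s * n)"
      by (simp add: A2_dual_point_def inner_vec_def sum_3 mn x3 field_simps)
    thus ?thesis by simp
  qed
  moreover have "A2_dual_point (r, s) \<in> span A2"
    by (simp add: span_A2 A2_dual_point_def field_simps)
  ultimately show "A2_dual_point (r, s) \<in> dual_lattice A2" by (simp add: dual_lattice_def)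
qed

text \<open>
  The coefficient \<open>A2_sign (r + s)\<close> in terms of \<open>l = A2_dual_point (r, s)\<close>.
\<close>

definition A2_coeff :: "real ^ 3 \<Rightarrow> complex" where
  "A2_coeff l = A2_sign (\<lfloor>l $ 1 - l $ 3\<rfloor> + \<lfloor>l $ 2 - l $ 3\<rfloor>)"

lemma A2_dual_point_diffs:
  "A2_dual_point (r, s) $ 1 - A2_dual_point (r, s) $ 3 = of_int r"
  "A2_dual_point (r, s) $ 2 - A2_dual_point (r, s) $ 3 = of_int s"
  by (simp_all add: A2_dual_point_def field_simps)

lemma A2_coeff_dual_point: "A2_coeff (A2_dual_point (r, s)) = A2_sign (r + s)"
  unfolding A2_coeff_def A2_dual_point_diffs by simp

lemma inj_A2_dual_point: "inj A2_dual_point"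
proof (rule injI)
  fix p q assume "A2_dual_point p = A2_dual_point q"
  thus "p = q" using A2_dual_point_diffs[of "fst p" "snd p"] A2_dual_point_diffs[of "fst q" "snd q"]
    by (simp add: prod_eq_iff)
qed

lemma A2_dual_point_norm:
  "A2_dual_point (r, s) \<bullet> A2_dual_point (r, s) / 2 = of_int (r\<^sup>2 - r * s + s\<^sup>2) / 3"
  by (simp add: A2_dual_point_def inner_vec_def sum_3 field_simps power2_eq_square)

text \<open>
  As \<open>r\<^sup>2 - r * s + s\<^sup>2 \<equiv> (r + s)\<^sup>2 \<equiv> 1\<close> modulo 3 unless 3 divides \<open>r + s\<close>, all exponents of \<open>q\<close> lie
  in \<open>1 / 3 + \<int>\<close>, in accordance with the character \<open>v\<^sub>\<eta>\<^sup>8\<close>.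
\<close>

lemma A2_coeff_support:
  assumes "l \<in> dual_lattice A2" "A2_coeff l \<noteq> 0"
  obtains k :: int where "l \<bullet> l / 2 = of_int k + 1 / 3"
proof -
  obtain r s where l: "l = A2_dual_point (r, s)" using assms(1) by (auto simp: dual_lattice_A2)
  have "\<not> 3 dvd (r + s)" using assms(2) unfolding l A2_coeff_dual_point by (auto simp: A2_sign_def)
  hence "(r + s) mod 3 = 1 \<or> (r + s) mod 3 = 2" by presburger
  hence "(r + s)\<^sup>2 mod 3 = 1" by (auto simp: power2_eq_square mod_mult_eq[of "r + s" 3 "r + s", symmetric])
  moreover have "r\<^sup>2 - r * s + s\<^sup>2 = (r + s)\<^sup>2 - 3 * (r * s)" by (simp add: power2_eq_square algebra_simps)
  ultimately have n: "r\<^sup>2 - r * s + s\<^sup>2 = 3 * ((r + s)\<^sup>2 div 3 - r * s) + 1"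
    using div_mult_mod_eq[of "(r + s)\<^sup>2" 3] by simp
  have "l \<bullet> l / 2 = of_int (3 * ((r + s)\<^sup>2 div 3 - r * s) + 1) / 3"
    unfolding l A2_dual_point_norm n ..
  also have "\<dots> = of_int ((r + s)\<^sup>2 div 3 - r * s) + 1 / 3" by (simp add: field_simps)
  finally show ?thesis by (rule that)
qed

lemma sigma_A2_form_has_sum:
  assumes \<tau>: "Im \<tau> > 0" and z: "z \<in> complexification A2"
  shows "((\<lambda>l. A2_coeff l * exp (2 * of_real pi * \<i> * (of_real (l \<bullet> l / 2) * \<tau> + cform (cvec l) z)))
      has_sum sigma_A2_form \<tau> z) (dual_lattice A2)"
proof -
  let ?F = "\<lambda>l. A2_coeff l * exp (2 * of_real pi * \<i> * (of_real (l \<bullet> l / 2) * \<tau> + cform (cvec l) z))"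
  have F: "?F (A2_dual_point (r, s)) = A2_sign (r + s) * exp (2 * of_real pi * \<i> *
            (of_int (r\<^sup>2 - r * s + s\<^sup>2) / 3 * \<tau> + (of_int r * z $ 1 + of_int s * z $ 2)))" for r s
  proof -
    have "cform (cvec (A2_dual_point (r, s))) z = of_int r * z $ 1 + of_int s * z $ 2"
      by (simp add: cform_def cvec_def A2_dual_point_def sum_3 complexification_A2[OF z] field_simps)
    moreover have "of_real (of_int (r\<^sup>2 - r * s + s\<^sup>2) / 3) = (of_int (r\<^sup>2 - r * s + s\<^sup>2) / 3 :: complex)"
      by simp
    ultimately show ?thesis unfolding A2_coeff_dual_point A2_dual_point_norm by (simp only:)
  qed
  have "((?F \<circ> A2_dual_point) has_sum sigma_A2_form \<tau> z) UNIV"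
  proof -
    have "?F \<circ> A2_dual_point = (\<lambda>(r, s). A2_sign (r + s) * exp (2 * of_real pi * \<i> *
            (of_int (r\<^sup>2 - r * s + s\<^sup>2) / 3 * \<tau> + (of_int r * z $ 1 + of_int s * z $ 2))))"
    proof (rule ext)
      fix p :: "int \<times> int"
      obtain r s where p: "p = (r, s)" by (cases p)
      show "(?F \<circ> A2_dual_point) p = (case p of (r, s) \<Rightarrow> A2_sign (r + s) * exp (2 * of_real pi * \<i> *
            (of_int (r\<^sup>2 - r * s + s\<^sup>2) / 3 * \<tau> + (of_int r * z $ 1 + of_int s * z $ 2))))"
        unfolding p o_apply prod.case by (rule F)
    qed
    thus ?thesis using sigma_A2_has_sum[OF \<tau>, of "z $ 1" "z $ 2"] unfolding sigma_A2_form_def by simp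
  qed
  thus ?thesis unfolding dual_lattice_A2 by (subst has_sum_reindex[OF inj_A2_dual_point])
qed

lemma sigma_A2_form_modular:
  assumes det: "a * d - b * c = 1" and \<tau>: "Im \<tau> > 0" and z: "z \<in> complexification A2"
  shows "sigma_A2_form ((of_int a * \<tau> + of_int b) / (of_int c * \<tau> + of_int d)) ((1 / (of_int c * \<tau> + of_int d)) *s z) =
     eta_multiplier a b c d ^ 8 * (of_int c * \<tau> + of_int d) *
     exp (of_real pi * \<i> * (of_int c * cform z z / (of_int c * \<tau> + of_int d))) * sigma_A2_form \<tau> z"
proof -
  have "cform z z = (z $ 1)\<^sup>2 + (z $ 2)\<^sup>2 + (z $ 1 + z $ 2)\<^sup>2"
    by (simp add: cform_def sum_3 complexification_A2[OF z] power2_eq_square algebra_simps)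
  thus ?thesis using sigma_A2_modular[OF det \<tau>, of "z $ 1" "z $ 2"] by (simp add: sigma_A2_form_def)
qed

lemma A2_coordinates:
  fixes x :: "real ^ 3"
  assumes "x \<in> A2"
  obtains m n :: int where "x $ 1 = of_int m" "x $ 2 = of_int n" "x $ 3 = - of_int (m + n)"
proof -
  obtain m n where mn: "x $ 1 = of_int m" "x $ 2 = of_int n"
    using assms by (auto simp: A2_def elim!: Ints_cases) (metis Ints_cases)
  moreover have "x $ 1 + x $ 2 + x $ 3 = 0" using assms by (simp add: A2_def)
  hence "x $ 3 = - of_int (m + n)" using mn by simp
  ultimately show ?thesis using that by blast
qed

lemma sigma_A2_form_elliptic:
  assumes \<tau>: "Im \<tau> > 0" and z: "z \<in> complexification A2" and x: "x \<in> A2" and y: "y \<in> A2"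
  shows "sigma_A2_form \<tau> (z + \<tau> *s cvec x + cvec y) =
     exp (- of_real pi * \<i> * (cform (cvec x) (cvec x) * \<tau> + 2 * cform (cvec x) z)) * sigma_A2_form \<tau> z"
proof -
  obtain m n where x: "x $ 1 = of_int m" "x $ 2 = of_int n" "x $ 3 = - of_int (m + n)"
    using A2_coordinates[OF x] by blast
  obtain m' n' where y: "y $ 1 = of_int m'" "y $ 2 = of_int n'" "y $ 3 = - of_int (m' + n')"
    using A2_coordinates[OF y] by blast
  have "cform (cvec x) (cvec x) = of_int m ^ 2 + of_int n ^ 2 + of_int (m + n) ^ 2"
    by (simp add: cform_def sum_3 cvec_def x power2_eq_square algebra_simps)
  moreover have "cform (cvec x) z = of_int m * z $ 1 + of_int n * z $ 2 + of_int (m + n) * (z $ 1 + z $ 2)"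
    by (simp add: cform_def sum_3 cvec_def x complexification_A2[OF z] algebra_simps)
  moreover have "sigma_A2_form \<tau> (z + \<tau> *s cvec x + cvec y) =
      sigma_A2 \<tau> (z $ 1 + of_int m * \<tau> + of_int m') (z $ 2 + of_int n * \<tau> + of_int n')"
    by (simp add: sigma_A2_form_def cvec_def x y mult.commute)
  ultimately show ?thesis using sigma_A2_elliptic[OF \<tau>] by (simp only: sigma_A2_form_def)
qed

section \<open>Holomorphy\<close>

text \<open>
  Total differentiability at a point of the full space, with a complex-linear derivative.
\<close>

definition complex_differentiable_at :: "(complex \<Rightarrow> complex ^ 'n \<Rightarrow> complex) \<Rightarrow> complex \<times> (complex ^ 'n) \<Rightarrow> bool" where
  "complex_differentiable_at \<phi> p \<longleftrightarrow> (\<exists>D. ((\<lambda>(\<tau>, z). \<phi> \<tau> z) has_derivative D) (at p) \<and>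
     (\<forall>c t w. D (c * t, c *s w) = c * D (t, w)))"

lemma complex_differentiable_atI:
  assumes "((\<lambda>p. \<phi> (fst p) (snd p)) has_derivative D) (at p)" "\<And>c t w. D (c * t, c *s w) = c * D (t, w)"
  shows "complex_differentiable_at \<phi> p"
  unfolding complex_differentiable_at_def case_prod_beta using assms by blast

lemma complex_differentiable_atE:
  assumes "complex_differentiable_at \<phi> p"
  obtains D where "((\<lambda>p. \<phi> (fst p) (snd p)) has_derivative D) (at p)" "\<And>c t w. D (c * t, c *s w) = c * D (t, w)"
  using assms unfolding complex_differentiable_at_def case_prod_beta by blast

lemma complex_differentiable_imp_holomorphic_on_times:
  assumes "\<And>\<tau> z. \<tau> \<in> S \<Longrightarrow> complex_differentiable_at \<phi> (\<tau>, z)"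
  shows "holomorphic_on_times \<phi> S V"
  unfolding holomorphic_on_times_def
proof
  fix p assume "p \<in> S \<times> V"
  hence "complex_differentiable_at \<phi> p" using assms by auto
  thus "\<exists>D. ((\<lambda>(\<tau>, z). \<phi> \<tau> z) has_derivative D) (at p within S \<times> V) \<and> (\<forall>c t w. D (c * t, c *s w) = c * D (t, w))"
    unfolding complex_differentiable_at_def by (blast intro: has_derivative_at_withinI)
qed

lemma complex_differentiable_mult:
  assumes "complex_differentiable_at f p" "complex_differentiable_at g p"
  shows "complex_differentiable_at (\<lambda>\<tau> z. f \<tau> z * g \<tau> z) p"
proof -
  obtain F where F: "((\<lambda>p. f (fst p) (snd p)) has_derivative F) (at p)"
      "\<And>c t w. F (c * t, c *s w) = c * F (t, w)"
    using assms(1) by (rule complex_differentiable_atE) blast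
  obtain G where G: "((\<lambda>p. g (fst p) (snd p)) has_derivative G) (at p)"
      "\<And>c t w. G (c * t, c *s w) = c * G (t, w)"
    using assms(2) by (rule complex_differentiable_atE) blast
  show ?thesis
    by (rule complex_differentiable_atI[OF has_derivative_mult[OF F(1) G(1)]])
       (simp add: F(2) G(2) algebra_simps)
qed

lemma complex_differentiable_divide:
  assumes "complex_differentiable_at f p" "complex_differentiable_at g p" "g (fst p) (snd p) \<noteq> 0"
  shows "complex_differentiable_at (\<lambda>\<tau> z. f \<tau> z / g \<tau> z) p"
proof -
  obtain F where F: "((\<lambda>p. f (fst p) (snd p)) has_derivative F) (at p)"
      "\<And>c t w. F (c * t, c *s w) = c * F (t, w)"
    using assms(1) by (rule complex_differentiable_atE) blast
  obtain G where G: "((\<lambda>p. g (fst p) (snd p)) has_derivative G) (at p)"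
      "\<And>c t w. G (c * t, c *s w) = c * G (t, w)"
    using assms(2) by (rule complex_differentiable_atE) blast
  show ?thesis
    by (rule complex_differentiable_atI[OF has_derivative_divide'[OF F(1) G(1) assms(3)]])
       (simp add: F(2) G(2) algebra_simps diff_divide_distrib)
qed

lemma complex_differentiable_compose_linear:
  assumes F: "((\<lambda>(\<tau>, w). F \<tau> w) has_derivative (\<lambda>(t, w). A * t + B * w)) (at (\<tau>, l z))"
    and l: "bounded_linear l" "\<And>c w. l (c *s w) = c * l w"
  shows "complex_differentiable_at (\<lambda>\<tau> z. F \<tau> (l z)) (\<tau>, z)"
proof -
  have 1: "((\<lambda>p. (fst p, l (snd p))) has_derivative (\<lambda>h. (fst h, l (snd h)))) (at (\<tau>, z))"
    by (intro has_derivative_Pair has_derivative_fst has_derivative_ident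
        bounded_linear.has_derivative[OF l(1)] has_derivative_snd)
  have 2: "((\<lambda>(\<tau>, w). F \<tau> w) has_derivative (\<lambda>(t, w). A * t + B * w)) (at (fst (\<tau>, z), l (snd (\<tau>, z))))"
    using F by simp
  from has_derivative_compose[OF 1 2]
  have "((\<lambda>p. F (fst p) (l (snd p))) has_derivative (\<lambda>h. A * fst h + B * l (snd h))) (at (\<tau>, z))"
    by simp
  thus ?thesis by (rule complex_differentiable_atI) (simp add: l(2) algebra_simps)
qed

lemma complex_differentiable_theta:
  assumes "Im \<tau> > 0" "bounded_linear l" "\<And>c w. l (c *s w) = c * l w"
  shows "complex_differentiable_at (\<lambda>\<tau> z. jacobi_theta \<tau> (l z)) (\<tau>, z)"
  unfolding jacobi_theta_eq_series
  by (rule complex_differentiable_compose_linear[OF theta_series_has_derivative[OF theta_coeff_exp_bounded assms(1)] assms(2,3)])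

lemma dedekind_eta_has_field_derivative:
  assumes "Im \<tau> > 0"
  shows "\<exists>D. (dedekind_eta has_field_derivative D) (at \<tau>)"
proof -
  have "((\<lambda>\<tau>. \<tau> / 3) has_field_derivative 1 / 3) (at \<tau>)" by (rule DERIV_cdivide[OF DERIV_ident])
  from theta_series_deriv_comp[OF theta_coeff_exp_bounded this DERIV_const[where k = "2 / 3"]] assms
  obtain D where "((\<lambda>\<tau>. jacobi_theta (\<tau> / 3) (2 / 3)) has_field_derivative D) (at \<tau>)"
    unfolding jacobi_theta_eq_series by auto
  from DERIV_cdivide[OF this, of "\<i> * of_real (sqrt 3)"]
  have "((\<lambda>\<tau>. jacobi_theta (\<tau> / 3) (2 / 3) / (\<i> * of_real (sqrt 3))) has_field_derivative
      D / (\<i> * of_real (sqrt 3))) (at \<tau>)" .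
  hence "(dedekind_eta has_field_derivative D / (\<i> * of_real (sqrt 3))) (at \<tau>)"
  proof (rule has_field_derivative_transform_within_open)
    show "open {\<tau>. Im \<tau> > 0}" by (rule open_halfspace_Im_gt)
    fix t assume "t \<in> {\<tau>. Im \<tau> > 0}"
    thus "jacobi_theta (t / 3) (2 / 3) / (\<i> * of_real (sqrt 3)) = dedekind_eta t"
      by (simp add: jacobi_theta_third)
  qed (use assms in simp)
  thus ?thesis by blast
qed

lemma complex_differentiable_eta:
  assumes "Im \<tau> > 0"
  shows "complex_differentiable_at (\<lambda>\<tau> (z :: complex ^ 'n). dedekind_eta \<tau>) (\<tau>, z)"
proof -
  obtain D where "(dedekind_eta has_field_derivative D) (at \<tau>)"
    using dedekind_eta_has_field_derivative[OF assms] by blast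
  hence "(dedekind_eta has_derivative (*) D) (at (fst (\<tau>, z)))" by (simp add: has_field_derivative_def)
  from has_derivative_compose[OF has_derivative_fst[OF has_derivative_ident] this]
  have "((\<lambda>p. dedekind_eta (fst p)) has_derivative (\<lambda>h. D * fst h)) (at (\<tau>, z))" .
  thus ?thesis by (rule complex_differentiable_atI) simp
qed

lemma complex_differentiable_sigma:
  assumes \<tau>: "Im \<tau> > 0" and l: "bounded_linear l1" "\<And>c w. l1 (c *s w) = c * l1 w"
    "bounded_linear l2" "\<And>c w. l2 (c *s w) = c * l2 w"
  shows "complex_differentiable_at (\<lambda>\<tau> z. sigma_A2 \<tau> (l1 z) (l2 z)) (\<tau>, z :: complex ^ 'n)"
  unfolding sigma_A2_def
proof (intro complex_differentiable_divide complex_differentiable_mult complex_differentiable_eta \<tau>)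
  show "complex_differentiable_at (\<lambda>\<tau> z. jacobi_theta \<tau> (l1 z)) (\<tau>, z)"
    "complex_differentiable_at (\<lambda>\<tau> z. jacobi_theta \<tau> (l2 z)) (\<tau>, z)"
    "complex_differentiable_at (\<lambda>\<tau> z. jacobi_theta \<tau> (l1 z + l2 z)) (\<tau>, z)"
    by (rule complex_differentiable_theta[OF \<tau>]; simp add: l bounded_linear_add algebra_simps)+
  show "dedekind_eta (fst (\<tau>, z)) \<noteq> 0" using eta_has_sum(2)[OF \<tau>] by simp
qed

section \<open>The Jacobi forms of singular weight\<close>

theorem sigma_A2_form_jacobi: "sigma_A2_form \<in> jacobi_forms 1 A2 8"
  unfolding jacobi_forms_def mem_Collect_eq
proof (intro conjI allI ballI impI)
  show "holomorphic_on_times sigma_A2_form upper_half_plane (complexification A2)"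
    unfolding sigma_A2_form_def
    by (intro complex_differentiable_imp_holomorphic_on_times complex_differentiable_sigma)
       (auto simp: upper_half_plane_def bounded_linear_vec_nth)
next
  fix a b c d :: int and \<tau> :: complex and z :: "complex ^ 3"
  assume "a * d - b * c = 1" "\<tau> \<in> upper_half_plane" "z \<in> complexification A2"
  from sigma_A2_form_modular[OF this(1) _ this(3), of \<tau>] this(2)
  show "sigma_A2_form ((of_int a * \<tau> + of_int b) / (of_int c * \<tau> + of_int d)) ((1 / (of_int c * \<tau> + of_int d)) *s z) =
     eta_multiplier a b c d powi 8 * (of_int c * \<tau> + of_int d) powr of_real 1 *
     exp (of_real pi * \<i> * (of_int c * cform z z / (of_int c * \<tau> + of_int d))) * sigma_A2_form \<tau> z"
    by (simp add: upper_half_plane_def)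
next
  fix x y :: "real ^ 3" and \<tau> :: complex and z :: "complex ^ 3"
  assume "x \<in> A2" "y \<in> A2" "\<tau> \<in> upper_half_plane" "z \<in> complexification A2"
  thus "sigma_A2_form \<tau> (z + \<tau> *s cvec x + cvec y) =
     exp (- of_real pi * \<i> * (cform (cvec x) (cvec x) * \<tau> + 2 * cform (cvec x) z)) * sigma_A2_form \<tau> z"
    by (intro sigma_A2_form_elliptic) (auto simp: upper_half_plane_def)
next
  have supp: "l \<bullet> l / 2 \<in> \<rat> \<and> l \<bullet> l / 2 - of_int 8 / 24 \<in> \<int>"
    if l: "l \<in> dual_lattice A2" and c: "A2_coeff l \<noteq> 0" for l
  proof -
    obtain k where "l \<bullet> l / 2 = of_int k + 1 / 3" using A2_coeff_support[OF l c] by blast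
    thus ?thesis by (simp only:) simp
  qed
  show "\<exists>f. \<forall>\<tau>\<in>upper_half_plane. \<forall>z\<in>complexification A2.
      ((\<lambda>(n, l). f n l * exp (2 * of_real pi * \<i> * (of_real n * \<tau> + cform (cvec l) z))) has_sum sigma_A2_form \<tau> z)
        {(n, l). n \<in> \<rat> \<and> n \<ge> 0 \<and> n - of_int 8 / 24 \<in> \<int> \<and> l \<in> dual_lattice A2 \<and> 2 * n - l \<bullet> l \<ge> 0}"
    by (intro exI[of _ "\<lambda>n l. if 2 * n = l \<bullet> l then A2_coeff l else 0"] ballI
        fourier_expansion_of_dual_sum[OF sigma_A2_form_has_sum supp])
       (auto simp: upper_half_plane_def)
qed

lemma zero_in_A2: "0 \<in> A2"
  by (simp add: A2_def)

lemma dual_lattice_three_A2: "l \<in> dual_lattice three_A2 \<longleftrightarrow> (\<forall>j. block j l \<in> dual_lattice A2)"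
  unfolding three_A2_eq by (rule dual_lattice_power_iff[OF zero_in_A2])

lemma complexification_three_A2: "z \<in> complexification three_A2 \<Longrightarrow> block j z \<in> complexification A2"
  unfolding three_A2_eq by (rule complexification_power_block)

lemma three_A2_block: "x \<in> three_A2 \<Longrightarrow> block j x \<in> A2"
  unfolding three_A2_eq by (simp add: lattice_power_def)

text \<open>
The coefficient of \<open>sigma_3A2\<close> at a point of the dual lattice.
\<close>

definition three_A2_coeff :: "real ^ (3 \<times> 3) \<Rightarrow> complex" where
  "three_A2_coeff l = A2_coeff (block 1 l) * A2_coeff (block 2 l) * A2_coeff (block 3 l)"

lemma sigma_3A2_has_sum:
  assumes \<tau>: "Im \<tau> > 0" and z: "z \<in> complexification three_A2"
  shows "((\<lambda>l. three_A2_coeff l * exp (2 * of_real pi * \<i> * (of_real (l \<bullet> l / 2) * \<tau> + cform (cvec l) z)))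
      has_sum sigma_3A2 \<tau> z) (dual_lattice three_A2)"
proof -
  define F where "F = (\<lambda>j l. A2_coeff l * exp (2 * of_real pi * \<i> *
      (of_real (l \<bullet> l / 2) * \<tau> + cform (cvec l) (block j z))))"
  let ?D = "dual_lattice A2"
  have F: "(F j has_sum sigma_A2_form \<tau> (block j z)) ?D" for j
    unfolding F_def by (rule sigma_A2_form_has_sum[OF \<tau> complexification_three_A2[OF z]])
  have prod: "((\<lambda>(p, l3). (case p of (l1, l2) \<Rightarrow> F 1 l1 * F 2 l2) * F 3 l3) has_sum sigma_3A2 \<tau> z)
      ((?D \<times> ?D) \<times> ?D)"
    unfolding sigma_3A2_def by (intro has_sum_product F)
  have eq: "F 1 (block 1 l) * F 2 (block 2 l) * F 3 (block 3 l) =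
      three_A2_coeff l * exp (2 * of_real pi * \<i> * (of_real (l \<bullet> l / 2) * \<tau> + cform (cvec l) z))" for l
  proof -
    have comb: "(a * x) * (b * y) * (c * w) = (a * b * c) * (x * y * w)" for a b c x y w :: complex
      by (simp only: mult_ac)
    have "l \<bullet> l = block 1 l \<bullet> block 1 l + block 2 l \<bullet> block 2 l + block 3 l \<bullet> block 3 l"
      by (subst inner_blocks) (simp add: sum_3)
    moreover have "cform (cvec l) z = cform (cvec (block 1 l)) (block 1 z) + cform (cvec (block 2 l)) (block 2 z)
        + cform (cvec (block 3 l)) (block 3 z)"
      by (subst cform_blocks) (simp add: sum_3 cvec_block)
    ultimately show ?thesis
      unfolding F_def three_A2_coeff_def comb mult_exp_exp
      by (intro arg_cong2[of _ _ _ _ "(*)"] refl arg_cong[of _ _ exp]) (simp add: algebra_simps add_divide_distrib)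
  qed
  define join :: "((real ^ 3) \<times> (real ^ 3)) \<times> (real ^ 3) \<Rightarrow> real ^ (3 \<times> 3)"
    where "join = (\<lambda>((l1, l2), l3). unblock 1 l1 + unblock 2 l2 + unblock 3 l3)"
  define split :: "real ^ (3 \<times> 3) \<Rightarrow> ((real ^ 3) \<times> (real ^ 3)) \<times> (real ^ 3)"
    where "split = (\<lambda>l. ((block 1 l, block 2 l), block 3 l))"
  have js: "join (split l) = l" for l
    using sum_unblock_block[of l] by (simp add: sum_3 join_def split_def)
  have sj: "split (join p) = p" for p
    by (cases p) (auto simp: join_def split_def block_linear block_unblock)
  have split_mem: "split l \<in> (?D \<times> ?D) \<times> ?D \<longleftrightarrow> l \<in> dual_lattice three_A2" for l
    by (auto simp: split_def dual_lattice_three_A2 forall_3)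
  have "((\<lambda>l. three_A2_coeff l * exp (2 * of_real pi * \<i> * (of_real (l \<bullet> l / 2) * \<tau> + cform (cvec l) z)))
      has_sum sigma_3A2 \<tau> z) (dual_lattice three_A2) \<longleftrightarrow>
    ((\<lambda>(p, l3). (case p of (l1, l2) \<Rightarrow> F 1 l1 * F 2 l2) * F 3 l3) has_sum sigma_3A2 \<tau> z) ((?D \<times> ?D) \<times> ?D)"
  proof (rule has_sum_reindex_bij_witness[of _ join split])
    fix l :: "real ^ (3 \<times> 3)"
    show "(case split l of (p, l3) \<Rightarrow> (case p of (l1, l2) \<Rightarrow> F 1 l1 * F 2 l2) * F 3 l3) =
        three_A2_coeff l * exp (2 * of_real pi * \<i> * (of_real (l \<bullet> l / 2) * \<tau> + cform (cvec l) z))"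
      unfolding split_def prod.case by (rule eq)
    show "join (split l) = l" by (rule js)
  next
    fix p assume "p \<in> (?D \<times> ?D) \<times> ?D"
    thus "join p \<in> dual_lattice three_A2" using split_mem[of "join p"] unfolding sj by simp
  qed (simp_all only: split_mem sj)
  with prod show ?thesis by simp
qed

theorem sigma_3A2_jacobi: "sigma_3A2 \<in> jacobi_forms 3 three_A2 0"
  unfolding jacobi_forms_def mem_Collect_eq
proof (intro conjI allI ballI impI)
  have bl: "bounded_linear (\<lambda>z :: complex ^ (3 \<times> 3). block j z $ i)" for j i
    by (simp add: block_def bounded_linear_vec_nth)
  have "complex_differentiable_at sigma_3A2 (\<tau>, z)" if "\<tau> \<in> upper_half_plane" for \<tau> z
    unfolding sigma_3A2_def[abs_def] sigma_A2_form_def using that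
    by (intro complex_differentiable_mult complex_differentiable_sigma bl)
       (auto simp: upper_half_plane_def block_def)
  thus "holomorphic_on_times sigma_3A2 upper_half_plane (complexification three_A2)"
    by (rule complex_differentiable_imp_holomorphic_on_times)
next
  fix a b c d :: int and \<tau> :: complex and z :: "complex ^ (3 \<times> 3)"
  assume det: "a * d - b * c = 1" and \<tau>: "\<tau> \<in> upper_half_plane" and z: "z \<in> complexification three_A2"
  define j where "j = of_int c * \<tau> + of_int d"
  define v where "v = eta_multiplier a b c d"
  have \<tau>': "Im \<tau> > 0" using \<tau> by (simp add: upper_half_plane_def)
  have v24: "v ^ 24 = 1" using eta_multiplier_properties[OF det] by (simp add: eta_theta_multiplier_def v_def)
  define X where "X = (\<lambda>i. exp (of_real pi * \<i> * (of_int c * cform (block i z) (block i z) / j)))"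
  have s: "sigma_A2_form ((of_int a * \<tau> + of_int b) / j) (block i ((1 / j) *s z)) =
      v ^ 8 * j * X i * sigma_A2_form \<tau> (block i z)" for i
    unfolding block_linear X_def j_def v_def
    by (rule sigma_A2_form_modular[OF det \<tau>' complexification_three_A2[OF z]])
  have "X 1 * X 2 * X 3 = exp (of_real pi * \<i> * (of_int c * cform z z / j))"
    unfolding X_def mult_exp_exp cform_blocks[of z z]
    by (rule arg_cong[of _ _ exp]) (simp add: sum_3 algebra_simps add_divide_distrib)
  moreover have "sigma_3A2 ((of_int a * \<tau> + of_int b) / j) ((1 / j) *s z) =
      v ^ 24 * j ^ 3 * (X 1 * X 2 * X 3) * sigma_3A2 \<tau> z"
    unfolding sigma_3A2_def s by (simp add: eval_nat_numeral mult_ac)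
  moreover have "j powr of_real 3 = j ^ 3" by simp
  ultimately have "sigma_3A2 ((of_int a * \<tau> + of_int b) / j) ((1 / j) *s z) =
     v powi 0 * j powr of_real 3 * exp (of_real pi * \<i> * (of_int c * cform z z / j)) * sigma_3A2 \<tau> z"
    using v24 by simp
  thus "sigma_3A2 ((of_int a * \<tau> + of_int b) / (of_int c * \<tau> + of_int d)) ((1 / (of_int c * \<tau> + of_int d)) *s z) =
     eta_multiplier a b c d powi 0 * (of_int c * \<tau> + of_int d) powr of_real 3 *
     exp (of_real pi * \<i> * (of_int c * cform z z / (of_int c * \<tau> + of_int d))) * sigma_3A2 \<tau> z"
    unfolding j_def v_def .
next
  fix x y :: "real ^ (3 \<times> 3)" and \<tau> :: complex and z :: "complex ^ (3 \<times> 3)"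
  assume x: "x \<in> three_A2" and y: "y \<in> three_A2" and \<tau>: "\<tau> \<in> upper_half_plane" and z: "z \<in> complexification three_A2"
  define X where "X = (\<lambda>i. exp (- of_real pi * \<i> * (cform (cvec (block i x)) (cvec (block i x)) * \<tau> +
      2 * cform (cvec (block i x)) (block i z))))"
  have s: "sigma_A2_form \<tau> (block i (z + \<tau> *s cvec x + cvec y)) = X i * sigma_A2_form \<tau> (block i z)" for i
    unfolding block_linear cvec_block X_def
    by (rule sigma_A2_form_elliptic[OF _ complexification_three_A2[OF z] three_A2_block[OF x] three_A2_block[OF y]])
       (use \<tau> in \<open>simp add: upper_half_plane_def\<close>)
  have XX: "X 1 * X 2 * X 3 = exp (- of_real pi * \<i> * (cform (cvec x) (cvec x) * \<tau> + 2 * cform (cvec x) z))"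
    unfolding X_def mult_exp_exp cform_blocks[of "cvec x"] cvec_block
    by (rule arg_cong[of _ _ exp]) (simp add: sum_3 algebra_simps)
  show "sigma_3A2 \<tau> (z + \<tau> *s cvec x + cvec y) =
     exp (- of_real pi * \<i> * (cform (cvec x) (cvec x) * \<tau> + 2 * cform (cvec x) z)) * sigma_3A2 \<tau> z"
    unfolding sigma_3A2_def s XX[symmetric] by (simp only: mult_ac)
next
  have supp: "l \<bullet> l / 2 \<in> \<rat> \<and> l \<bullet> l / 2 - of_int 0 / 24 \<in> \<int>"
    if l: "l \<in> dual_lattice three_A2" and c: "three_A2_coeff l \<noteq> 0" for l
  proof -
    have "\<exists>k::int. block j l \<bullet> block j l / 2 = of_int k + 1 / 3" if "A2_coeff (block j l) \<noteq> 0" for j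
    proof -
      have "block j l \<in> dual_lattice A2" using l by (simp add: dual_lattice_three_A2)
      thus ?thesis using A2_coeff_support[OF _ that] by metis
    qed
    moreover have "A2_coeff (block 1 l) \<noteq> 0" "A2_coeff (block 2 l) \<noteq> 0" "A2_coeff (block 3 l) \<noteq> 0"
      using c by (auto simp: three_A2_coeff_def)
    ultimately obtain k1 k2 k3 :: int where "block 1 l \<bullet> block 1 l / 2 = of_int k1 + 1 / 3"
      "block 2 l \<bullet> block 2 l / 2 = of_int k2 + 1 / 3" "block 3 l \<bullet> block 3 l / 2 = of_int k3 + 1 / 3"
      by meson
    moreover have "l \<bullet> l = block 1 l \<bullet> block 1 l + block 2 l \<bullet> block 2 l + block 3 l \<bullet> block 3 l"
      by (subst inner_blocks) (simp add: sum_3)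
    ultimately have "l \<bullet> l / 2 = of_int (k1 + k2 + k3 + 1)" by simp
    thus ?thesis by (simp only:) simp
  qed
  show "\<exists>f. \<forall>\<tau>\<in>upper_half_plane. \<forall>z\<in>complexification three_A2.
      ((\<lambda>(n, l). f n l * exp (2 * of_real pi * \<i> * (of_real n * \<tau> + cform (cvec l) z))) has_sum sigma_3A2 \<tau> z)
        {(n, l). n \<in> \<rat> \<and> n \<ge> 0 \<and> n - of_int 0 / 24 \<in> \<int> \<and> l \<in> dual_lattice three_A2 \<and> 2 * n - l \<bullet> l \<ge> 0}"
    by (intro exI[of _ "\<lambda>n l. if 2 * n = l \<bullet> l then three_A2_coeff l else 0"] ballI
        fourier_expansion_of_dual_sum[OF sigma_3A2_has_sum supp])
       (auto simp: upper_half_plane_def)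
qed

theorem corollary3p4:
  "even_lattice A2 \<and> singular_weight A2 = 1 \<and>
   sigma_A2_form \<in> jacobi_forms 1 A2 8 \<and>
   even_lattice three_A2 \<and> singular_weight three_A2 = 3 \<and>
   sigma_3A2 \<in> jacobi_forms 3 three_A2 0"
  using even_lattice_A2 singular_weight_A2 sigma_A2_form_jacobi even_lattice_power[OF even_lattice_A2]
    singular_weight_three_A2 sigma_3A2_jacobi unfolding three_A2_eq by blast

end
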